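(* Let $\Omega\subset\mathbb{R}^2$ be a Serrin ring domain, or more generally, a capillary ring domain, whose associated solution $u$ is not a paraboloid $u(\mathbf{x})=c-\frac12\|\mathbf{x}-v_0\|^2$, $c\in\mathbb{R}$, $v_0\in\mathbb{R}^2$. Let $g:\mathcal{U}\to\overline\Omega$ be its developing map. Then the meromorphic function $$\eta(z):=\frac{g''(z)}{2g'(z)}$$ is an algebro-geometric potential for the meromorphic mKdV hierarchy.
   Context: $\mathbb{R}^2\equiv\mathbb{C}$, $z=x+iy$. A ring domain is a smooth doubly connected domain $\Omega\subset\mathbb{R}^2$ bounded by two Jordan curves. A curve $\gamma$ is capillary for $u$ if there is a polynomial $P=a+d_1x_1+d_2x_2-\frac c2(x_1^2+x_2^2)$ with real coefficients such that $u=P$ and $\|\nabla(u-P)\|$ is constant along $\gamma$. $\Omega$ is a capillary ring domain if there is a solution $u$ of $\Delta u+2=0$ in $\Omega$ for which both components of $\partial\Omega$ are capillary curves. It is a Serrin ring domain if $u$ and $\partial u/\partial\nu$ are constant on each component of $\partial\Omega$ ($\nu$ the exterior unit normal), with constants possibly depending on the component; Serrin ring domains are capillary. Developing map: a holomorphic bijection $g:\mathcal{U}\to\overline\Omega$ from a quotient band $\mathcal{U}=([s_1,s_2]\times\mathbb{R},\sim)$, $(x,y)\sim(x,y+T)$, for some $s_1<s_2$, $T>0$, sending each curve $\{x=s_j\}$ to a component of $\partial\Omega$. mKdV operators: for a holomorphic (meromorphic) function $\eta(z)$, $Q_n[\eta]$ is determined recursively by $Q_{-1}[\eta]=0$, $Q_0[\eta]=\eta$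 and $Q_{n+1}'-\frac{\eta'}{\eta}Q_{n+1}=Q_n'''-\frac{\eta'}{\eta}Q_n''-4\eta^2Q_n'$, where the free additive term $k_{n+1}\eta$ ($k_{n+1}$ constant) in the solution is always chosen to be zero; thus $Q_n[\eta]$ is a polynomial in $\eta,\dots,\eta^{(2n)}$, homogeneous of weight $2n+1$ when $\eta^{(k)}$ has weight $k+1$. E.g. $Q_1[\eta]=\eta''-2\eta^3$. $\eta$ is an algebro-geometric potential of the mKdV hierarchy if, for some integer $\mathfrak{m}\ge0$, there exist constants $a,c_0,\dots,c_{\mathfrak{m}-1}\in\mathbb{C}$ with $Q_{\mathfrak{m}}[\eta]=a+\sum_{j=0}^{\mathfrak{m}-1}c_jQ_j[\eta]$ (for $\mathfrak{m}=0$: $\eta\equiv a$). *)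

theory Defs
  imports "HOL-Complex_Analysis.Complex_Analysis" "HOL-Library.Poly_Mapping"
begin

text \<open>
  The plane is identified with the type of complex numbers; a gradient
  \<^term>\<open>D\<close> is the complex number with components \<open>u\<^sub>x\<close>, \<open>u\<^sub>y\<close>, so that the differential is
  \<^term>\<open>\<lambda>h. h \<bullet> D\<close> for the real inner product.
\<close>

definition smooth_Jordan_param :: "(real \<Rightarrow> complex) \<Rightarrow> bool"
  where "smooth_Jordan_param \<gamma> \<longleftrightarrow>
    (\<exists>\<Gamma>. \<Gamma> 0 = \<gamma> \<and> (\<forall>n t. (\<Gamma> n has_vector_derivative \<Gamma> (Suc n) t) (at t)) \<and> (\<forall>t. \<Gamma> 1 t \<noteq> 0)) \<and>
    (\<forall>t. \<gamma> (t + 1) = \<gamma> t) \<and> inj_on \<gamma> {0..<1}"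

text \<open>
  A bounded domain whose frontier consists of two disjoint Jordan curves is the region between
  two nested curves, so it is automatically doubly connected.
\<close>

definition ring_domain :: "complex set \<Rightarrow> bool"
  where "ring_domain \<Omega> \<longleftrightarrow> open \<Omega> \<and> connected \<Omega> \<and> bounded \<Omega> \<and>
    (\<exists>\<gamma>\<^sub>1 \<gamma>\<^sub>2. smooth_Jordan_param \<gamma>\<^sub>1 \<and> smooth_Jordan_param \<gamma>\<^sub>2 \<and>
       range \<gamma>\<^sub>1 \<inter> range \<gamma>\<^sub>2 = {} \<and> frontier \<Omega> = range \<gamma>\<^sub>1 \<union> range \<gamma>\<^sub>2)"

text \<open>
  Classical solutions of \<open>\<Delta>u + 2 = 0\<close> that are continuously differentiable up to the boundary.
  On the boundary the derivative is the one within the closed domain.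
\<close>

definition torsion_solution :: "complex set \<Rightarrow> (complex \<Rightarrow> real) \<Rightarrow> bool"
  where "torsion_solution \<Omega> u \<longleftrightarrow>
    (\<exists>G. (\<forall>z\<in>closure \<Omega>. (u has_derivative (\<lambda>h. h \<bullet> G z)) (at z within closure \<Omega>)) \<and>
         continuous_on (closure \<Omega>) G \<and>
         (\<forall>z\<in>\<Omega>. \<exists>G'. (G has_derivative G') (at z) \<and> (\<Sum>b\<in>Basis. G' b \<bullet> b) + 2 = 0))"

definition capillary_poly :: "real \<Rightarrow> real \<Rightarrow> real \<Rightarrow> real \<Rightarrow> complex \<Rightarrow> real"
  where "capillary_poly a d\<^sub>1 d\<^sub>2 c z =
    a + d\<^sub>1 * Re z + d\<^sub>2 * Im z - c / 2 * ((Re z)\<^sup>2 + (Im z)\<^sup>2)"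

definition capillary_curve :: "complex set \<Rightarrow> (complex \<Rightarrow> real) \<Rightarrow> complex set \<Rightarrow> bool"
  where "capillary_curve \<Omega> u C \<longleftrightarrow>
    (\<exists>a d\<^sub>1 d\<^sub>2 c \<kappa>. \<forall>z\<in>C. u z = capillary_poly a d\<^sub>1 d\<^sub>2 c z \<and>
       (\<exists>D. ((\<lambda>w. u w - capillary_poly a d\<^sub>1 d\<^sub>2 c w) has_derivative (\<lambda>h. h \<bullet> D))
              (at z within closure \<Omega>) \<and> norm D = \<kappa>))"

definition capillary_ring_domain :: "complex set \<Rightarrow> (complex \<Rightarrow> real) \<Rightarrow> bool"
  where "capillary_ring_domain \<Omega> u \<longleftrightarrow> ring_domain \<Omega> \<and> torsion_solution \<Omega> u \<and>
    (\<forall>C\<in>components (frontier \<Omega>). capillary_curve \<Omega> u C)"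

definition exterior_unit_normal :: "complex set \<Rightarrow> complex set \<Rightarrow> complex \<Rightarrow> complex \<Rightarrow> bool"
  where "exterior_unit_normal \<Omega> C z \<nu> \<longleftrightarrow> norm \<nu> = 1 \<and>
    (\<exists>\<gamma> t. smooth_Jordan_param \<gamma> \<and> range \<gamma> = C \<and> \<gamma> t = z \<and> vector_derivative \<gamma> (at t) \<bullet> \<nu> = 0) \<and>
    (\<forall>\<^sub>F s in at_right 0. z + s *\<^sub>R \<nu> \<notin> closure \<Omega>)"

definition serrin_curve :: "complex set \<Rightarrow> (complex \<Rightarrow> real) \<Rightarrow> complex set \<Rightarrow> bool"
  where "serrin_curve \<Omega> u C \<longleftrightarrow>
    (\<exists>a \<kappa>. \<forall>z\<in>C. u z = a \<and>
       (\<exists>D \<nu>. (u has_derivative (\<lambda>h. h \<bullet> D)) (at z within closure \<Omega>) \<and>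
          exterior_unit_normal \<Omega> C z \<nu> \<and> \<nu> \<bullet> D = \<kappa>))"

definition serrin_ring_domain :: "complex set \<Rightarrow> (complex \<Rightarrow> real) \<Rightarrow> bool"
  where "serrin_ring_domain \<Omega> u \<longleftrightarrow> ring_domain \<Omega> \<and> torsion_solution \<Omega> u \<and>
    (\<forall>C\<in>components (frontier \<Omega>). serrin_curve \<Omega> u C)"

definition paraboloid_on :: "complex set \<Rightarrow> (complex \<Rightarrow> real) \<Rightarrow> bool"
  where "paraboloid_on \<Omega> u \<longleftrightarrow> (\<exists>c v\<^sub>0. \<forall>z\<in>\<Omega>. u z = c - 1 / 2 * (norm (z - v\<^sub>0))\<^sup>2)"

definition closed_band :: "real \<Rightarrow> real \<Rightarrow> complex set"
  where "closed_band s\<^sub>1 s\<^sub>2 = {z. s\<^sub>1 \<le> Re z \<and> Re z \<le> s\<^sub>2}"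

text \<open>
  A map on the quotient band is given by its lift to the closed band: fibres of the lift are exactly
  the classes modulo \<open>\<i>T\<close>. Holomorphy on the closed band means holomorphic on a neighbourhood
  of each of its points.
\<close>

definition developing_map ::
    "complex set \<Rightarrow> real \<Rightarrow> real \<Rightarrow> real \<Rightarrow> (complex \<Rightarrow> complex) \<Rightarrow> bool"
  where "developing_map \<Omega> s\<^sub>1 s\<^sub>2 T g \<longleftrightarrow> s\<^sub>1 < s\<^sub>2 \<and> 0 < T \<and>
    g analytic_on closed_band s\<^sub>1 s\<^sub>2 \<and>
    (\<forall>z\<in>closed_band s\<^sub>1 s\<^sub>2. \<forall>w\<in>closed_band s\<^sub>1 s\<^sub>2.
       g z = g w \<longleftrightarrow> (\<exists>n::int. w = z + of_int n * of_real T * \<i>)) \<and>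
    g ` closed_band s\<^sub>1 s\<^sub>2 = closure \<Omega> \<and>
    g ` {z. Re z = s\<^sub>1} \<in> components (frontier \<Omega>) \<and>
    g ` {z. Re z = s\<^sub>2} \<in> components (frontier \<Omega>)"

text \<open>
  Differential polynomials in one indeterminate \<open>\<eta>\<close>: polynomials in the jet variables
  \<open>\<eta>, \<eta>', \<eta>'', \<dots>\<close>, where a monomial maps \<open>k\<close> to the exponent of the \<open>k\<close>-th derivative.
\<close>

type_synonym diff_poly = "(nat \<Rightarrow>\<^sub>0 nat) \<Rightarrow>\<^sub>0 complex"

abbreviation jet_var :: "nat \<Rightarrow> diff_poly"
  where "jet_var k \<equiv> Poly_Mapping.single (Poly_Mapping.single k 1) 1"

definition total_deriv :: "diff_poly \<Rightarrow> diff_poly"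
  where "total_deriv p =
    (\<Sum>m\<in>Poly_Mapping.keys p. \<Sum>k\<in>Poly_Mapping.keys m.
       Poly_Mapping.single (m - Poly_Mapping.single k 1 + Poly_Mapping.single (Suc k) 1)
         (Poly_Mapping.lookup p m * of_nat (Poly_Mapping.lookup m k)))"

definition eval_diff_poly :: "diff_poly \<Rightarrow> (complex \<Rightarrow> complex) \<Rightarrow> complex \<Rightarrow> complex"
  where "eval_diff_poly p f z =
    (\<Sum>m\<in>Poly_Mapping.keys p. Poly_Mapping.lookup p m *
       (\<Prod>k\<in>Poly_Mapping.keys m. (deriv ^^ k) f z ^ Poly_Mapping.lookup m k))"

text \<open>
  The differential equation for \<open>Q\<^sub>n\<^sub>+\<^sub>1\<close>, multiplied by \<open>\<eta>\<close>. Its solutions are unique up to a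
  constant multiple of \<open>\<eta>\<close>; the second conjunct sets that free term to zero.
\<close>

definition mkdv_step :: "diff_poly \<Rightarrow> diff_poly \<Rightarrow> bool"
  where "mkdv_step Q R \<longleftrightarrow>
    jet_var 0 * total_deriv R - jet_var 1 * R =
      jet_var 0 * (total_deriv ^^ 3) Q - jet_var 1 * (total_deriv ^^ 2) Q
        - 4 * jet_var 0 ^ 3 * total_deriv Q \<and>
    Poly_Mapping.lookup R (Poly_Mapping.single 0 1) = 0"

primrec mkdv_Q :: "nat \<Rightarrow> diff_poly"
  where
    "mkdv_Q 0 = jet_var 0"
  | "mkdv_Q (Suc n) = (THE R. mkdv_step (mkdv_Q n) R)"

text \<open>
  Points of \<^term>\<open>S\<close> where \<^term>\<open>f\<close> is not analytic are excluded from the identity: they are isolated, and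
  the values of a meromorphic function there carry no meaning.
\<close>

definition algebro_geometric_potential :: "complex set \<Rightarrow> (complex \<Rightarrow> complex) \<Rightarrow> bool"
  where "algebro_geometric_potential S f \<longleftrightarrow> f meromorphic_on S \<and>
    (\<exists>(m::nat) (a::complex) (c::nat \<Rightarrow> complex). \<forall>z\<in>S. f analytic_on {z} \<longrightarrow>
       eval_diff_poly (mkdv_Q m) f z = a + (\<Sum>j<m. c j * eval_diff_poly (mkdv_Q j) f z))"

text \<open>
  The remaining facts show that the recursion is well defined. Existence:
  with \<open>R\<^sub>n' = \<eta> Q\<^sub>n'\<close> one has \<open>Q\<^sub>n\<^sub>+\<^sub>1 = Q\<^sub>n'' - 4 \<eta> R\<^sub>n\<close>, and a quadratic first integral of this linear
  system gives \<open>R\<^sub>n\<close> as a differential polynomial in \<open>Q\<^sub>0, \<dots>, Q\<^sub>n\<close>.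
\<close>

lemma lookup_single_mult:
  fixes p :: diff_poly
  shows "Poly_Mapping.lookup (Poly_Mapping.single a 1 * p) (a + b) = Poly_Mapping.lookup p b"
  by (simp add: lookup_mult lookup_single when_mult)

lemma lookup_single_mult_0:
  fixes p :: diff_poly
  assumes "\<And>b. b \<in> Poly_Mapping.keys p \<Longrightarrow> a + b \<noteq> m"
  shows "Poly_Mapping.lookup (Poly_Mapping.single a 1 * p) m = 0"
proof (rule ccontr)
  assume "Poly_Mapping.lookup (Poly_Mapping.single a 1 * p) m \<noteq> 0"
  then have "m \<in> Poly_Mapping.keys (Poly_Mapping.single a 1 * p)"
    by (simp add: in_keys_iff)
  with keys_mult[of "Poly_Mapping.single a (1::complex)" p] assms show False by fastforce
qed

definition dmon :: "(nat \<Rightarrow>\<^sub>0 nat) \<Rightarrow> diff_poly"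
  where "dmon m = (\<Sum>k\<in>Poly_Mapping.keys m.
       Poly_Mapping.single (m - Poly_Mapping.single k 1 + Poly_Mapping.single (Suc k) 1)
         (of_nat (Poly_Mapping.lookup m k)))"

lemma total_deriv_dmon:
  "total_deriv p = (\<Sum>m\<in>Poly_Mapping.keys p. Poly_Mapping.single 0 (Poly_Mapping.lookup p m) * dmon m)"
  by (simp add: total_deriv_def dmon_def sum_distrib_left mult_single)

lemma total_deriv_superset:
  assumes "finite A" "Poly_Mapping.keys p \<subseteq> A"
  shows "total_deriv p = (\<Sum>m\<in>A. Poly_Mapping.single 0 (Poly_Mapping.lookup p m) * dmon m)"
  unfolding total_deriv_dmon
  by (rule sum.mono_neutral_left) (use assms in \<open>auto simp: in_keys_iff\<close>)

lemma total_deriv_add: "total_deriv (p + q) = total_deriv p + total_deriv q"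
proof -
  let ?A = "Poly_Mapping.keys p \<union> Poly_Mapping.keys q"
  have "finite ?A" by simp
  moreover have "Poly_Mapping.keys (p + q) \<subseteq> ?A" by (rule keys_add)
  ultimately show ?thesis
    by (simp add: total_deriv_superset[of ?A] lookup_add single_add distrib_right sum.distrib)
qed

lemma total_deriv_0 [simp]: "total_deriv 0 = 0"
  by (simp add: total_deriv_def)

lemma total_deriv_uminus: "total_deriv (- p) = - total_deriv p"
  using total_deriv_add[of p "- p"] by (simp add: eq_neg_iff_add_eq_0 add.commute)

lemma total_deriv_diff: "total_deriv (p - q) = total_deriv p - total_deriv q"
  using total_deriv_add[of p "- q"] by (simp add: total_deriv_uminus)

lemma total_deriv_sum: "total_deriv (sum f A) = (\<Sum>x\<in>A. total_deriv (f x))"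
  by (induction A rule: infinite_finite_induct) (auto simp: total_deriv_add)

lemma total_deriv_single: "total_deriv (Poly_Mapping.single m c) = Poly_Mapping.single 0 c * dmon m"
  by (cases "c = 0") (auto simp: total_deriv_dmon)

lemma dmon_superset:
  assumes "finite A" "Poly_Mapping.keys m \<subseteq> A"
  shows "dmon m = (\<Sum>k\<in>A.
       Poly_Mapping.single (m - Poly_Mapping.single k 1 + Poly_Mapping.single (Suc k) 1)
         (of_nat (Poly_Mapping.lookup m k)))"
  unfolding dmon_def
  by (rule sum.mono_neutral_left) (use assms in \<open>auto simp: in_keys_iff\<close>)

lemma minus_single_add:
  fixes m n :: "nat \<Rightarrow>\<^sub>0 nat"
  assumes "Poly_Mapping.lookup m k \<noteq> 0"
  shows "m + n - Poly_Mapping.single k 1 = m - Poly_Mapping.single k 1 + n"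
  by (rule poly_mapping_eqI) (use assms in \<open>auto simp: lookup_add lookup_minus lookup_single when_def\<close>)

lemma dmon_add:
  "dmon (m + n) = Poly_Mapping.single m 1 * dmon n + Poly_Mapping.single n 1 * dmon m"
proof -
  let ?A = "Poly_Mapping.keys m \<union> Poly_Mapping.keys n"
  have A: "finite ?A" "Poly_Mapping.keys (m + n) \<subseteq> ?A" "Poly_Mapping.keys m \<subseteq> ?A" "Poly_Mapping.keys n \<subseteq> ?A"
    using keys_add[of m n] by auto
  have *: "Poly_Mapping.single (m + n - Poly_Mapping.single k 1 + Poly_Mapping.single (Suc k) 1)
         (of_nat (Poly_Mapping.lookup m k)) =
      Poly_Mapping.single n (1::complex) * Poly_Mapping.single (m - Poly_Mapping.single k 1 + Poly_Mapping.single (Suc k) 1)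
         (of_nat (Poly_Mapping.lookup m k))" for m n :: "nat \<Rightarrow>\<^sub>0 nat" and k
  proof (cases "Poly_Mapping.lookup m k = 0")
    case False
    then show ?thesis unfolding minus_single_add[OF False] by (simp add: mult_single ac_simps)
  qed simp
  have "dmon (m + n) = (\<Sum>k\<in>?A.
       Poly_Mapping.single (m + n - Poly_Mapping.single k 1 + Poly_Mapping.single (Suc k) 1)
         (of_nat (Poly_Mapping.lookup m k)) +
       Poly_Mapping.single (n + m - Poly_Mapping.single k 1 + Poly_Mapping.single (Suc k) 1)
         (of_nat (Poly_Mapping.lookup n k)))"
    unfolding dmon_superset[OF A(1,2)]
    by (intro sum.cong refl) (simp add: lookup_add single_add add.commute)
  also have "\<dots> = Poly_Mapping.single m 1 * dmon n + Poly_Mapping.single n 1 * dmon m"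
    unfolding * dmon_superset[OF A(1,3)] dmon_superset[OF A(1,4)]
    by (simp add: sum.distrib sum_distrib_left add.commute)
  finally show ?thesis .
qed

lemma diff_poly_expand:
  "p = (\<Sum>m\<in>Poly_Mapping.keys p. Poly_Mapping.single m (Poly_Mapping.lookup p m))"
  for p :: diff_poly
  by (rule poly_mapping_eqI)
    (auto simp: lookup_sum lookup_single when_def sum.delta in_keys_iff)

lemma total_deriv_mult:
  "total_deriv (p * q) = total_deriv p * q + p * total_deriv q"
proof -
  have mono: "total_deriv (Poly_Mapping.single m a * Poly_Mapping.single n b) =
     total_deriv (Poly_Mapping.single m a) * Poly_Mapping.single n b +
     Poly_Mapping.single m a * total_deriv (Poly_Mapping.single n b)" for m n a b
  proof -
    have s: "Poly_Mapping.single m a = Poly_Mapping.single 0 a * (Poly_Mapping.single m 1 :: diff_poly)"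
      "Poly_Mapping.single n b = Poly_Mapping.single 0 b * (Poly_Mapping.single n 1 :: diff_poly)"
      by (simp_all add: mult_single)
    have ab: "Poly_Mapping.single 0 (a * b) = (Poly_Mapping.single 0 a :: diff_poly) * Poly_Mapping.single 0 b"
      by (simp add: mult_single)
    have ring: "x * y * (v * n' + w * m') = x * m' * (y * w) + (x * v) * (y * n')"
      for x y v w m' n' :: diff_poly
      by (simp only: distrib_left mult.assoc mult.commute mult.left_commute add.commute)
    have "total_deriv (Poly_Mapping.single m a * Poly_Mapping.single n b) =
        Poly_Mapping.single 0 (a * b) *
          (Poly_Mapping.single m 1 * dmon n + Poly_Mapping.single n 1 * dmon m)"
      by (simp only: mult_single total_deriv_single dmon_add)
    also have "\<dots> = Poly_Mapping.single 0 a * dmon m * (Poly_Mapping.single 0 b * Poly_Mapping.single n 1)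
        + Poly_Mapping.single 0 a * Poly_Mapping.single m 1 * (Poly_Mapping.single 0 b * dmon n)"
      unfolding ab by (rule ring)
    finally show ?thesis unfolding total_deriv_single s[symmetric] .
  qed
  have "total_deriv (p * q) = (\<Sum>m\<in>Poly_Mapping.keys p. \<Sum>n\<in>Poly_Mapping.keys q.
      total_deriv (Poly_Mapping.single m (Poly_Mapping.lookup p m) * Poly_Mapping.single n (Poly_Mapping.lookup q n)))"
    unfolding total_deriv_sum[symmetric] sum_product[symmetric]
    by (simp only: diff_poly_expand[of p, symmetric] diff_poly_expand[of q, symmetric])
  also have "\<dots> = total_deriv (\<Sum>m\<in>Poly_Mapping.keys p. Poly_Mapping.single m (Poly_Mapping.lookup p m)) *
        (\<Sum>m\<in>Poly_Mapping.keys q. Poly_Mapping.single m (Poly_Mapping.lookup q m)) +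
      (\<Sum>m\<in>Poly_Mapping.keys p. Poly_Mapping.single m (Poly_Mapping.lookup p m)) *
        total_deriv (\<Sum>m\<in>Poly_Mapping.keys q. Poly_Mapping.single m (Poly_Mapping.lookup q m))"
    by (simp add: mono sum_product total_deriv_sum sum.distrib)
  also have "\<dots> = total_deriv p * q + p * total_deriv q"
    by (simp only: diff_poly_expand[of p, symmetric] diff_poly_expand[of q, symmetric])
  finally show ?thesis .
qed


lemma total_deriv_var: "total_deriv (jet_var k) = jet_var (Suc k)"
  by (simp add: total_deriv_single dmon_def mult_single)

lemma dmon_lookup:
  "Poly_Mapping.lookup (dmon m) n = (\<Sum>k\<in>Poly_Mapping.keys m.
      of_nat (Poly_Mapping.lookup m k) when
        m - Poly_Mapping.single k 1 + Poly_Mapping.single (Suc k) 1 = n)"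
  by (simp add: dmon_def lookup_sum lookup_single)

lemma lookup_total_deriv:
  "Poly_Mapping.lookup (total_deriv p) n = (\<Sum>m\<in>Poly_Mapping.keys p. \<Sum>k\<in>Poly_Mapping.keys m.
      Poly_Mapping.lookup p m * of_nat (Poly_Mapping.lookup m k) when
        m - Poly_Mapping.single k 1 + Poly_Mapping.single (Suc k) 1 = n)"
  by (simp add: total_deriv_def lookup_sum lookup_single)

lemma lookup_total_deriv_top:
  assumes bd: "\<And>n k. n \<in> Poly_Mapping.keys p \<Longrightarrow> k \<in> Poly_Mapping.keys n \<Longrightarrow> k \<le> K"
    and m: "m \<in> Poly_Mapping.keys p" "K \<in> Poly_Mapping.keys m"
  shows "Poly_Mapping.lookup (total_deriv p)
      (m - Poly_Mapping.single K 1 + Poly_Mapping.single (Suc K) 1) =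
      Poly_Mapping.lookup p m * of_nat (Poly_Mapping.lookup m K)"
proof -
  let ?sh = "\<lambda>n k. n - Poly_Mapping.single k 1 + Poly_Mapping.single (Suc k) (1::nat)"
  have eq: "n = m \<and> k = K"
    if n: "n \<in> Poly_Mapping.keys p" "k \<in> Poly_Mapping.keys n" and e: "?sh n k = ?sh m K" for n k
  proof -
    have z: "Poly_Mapping.lookup n (Suc K) = 0" if "n \<in> Poly_Mapping.keys p" for n
      using bd[OF that, of "Suc K"] by (auto simp: in_keys_iff)
    have "Poly_Mapping.lookup (?sh n k) (Suc K) = Poly_Mapping.lookup (?sh m K) (Suc K)"
      using e by simp
    then have "k = K"
      using z[OF n(1)] z[OF m(1)]
      by (auto simp: lookup_add lookup_minus lookup_single when_def split: if_splits)
    moreover have "n = m"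
    proof (rule poly_mapping_eqI)
      fix i
      have "Poly_Mapping.lookup (?sh n k) i = Poly_Mapping.lookup (?sh m K) i"
        using e by simp
      then show "Poly_Mapping.lookup n i = Poly_Mapping.lookup m i"
        using n(2) m(2) \<open>k = K\<close>
        by (auto simp: lookup_add lookup_minus lookup_single when_def in_keys_iff split: if_splits)
    qed
    ultimately show ?thesis by simp
  qed
  have "Poly_Mapping.lookup (total_deriv p) (?sh m K) = (\<Sum>n\<in>Poly_Mapping.keys p. \<Sum>k\<in>Poly_Mapping.keys n.
      if n = m then if k = K then Poly_Mapping.lookup p m * of_nat (Poly_Mapping.lookup m K) else 0 else 0)"
    unfolding lookup_total_deriv
  proof (intro sum.cong refl)
    fix n k assume n: "n \<in> Poly_Mapping.keys p" "k \<in> Poly_Mapping.keys n"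
    show "(Poly_Mapping.lookup p n * of_nat (Poly_Mapping.lookup n k) when ?sh n k = ?sh m K) =
      (if n = m then if k = K then Poly_Mapping.lookup p m * of_nat (Poly_Mapping.lookup m K) else 0 else 0)"
      using eq[OF n] by (cases "?sh n k = ?sh m K") auto
  qed
  also have "\<dots> = (\<Sum>n\<in>Poly_Mapping.keys p. if n = m then \<Sum>k\<in>Poly_Mapping.keys n.
      if k = K then Poly_Mapping.lookup p m * of_nat (Poly_Mapping.lookup m K) else 0 else 0)"
    by (intro sum.cong refl) auto
  also have "\<dots> = Poly_Mapping.lookup p m * of_nat (Poly_Mapping.lookup m K)"
    using m by (simp add: sum.delta)
  finally show ?thesis .
qed

lemma mkdv_kernel:
  assumes eq: "jet_var 0 * total_deriv R = jet_var 1 * R"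
    and c: "Poly_Mapping.lookup R (Poly_Mapping.single 0 1) = 0"
  shows "R = 0"
proof (rule ccontr)
  assume "R \<noteq> 0"
  then have ne: "Poly_Mapping.keys R \<noteq> {}" by simp
  let ?I = "insert 0 (\<Union>m\<in>Poly_Mapping.keys R. Poly_Mapping.keys m)"
  have fin: "finite ?I" by simp
  define K where "K = Max ?I"
  have bd: "k \<le> K" if "n \<in> Poly_Mapping.keys R" "k \<in> Poly_Mapping.keys n" for n k
    unfolding K_def using that by (intro Max_ge[OF fin]) auto
  have top: "Poly_Mapping.lookup (jet_var 1 * R)
      (Poly_Mapping.single 0 1 + (m - Poly_Mapping.single K 1 + Poly_Mapping.single (Suc K) 1)) =
      Poly_Mapping.lookup R m * of_nat (Poly_Mapping.lookup m K)"
    if "m \<in> Poly_Mapping.keys R" "K \<in> Poly_Mapping.keys m" for m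
    unfolding eq[symmetric] lookup_single_mult
    by (rule lookup_total_deriv_top) (use bd that in auto)
  show False
  proof (cases "K = 0")
    case False
    have "K \<in> ?I" unfolding K_def using fin by (intro Max_in) auto
    with False obtain m where m: "m \<in> Poly_Mapping.keys R" "K \<in> Poly_Mapping.keys m" by auto
    have "Poly_Mapping.lookup (jet_var 1 * R)
        (Poly_Mapping.single 0 1 + (m - Poly_Mapping.single K 1 + Poly_Mapping.single (Suc K) 1)) = 0"
    proof (rule lookup_single_mult_0)
      fix b assume b: "b \<in> Poly_Mapping.keys R"
      have "Suc K \<notin> Poly_Mapping.keys b" "Suc K \<notin> Poly_Mapping.keys m"
        using bd[OF b, of "Suc K"] bd[OF m(1), of "Suc K"] by auto
      then have "Poly_Mapping.lookup (Poly_Mapping.single 1 1 + b) (Suc K) \<noteq>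
        Poly_Mapping.lookup (Poly_Mapping.single 0 1 +
          (m - Poly_Mapping.single K 1 + Poly_Mapping.single (Suc K) 1)) (Suc K)"
        using False by (auto simp: lookup_add lookup_minus lookup_single when_def in_keys_iff)
      then show "Poly_Mapping.single 1 1 + b \<noteq> Poly_Mapping.single 0 1 +
          (m - Poly_Mapping.single K 1 + Poly_Mapping.single (Suc K) 1)" by metis
    qed
    then show False using top[OF m] m by (simp add: in_keys_iff)
  next
    case True
    obtain m where m: "m \<in> Poly_Mapping.keys R" using ne by blast
    have m0: "Poly_Mapping.lookup m i = 0" if "i \<noteq> 0" for i
      using bd[OF m, of i] True that by (auto simp: in_keys_iff)
    show False
    proof (cases "0 \<in> Poly_Mapping.keys m")
      case T: True
      have "Poly_Mapping.single 0 1 + (m - Poly_Mapping.single K 1 + Poly_Mapping.single (Suc K) 1) =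
        Poly_Mapping.single 1 1 + m"
        by (rule poly_mapping_eqI)
          (use T True in \<open>auto simp: lookup_add lookup_minus lookup_single when_def in_keys_iff\<close>)
      with top[OF m] T True
      have "Poly_Mapping.lookup R m = Poly_Mapping.lookup R m * of_nat (Poly_Mapping.lookup m 0)"
        by (simp only: lookup_single_mult)
      then have "of_nat (Poly_Mapping.lookup m 0) = (1::complex)" using m by (simp add: in_keys_iff)
      then have "Poly_Mapping.lookup m 0 = 1" by simp
      then have "m = Poly_Mapping.single 0 1"
        by (intro poly_mapping_eqI) (use m0 in \<open>auto simp: lookup_single when_def\<close>)
      then show False using m c by (simp add: in_keys_iff)
    next
      case F: False
      have "Poly_Mapping.lookup (jet_var 0 * total_deriv R) (Poly_Mapping.single 1 1 + m) = 0"
      proof (rule lookup_single_mult_0)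
        fix b
        show "Poly_Mapping.single 0 1 + b \<noteq> Poly_Mapping.single 1 1 + m"
        proof
          assume "Poly_Mapping.single 0 1 + b = Poly_Mapping.single 1 1 + m"
          then have "Poly_Mapping.lookup (Poly_Mapping.single 0 1 + b) 0 =
            Poly_Mapping.lookup (Poly_Mapping.single 1 1 + m) 0" by simp
          then show False using F by (simp add: lookup_add lookup_single in_keys_iff)
        qed
      qed
      then show False unfolding eq lookup_single_mult using m by (simp add: in_keys_iff)
    qed
  qed
qed

lemma mkdv_step_unique:
  assumes "mkdv_step Q R" "mkdv_step Q S"
  shows "R = S"
proof -
  have "jet_var 0 * total_deriv R - jet_var 1 * R = jet_var 0 * total_deriv S - jet_var 1 * S"
    using assms by (simp add: mkdv_step_def)
  then have "jet_var 0 * total_deriv (R - S) = jet_var 1 * (R - S)"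
    by (simp add: total_deriv_diff right_diff_distrib) (simp add: algebra_simps)
  moreover have "Poly_Mapping.lookup (R - S) (Poly_Mapping.single 0 1) = 0"
    using assms by (simp add: mkdv_step_def lookup_minus)
  ultimately show ?thesis using mkdv_kernel[of "R - S"] by simp
qed

function mkdv_seq :: "nat \<Rightarrow> diff_poly" and mkdv_int :: "nat \<Rightarrow> diff_poly"
  where
    "mkdv_seq 0 = jet_var 0"
  | "mkdv_seq (Suc n) = (total_deriv ^^ 2) (mkdv_seq n) - 4 * jet_var 0 * mkdv_int n"
  | "mkdv_int n = Poly_Mapping.single 0 (1/2) *
      ((\<Sum>i\<le>n. mkdv_seq i * mkdv_seq (n - i)) -
       (\<Sum>i<n. total_deriv (mkdv_seq i) * total_deriv (mkdv_seq (n - 1 - i)) - 4 * mkdv_int i * mkdv_int (n - 1 - i)))"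
  by pat_completeness auto
termination
  by (relation "Wellfounded.measure (case_sum (\<lambda>n. 2 * n) (\<lambda>n. 2 * n + 1))") auto

lemma total_deriv_const: "total_deriv (Poly_Mapping.single 0 c) = 0"
  by (simp add: total_deriv_single dmon_def)

lemma total_deriv_numeral [simp]: "total_deriv (numeral w) = 0"
  using total_deriv_const[of "numeral w"] by simp

lemma total_deriv_numeral_mult [simp]:
  "total_deriv (numeral w * p) = numeral w * total_deriv p"
  by (simp add: total_deriv_mult)

declare mkdv_seq.simps(2) [simp del] mkdv_int.simps [simp del]

lemma total_deriv_mkdv_int: "total_deriv (mkdv_int n) = jet_var 0 * total_deriv (mkdv_seq n)"
proof (induction n rule: less_induct)
  case (less n)
  let ?d = total_deriv
  have qs: "?d (?d (mkdv_seq i)) = mkdv_seq (Suc i) + 4 * jet_var 0 * mkdv_int i" for i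
    by (simp add: mkdv_seq.simps(2) numeral_2_eq_2)
  have rv: "(\<Sum>i\<le>n. f i (n - i)) = (\<Sum>i\<le>n. f (n - i) i)" for f :: "nat \<Rightarrow> nat \<Rightarrow> diff_poly"
    by (rule sum.reindex_bij_witness[of _ "\<lambda>i. n - i" "\<lambda>i. n - i"]) auto
  have rv': "(\<Sum>i<n. f i (n - 1 - i)) = (\<Sum>i<n. f (n - 1 - i) i)" for f :: "nat \<Rightarrow> nat \<Rightarrow> diff_poly"
    by (rule sum.reindex_bij_witness[of _ "\<lambda>i. n - 1 - i" "\<lambda>i. n - 1 - i"]) auto
  have A: "?d (\<Sum>i\<le>n. mkdv_seq i * mkdv_seq (n - i)) = 2 * (\<Sum>i\<le>n. mkdv_seq i * ?d (mkdv_seq (n - i)))"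
    using rv[of "\<lambda>i j. ?d (mkdv_seq i) * mkdv_seq j"]
    by (simp add: total_deriv_sum total_deriv_mult sum.distrib mult.commute)
  have B: "?d (\<Sum>i<n. ?d (mkdv_seq i) * ?d (mkdv_seq (n - 1 - i)) - 4 * mkdv_int i * mkdv_int (n - 1 - i)) =
     2 * (\<Sum>i<n. mkdv_seq (Suc i) * ?d (mkdv_seq (n - 1 - i)))"
  proof -
    have "?d (\<Sum>i<n. ?d (mkdv_seq i) * ?d (mkdv_seq (n - 1 - i)) - 4 * mkdv_int i * mkdv_int (n - 1 - i)) =
      (\<Sum>i<n. ?d (?d (mkdv_seq i)) * ?d (mkdv_seq (n - 1 - i))) + (\<Sum>i<n. ?d (mkdv_seq i) * ?d (?d (mkdv_seq (n - 1 - i))))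
      - (4 * (\<Sum>i<n. ?d (mkdv_int i) * mkdv_int (n - 1 - i)) + 4 * (\<Sum>i<n. mkdv_int i * ?d (mkdv_int (n - 1 - i))))"
      by (simp add: total_deriv_sum total_deriv_mult total_deriv_diff sum.distrib sum_subtractf
         sum_distrib_left mult.assoc distrib_left)
    also have "(\<Sum>i<n. ?d (mkdv_seq i) * ?d (?d (mkdv_seq (n - 1 - i)))) = (\<Sum>i<n. ?d (?d (mkdv_seq i)) * ?d (mkdv_seq (n - 1 - i)))"
      using rv'[of "\<lambda>i j. ?d (mkdv_seq i) * ?d (?d (mkdv_seq j))"] by (simp add: mult.commute)
    also have "(\<Sum>i<n. ?d (mkdv_int i) * mkdv_int (n - 1 - i)) = (\<Sum>i<n. mkdv_int i * ?d (mkdv_int (n - 1 - i)))"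
      using rv'[of "\<lambda>i j. ?d (mkdv_int i) * mkdv_int j"] by (simp add: mult.commute)
    also have "(\<Sum>i<n. mkdv_int i * ?d (mkdv_int (n - 1 - i))) = (\<Sum>i<n. mkdv_int i * (jet_var 0 * ?d (mkdv_seq (n - 1 - i))))"
      by (intro sum.cong refl) (simp add: less)
    also have "(\<Sum>i<n. ?d (?d (mkdv_seq i)) * ?d (mkdv_seq (n - 1 - i))) =
       (\<Sum>i<n. mkdv_seq (Suc i) * ?d (mkdv_seq (n - 1 - i))) + 4 * (\<Sum>i<n. mkdv_int i * (jet_var 0 * ?d (mkdv_seq (n - 1 - i))))"
      by (simp add: qs distrib_right sum.distrib sum_distrib_left mult.assoc mult.left_commute)
    finally show ?thesis by (simp add: algebra_simps)
  qed
  have C: "(\<Sum>i\<le>n. mkdv_seq i * ?d (mkdv_seq (n - i))) =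
      jet_var 0 * ?d (mkdv_seq n) + (\<Sum>i<n. mkdv_seq (Suc i) * ?d (mkdv_seq (n - 1 - i)))"
    by (subst sum.atMost_shift) simp
  have half: "Poly_Mapping.single 0 (1/2) * (2 * p) = (p :: diff_poly)" for p
  proof -
    have "Poly_Mapping.single 0 (1/2) * (2 :: diff_poly) = 1"
      using mult_single[of 0 "1/2" 0 "2::complex"] by simp
    then show ?thesis by (simp flip: mult.assoc)
  qed
  have "?d (mkdv_int n) = Poly_Mapping.single 0 (1/2) *
    (?d (\<Sum>i\<le>n. mkdv_seq i * mkdv_seq (n - i)) -
     ?d (\<Sum>i<n. ?d (mkdv_seq i) * ?d (mkdv_seq (n - 1 - i)) - 4 * mkdv_int i * mkdv_int (n - 1 - i)))"
    by (subst mkdv_int.simps) (simp only: total_deriv_mult total_deriv_const total_deriv_diff, simp)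
  also have "\<dots> = Poly_Mapping.single 0 (1/2) * (2 * (jet_var 0 * ?d (mkdv_seq n)))"
    unfolding A B C by (simp add: algebra_simps)
  finally show ?case by (simp only: half)
qed

lemma lookup_0_mult: "Poly_Mapping.lookup (p * q) 0 = Poly_Mapping.lookup p 0 * Poly_Mapping.lookup q (0 :: nat \<Rightarrow>\<^sub>0 nat)"
  for p q :: diff_poly
proof -
  have *: "(0 = a + b) = (a = 0 \<and> b = 0)" for a b :: "nat \<Rightarrow>\<^sub>0 nat"
    by (auto simp: poly_mapping_eq_iff lookup_add fun_eq_iff)
  show ?thesis
    unfolding lookup_mult *
    by (simp add: when_when[symmetric] Sum_any_when_independent mult_when del: when_when)
qed

lemma lookup_total_deriv_0:
  assumes "\<And>k. Poly_Mapping.lookup n (Suc k) = 0"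
  shows "Poly_Mapping.lookup (total_deriv p) n = 0"
proof -
  have "m - Poly_Mapping.single k 1 + Poly_Mapping.single (Suc k) 1 \<noteq> n" for m k
  proof
    assume "m - Poly_Mapping.single k 1 + Poly_Mapping.single (Suc k) 1 = n"
    then have "Poly_Mapping.lookup n (Suc k) \<noteq> 0"
      by (auto simp: lookup_add)
    with assms show False by simp
  qed
  then show ?thesis by (simp add: lookup_total_deriv)
qed

lemma mkdv_seq_int_0: "Poly_Mapping.lookup (mkdv_seq n) 0 = 0" "Poly_Mapping.lookup (mkdv_int n) 0 = 0"
proof (induction n and n rule: mkdv_seq_mkdv_int.induct)
  case 1
  have "Poly_Mapping.single 0 1 \<noteq> (0 :: nat \<Rightarrow>\<^sub>0 nat)"
    by (metis lookup_single_eq lookup_zero one_neq_zero)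
  then show ?case by (simp add: lookup_single when_def)
next
  case (2 n)
  then show ?case
    by (simp add: mkdv_seq.simps(2) numeral_2_eq_2 lookup_minus lookup_0_mult lookup_total_deriv_0)
next
  case (3 n)
  show ?case
    by (subst mkdv_int.simps) (use 3 in \<open>auto simp: lookup_sum lookup_0_mult lookup_minus lookup_total_deriv_0\<close>)
qed

lemma mkdv_step_seq: "mkdv_step (mkdv_seq n) (mkdv_seq (Suc n))"
  unfolding mkdv_step_def
proof
  let ?x = "jet_var 0"
  have d3: "(total_deriv ^^ 3) p = total_deriv (total_deriv (total_deriv p))" for p
    by (simp add: numeral_3_eq_3)
  have d2: "(total_deriv ^^ 2) p = total_deriv (total_deriv p)" for p
    by (simp add: numeral_2_eq_2)
  show "?x * total_deriv (mkdv_seq (Suc n)) - jet_var 1 * mkdv_seq (Suc n) =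
    ?x * (total_deriv ^^ 3) (mkdv_seq n) - jet_var 1 * (total_deriv ^^ 2) (mkdv_seq n) - 4 * ?x ^ 3 * total_deriv (mkdv_seq n)"
    unfolding mkdv_seq.simps(2) d2 d3 total_deriv_diff mult.assoc total_deriv_numeral_mult
      total_deriv_mult total_deriv_mkdv_int One_nat_def total_deriv_var[unfolded One_nat_def]
      total_deriv_numeral mult_zero_left add_0_left add_0_right
    by (simp only: algebra_simps power3_eq_cube)
  have "Poly_Mapping.lookup (jet_var 0 * mkdv_int n) (Poly_Mapping.single 0 1 + 0) = 0"
    unfolding lookup_single_mult by (rule mkdv_seq_int_0)
  then have z: "Poly_Mapping.lookup (jet_var 0 * mkdv_int n) (Poly_Mapping.single 0 1) = 0"
    by (simp only: add_0_right)
  have four: "4 * jet_var 0 * mkdv_int n =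
      jet_var 0 * mkdv_int n + jet_var 0 * mkdv_int n + jet_var 0 * mkdv_int n + jet_var 0 * mkdv_int n"
    by (simp add: mult.assoc)
  have "Poly_Mapping.lookup (total_deriv p) (Poly_Mapping.single 0 1) = 0" for p
    by (rule lookup_total_deriv_0) (simp add: lookup_single)
  then show "Poly_Mapping.lookup (mkdv_seq (Suc n)) (Poly_Mapping.single 0 1) = 0"
    by (simp only: mkdv_seq.simps(2) d2 four lookup_minus lookup_add z) simp
qed

lemma mkdv_Q_eq_seq: "mkdv_Q n = mkdv_seq n"
proof (induction n)
  case (Suc n)
  have "(THE R. mkdv_step (mkdv_seq n) R) = mkdv_seq (Suc n)"
    using mkdv_step_seq mkdv_step_unique by blast
  then show ?case by (simp add: Suc)
qed simp

theorem mkdv_step_mkdv_Q: "mkdv_step (mkdv_Q n) R \<longleftrightarrow> R = mkdv_Q (Suc n)"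
  unfolding mkdv_Q_eq_seq using mkdv_step_seq mkdv_step_unique by blast

lemma mkdv_Q_1: "mkdv_Q 1 = jet_var 2 - 2 * jet_var 0 ^ 3"
proof -
  have "(4::diff_poly) * Poly_Mapping.single 0 (1/2) = 2"
    by (simp add: mult_single flip: single_numeral)
  moreover have "4 * (x * (h * y)) = (4 * h) * (x * y)" for x h y :: diff_poly
    by (simp only: mult.assoc mult.commute mult.left_commute)
  ultimately have four: "(4::diff_poly) * (x * (Poly_Mapping.single 0 (1/2) * y)) = 2 * (x * y)" for x y
    by (simp only:)
  have int0: "mkdv_int 0 = Poly_Mapping.single 0 (1/2) * (jet_var 0 * jet_var 0)"
    by (subst mkdv_int.simps) (simp del: mult_single)
  have "mkdv_Q 1 = (total_deriv ^^ 2) (jet_var 0) - 2 * (jet_var 0 * (jet_var 0 * jet_var 0))"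
    unfolding mkdv_Q_eq_seq One_nat_def mkdv_seq.simps int0 mult.assoc four ..
  also have "(total_deriv ^^ 2) (jet_var 0) = jet_var 2"
    by (simp only: numeral_2_eq_2 funpow.simps o_apply id_apply total_deriv_var)
  finally show ?thesis by (simp only: power3_eq_cube mult.assoc)
qed

end

theory Submission
  imports Defs
begin

text \<open>
  Since \<open>\<Delta>u + 2 = 0\<close>, the gradient of \<open>u\<close> is encoded by the holomorphic function
  \<open>h = u\<^sub>x - \<i>u\<^sub>y + x - \<i>y\<close>; put \<open>H = h \<circ> g\<close>. The capillary condition on a boundary line makes the Hopf
  differential \<open>H' g'\<close> real there, so by the maximum principle it is a constant \<open>\<tau>\<close>, and \<open>\<tau> \<noteq> 0\<close>
  unless \<open>u\<close> is a paraboloid. In particular \<open>g'\<close> has no zeros on the boundary. Eliminating \<open>H\<close>,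
  each line satisfies either \<open>Im \<eta> = 0\<close> (then \<open>Im Q\<^sub>n[\<eta>] = 0\<close> too) or, for \<open>\<omega> = log |g'|\<close>, a sinh-Gordon type condition
  \<open>\<omega>\<^sub>x = a exp (-\<omega>) + b exp \<omega>\<close>. The linearisation of the latter is a Robin condition \<open>Im F' = p Im F\<close> for
  holomorphic functions \<open>F\<close>, and the mKdV recursion shows that every \<open>Q\<^sub>n[\<eta>]\<close> satisfies it.

  The periodic holomorphic functions with these boundary conditions form a finite-dimensional real
  space: reflection bounds \<open>|F|\<close> slightly outside the band by \<open>7 max |F|\<close>, so by Cauchy's estimates
  \<open>F\<close> vanishes as soon as it vanishes to fourth order at finitely many points that are independent
  of \<open>F\<close>. Hence some nontrivial real combination of the \<open>Q\<^sub>n[\<eta>]\<close> is zero.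
\<close>

section \<open>Evaluation of differential polynomials\<close>

text \<open>Write F# for \<open>reflect s F\<close>, the reflection of F in an edge. Boundary
  conditions are kept as holomorphic identities between F and F# on a disc around an edge point,
  where they can be differentiated. Three obstacles shape the argument. A priori \<open>H\<close> is
  only continuous up to the edges and g' may vanish there; the boundary relation is quadratic in
  \<open>H\<close>, so \<open>H\<close> is continued by a square root of (g')#/g', which is
  zero-free near the edge point because both factors vanish there to the same order. Next, R_n is an
  antiderivative of \<eta> Q_n', and differentiating its boundary identity would leave a constant
  undetermined; the quadratic formula for \<open>mkdv_int\<close> settles it. Finally, the Robin
  condition gives no pointwise formula for F beyond the edge, but it makes F + F# solve a
  first-order equation, which carries a bound M across at the cost of 7 M, where 7 = 6 + 1.
  Vanishing to fourth order gains the tail 1/16 + 1/32 + ... = 1/8, and 7/8 < 1; third order would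
  gain only 1/4. The conditions are real-linear, not complex-linear, so coefficients are real and
  the real and imaginary parts of derivatives are counted separately.\<close>

definition mon_value :: "(nat \<Rightarrow> complex) \<Rightarrow> (nat \<Rightarrow>\<^sub>0 nat) \<Rightarrow> complex"
  where "mon_value v m = (\<Prod>k\<in>Poly_Mapping.keys m. v k ^ Poly_Mapping.lookup m k)"

lemma mon_value_superset:
  assumes "finite A" "Poly_Mapping.keys m \<subseteq> A"
  shows "mon_value v m = (\<Prod>k\<in>A. v k ^ Poly_Mapping.lookup m k)"
  unfolding mon_value_def
  by (rule prod.mono_neutral_left) (use assms in \<open>auto simp: in_keys_iff\<close>)

lemma mon_value_add: "mon_value v (m + n) = mon_value v m * mon_value v n"
proof -
  let ?A = "Poly_Mapping.keys m \<union> Poly_Mapping.keys n"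
  have A: "finite ?A" "Poly_Mapping.keys (m + n) \<subseteq> ?A" "Poly_Mapping.keys m \<subseteq> ?A"
    "Poly_Mapping.keys n \<subseteq> ?A"
    using keys_add[of m n] by auto
  show ?thesis
    unfolding mon_value_superset[OF A(1,2)] mon_value_superset[OF A(1,3)] mon_value_superset[OF A(1,4)]
    by (simp add: lookup_add power_add prod.distrib)
qed

lemma eval_diff_poly_mon:
  "eval_diff_poly p f z =
    (\<Sum>m\<in>Poly_Mapping.keys p. Poly_Mapping.lookup p m * mon_value (\<lambda>k. (deriv ^^ k) f z) m)"
  by (simp add: eval_diff_poly_def mon_value_def)

lemma eval_diff_poly_superset:
  assumes "finite A" "Poly_Mapping.keys p \<subseteq> A"
  shows "eval_diff_poly p f z =
    (\<Sum>m\<in>A. Poly_Mapping.lookup p m * mon_value (\<lambda>k. (deriv ^^ k) f z) m)"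
  unfolding eval_diff_poly_mon
  by (rule sum.mono_neutral_left) (use assms in \<open>auto simp: in_keys_iff\<close>)

lemma eval_diff_poly_add [simp]:
  "eval_diff_poly (p + q) f z = eval_diff_poly p f z + eval_diff_poly q f z"
proof -
  let ?A = "Poly_Mapping.keys p \<union> Poly_Mapping.keys q"
  have "finite ?A" "Poly_Mapping.keys (p + q) \<subseteq> ?A" using keys_add[of p q] by auto
  then show ?thesis
    by (simp add: eval_diff_poly_superset[of ?A] lookup_add distrib_right sum.distrib)
qed

lemma eval_diff_poly_0 [simp]: "eval_diff_poly 0 f z = 0"
  by (simp add: eval_diff_poly_def)

lemma eval_diff_poly_uminus [simp]: "eval_diff_poly (- p) f z = - eval_diff_poly p f z"
  using eval_diff_poly_add[of p "- p" f z] by (simp add: eq_neg_iff_add_eq_0 add.commute)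

lemma eval_diff_poly_diff [simp]:
  "eval_diff_poly (p - q) f z = eval_diff_poly p f z - eval_diff_poly q f z"
  using eval_diff_poly_add[of p "- q" f z] by simp

lemma eval_diff_poly_sum [simp]:
  "eval_diff_poly (\<Sum>x\<in>A. h x) f z = (\<Sum>x\<in>A. eval_diff_poly (h x) f z)"
  by (induction A rule: infinite_finite_induct) auto

lemma eval_diff_poly_single:
  "eval_diff_poly (Poly_Mapping.single m c) f z = c * mon_value (\<lambda>k. (deriv ^^ k) f z) m"
  by (cases "c = 0") (auto simp: eval_diff_poly_mon)

lemma eval_diff_poly_const [simp]: "eval_diff_poly (Poly_Mapping.single 0 c) f z = c"
  by (simp add: eval_diff_poly_single mon_value_def)

lemma eval_diff_poly_numeral [simp]: "eval_diff_poly (numeral w) f z = numeral w"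
  using eval_diff_poly_const[of "numeral w" f z] by simp

lemma eval_diff_poly_var [simp]: "eval_diff_poly (jet_var k) f z = (deriv ^^ k) f z"
  by (simp add: eval_diff_poly_single mon_value_def)

lemma eval_diff_poly_mult [simp]:
  "eval_diff_poly (p * q) f z = eval_diff_poly p f z * eval_diff_poly q f z"
proof -
  have "p * q = (\<Sum>m\<in>Poly_Mapping.keys p. \<Sum>n\<in>Poly_Mapping.keys q.
      Poly_Mapping.single (m + n) (Poly_Mapping.lookup p m * Poly_Mapping.lookup q n))"
    unfolding mult_single[symmetric] sum_product[symmetric]
    by (simp only: diff_poly_expand[of p, symmetric] diff_poly_expand[of q, symmetric])
  then have "eval_diff_poly (p * q) f z = (\<Sum>m\<in>Poly_Mapping.keys p. \<Sum>n\<in>Poly_Mapping.keys q.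
      eval_diff_poly (Poly_Mapping.single (m + n)
        (Poly_Mapping.lookup p m * Poly_Mapping.lookup q n)) f z)"
    by simp
  also have "\<dots> = eval_diff_poly p f z * eval_diff_poly q f z"
    unfolding eval_diff_poly_mon[of p] eval_diff_poly_mon[of q] sum_product
    by (simp add: eval_diff_poly_single mon_value_add algebra_simps)
  finally show ?thesis .
qed

text \<open>\<open>total_deriv\<close> is a derivation that shifts the jet variables, and evaluation
  is a ring homomorphism. So the polynomials with this property contain the generators and are
  closed under sums and products, and \<open>diff_poly_expand\<close> then reaches all of
  them.\<close>

lemma has_field_derivative_eval_diff_poly:
  assumes f: "f holomorphic_on S" "open S" "z \<in> S"
  shows "(eval_diff_poly p f has_field_derivative eval_diff_poly (total_deriv p) f z) (at z)"
proof -
  define D where "D p \<longleftrightarrow>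
    ((\<lambda>z. eval_diff_poly p f z) has_field_derivative eval_diff_poly (total_deriv p) f z) (at z)" for p
  have var: "D (jet_var k)" for k
  proof -
    have "eval_diff_poly (jet_var k) f = (deriv ^^ k) f" by (rule ext, rule eval_diff_poly_var)
    then show ?thesis
      unfolding D_def total_deriv_var eval_diff_poly_var
      using has_field_derivative_higher_deriv[OF f, of k] by (simp only:)
  qed
  have const: "D (Poly_Mapping.single 0 c)" for c
  proof -
    have "eval_diff_poly (Poly_Mapping.single 0 c) f = (\<lambda>_. c)" by (intro ext) simp
    then show ?thesis unfolding D_def by (simp add: total_deriv_const)
  qed
  have mult: "D (p * q)" if "D p" "D q" for p q
  proof -
    have "eval_diff_poly (p * q) f = (\<lambda>z. eval_diff_poly p f z * eval_diff_poly q f z)"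
      by (intro ext) simp
    then show ?thesis
      using that unfolding D_def by (auto intro!: derivative_eq_intros simp: total_deriv_mult)
  qed
  have plus: "D (p + q)" if "D p" "D q" for p q
  proof -
    have "eval_diff_poly (p + q) f = (\<lambda>z. eval_diff_poly p f z + eval_diff_poly q f z)"
      by (intro ext) simp
    then show ?thesis
      using that unfolding D_def by (auto intro!: derivative_eq_intros simp: total_deriv_add)
  qed
  have one: "D 1" using const[of 1] by simp
  have pow: "D (p ^ n)" if "D p" for p n
    by (induction n) (use that one in \<open>auto intro: mult\<close>)
  have sums: "D (\<Sum>x\<in>A. h x)" if "\<And>x. x \<in> A \<Longrightarrow> D (h x)" for A :: "(nat \<Rightarrow>\<^sub>0 nat) set" and h
    using that
    by (induction A rule: infinite_finite_induct) (use const[of 0] in \<open>auto intro: plus\<close>)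
  have sp: "Poly_Mapping.single (Poly_Mapping.single k a) 1 = jet_var k ^ a" for k a
  proof (induction a)
    case (Suc a)
    have "Poly_Mapping.single k (Suc a) = Poly_Mapping.single k 1 + Poly_Mapping.single k a"
      by (simp flip: single_add)
    then have "Poly_Mapping.single (Poly_Mapping.single k (Suc a)) 1
        = jet_var k * Poly_Mapping.single (Poly_Mapping.single k a) 1"
      by (simp add: mult_single)
    then show ?case using Suc by simp
  qed simp
  \<comment> \<open>Each induction step adds an exponent at a fresh index; \<open>sp\<close> turns
    this factor into a power of a jet variable.\<close>
  have mons: "D (Poly_Mapping.single m 1)" for m
  proof (induction m rule: update_induct)
    case const
    show ?case using one by simp
  next
    case (update m k v)
    have "Poly_Mapping.update k v m = m + Poly_Mapping.single k v"
      by (rule poly_mapping_eqI)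
        (use update(1) in \<open>auto simp: lookup_update lookup_add lookup_single when_def in_keys_iff\<close>)
    then show ?case
      using mult[OF update(3) pow[OF var, of k v]] by (simp only: flip: sp) (simp add: mult_single)
  qed
  have "D (Poly_Mapping.single m c)" for m c
    using mult[OF const[of c] mons[of m]] by (simp add: mult_single)
  then have "D (\<Sum>m\<in>Poly_Mapping.keys p. Poly_Mapping.single m (Poly_Mapping.lookup p m))"
    by (intro sums)
  then have "D p"
    by (simp only: diff_poly_expand[of p, symmetric])
  then show ?thesis unfolding D_def .
qed

section \<open>The mKdV polynomials under reflection in a line\<close>

text \<open>Schwarz reflection: 2s - cnj z is the mirror image of z in Re z = s. On that line F + F#
  and F - F# are 2 Re F and 2i Im F; since both are holomorphic, conditions on real and imaginary
  parts become identities on an open disc.\<close>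

definition reflect :: "real \<Rightarrow> (complex \<Rightarrow> complex) \<Rightarrow> complex \<Rightarrow> complex"
  where "reflect s F z = cnj (F (2 * of_real s - cnj z))"

lemma mirror_mem_ball:
  assumes "Re p = s" "z \<in> ball p r"
  shows "2 * of_real s - cnj z \<in> ball p r"
proof -
  have "p - (2 * of_real s - cnj z) = - cnj (p - z)"
    using assms(1) by (simp add: complex_eq_iff)
  then have "dist p (2 * of_real s - cnj z) = dist p z"
    by (metis dist_norm complex_mod_cnj norm_minus_cancel)
  then show ?thesis using assms(2) by simp
qed

lemma reflect_on_line: "Re z = s \<Longrightarrow> reflect s F z = cnj (F z)"
proof -
  assume "Re z = s"
  then have "2 * of_real s - cnj z = z" by (simp add: complex_eq_iff)
  then show ?thesis by (simp add: reflect_def)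
qed

text \<open>The inner map w to 2s - w has derivative -1, whence the sign. Differentiation therefore
  exchanges the roles of F + F# and F - F#.\<close>

lemma has_field_derivative_reflect:
  assumes "(F has_field_derivative D) (at (2 * of_real s - cnj z))"
  shows "(reflect s F has_field_derivative - cnj D) (at z)"
proof -
  have "((\<lambda>w. F (2 * of_real s - w)) has_field_derivative D * (- 1)) (at (cnj z))"
    by (rule DERIV_chain2[where f = F]) (use assms in \<open>auto intro!: derivative_eq_intros\<close>)
  from has_field_derivative_cnj_cnj[OF this] show ?thesis
    by (simp add: reflect_def[abs_def] o_def)
qed

lemma holomorphic_on_reflect:
  assumes "F holomorphic_on ball p r" "Re p = s"
  shows "reflect s F holomorphic_on ball p r"
proof (rule holomorphic_onI)
  fix z assume "z \<in> ball p r"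
  then have "(F has_field_derivative deriv F (2 * of_real s - cnj z)) (at (2 * of_real s - cnj z))"
    using assms mirror_mem_ball holomorphic_derivI[OF assms(1) open_ball] by blast
  from has_field_derivative_reflect[OF this]
  show "reflect s F field_differentiable at z within ball p r"
    using field_differentiable_def field_differentiable_at_within by blast
qed

text \<open>
  On the line \<open>Re z = s\<close> the reflected function is the complex conjugate, so the hypotheses say
  \<open>Im \<eta>' = p Im \<eta>\<close> there, and the conclusions \<open>Im Q\<^sub>n' = p Im Q\<^sub>n\<close> and \<open>Im R\<^sub>n = Re \<eta> Im Q\<^sub>n\<close>.
\<close>

locale reflected_jet =
  fixes \<eta> :: "complex \<Rightarrow> complex" and p\<^sub>0 :: complex and r s :: real
  assumes holo: "\<eta> holomorphic_on ball p\<^sub>0 r" and line: "Re p\<^sub>0 = s"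
begin

abbreviation "B \<equiv> ball p\<^sub>0 r"
abbreviation E where "E P \<equiv> eval_diff_poly P \<eta>"
abbreviation E' where "E' P \<equiv> reflect s (eval_diff_poly P \<eta>)"

lemma reflect_eval [simp]:
  "E' (P + Q) z = E' P z + E' Q z" "E' (P - Q) z = E' P z - E' Q z"
  "E' (P * Q) z = E' P z * E' Q z"
  "E' (numeral w) z = numeral w"
  "E' (Poly_Mapping.single 0 (1/2)) z = 1/2"
  "E' (\<Sum>i\<in>A. h i) z = (\<Sum>i\<in>A. E' (h i) z)"
  by (simp_all add: reflect_def)

lemma dE: "z \<in> B \<Longrightarrow> (E P has_field_derivative E (total_deriv P) z) (at z)"
  by (rule has_field_derivative_eval_diff_poly[OF holo open_ball])

lemma dE': "z \<in> B \<Longrightarrow> (E' P has_field_derivative - E' (total_deriv P) z) (at z)"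
  using has_field_derivative_reflect[OF dE[OF mirror_mem_ball[OF line]]]
  by (simp add: reflect_def)

lemma derivs_eqI:
  assumes "\<And>z. z \<in> B \<Longrightarrow> f z = h z" "z \<in> B"
    "(f has_field_derivative a) (at z)" "(h has_field_derivative b) (at z)"
  shows "a = b"
proof -
  have "(f has_field_derivative b) (at z)"
    by (rule has_field_derivative_transform_within_open[OF assms(4) open_ball[of p\<^sub>0 r] assms(2)])
       (use assms(1) in auto)
  then show ?thesis using assms(3) DERIV_unique by blast
qed

abbreviation "Q \<equiv> mkdv_seq"
abbreviation "R \<equiv> mkdv_int"

lemma Q_Suc: "Q (Suc n) = total_deriv (total_deriv (Q n)) - 4 * jet_var 0 * R n"
  by (simp add: mkdv_seq.simps(2) numeral_2_eq_2)

lemma two_R: "2 * E (R n) z = (\<Sum>i\<le>n. E (Q i) z * E (Q (n - i)) z) -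
     (\<Sum>i<n. E (total_deriv (Q i)) z * E (total_deriv (Q (n - 1 - i))) z
        - 4 * E (R i) z * E (R (n - 1 - i)) z)"
  by (subst mkdv_int.simps) simp

lemma two_R': "2 * E' (R n) z = (\<Sum>i\<le>n. E' (Q i) z * E' (Q (n - i)) z) -
     (\<Sum>i<n. E' (total_deriv (Q i)) z * E' (total_deriv (Q (n - 1 - i))) z
        - 4 * E' (R i) z * E' (R (n - 1 - i)) z)"
  by (subst mkdv_int.simps) simp

lemma E_var0 [simp]: "E (jet_var 0) z = \<eta> z" "E' (jet_var 0) z = reflect s \<eta> z"
  using eval_diff_poly_var[of 0 \<eta>] by (simp_all add: reflect_def)

lemma E_var1: "E (jet_var (Suc 0)) z = deriv \<eta> z" "E' (jet_var (Suc 0)) z = reflect s (deriv \<eta>) z"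
  using eval_diff_poly_var[of "Suc 0" \<eta>] by (simp_all add: reflect_def)

lemma E_Q_Suc:
  "E (Q (Suc n)) z = E (total_deriv (total_deriv (Q n))) z - 4 * \<eta> z * E (R n) z"
  "E' (Q (Suc n)) z = E' (total_deriv (total_deriv (Q n))) z - 4 * reflect s \<eta> z * E' (R n) z"
  unfolding Q_Suc by (simp_all only: reflect_eval eval_diff_poly_diff eval_diff_poly_mult
      eval_diff_poly_numeral E_var0)

lemma total_deriv_Q_Suc:
  "total_deriv (Q (Suc n)) = total_deriv (total_deriv (total_deriv (Q n)))
    - 4 * jet_var (Suc 0) * R n - 4 * jet_var 0 * jet_var 0 * total_deriv (Q n)"
  unfolding Q_Suc
  by (simp only: total_deriv_diff total_deriv_mult total_deriv_var total_deriv_mkdv_int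
      total_deriv_numeral mult_zero_left add_0_left algebra_simps)

lemma E_total_deriv_Q_Suc:
  "E (total_deriv (Q (Suc n))) z = E (total_deriv (total_deriv (total_deriv (Q n)))) z
    - 4 * deriv \<eta> z * E (R n) z - 4 * \<eta> z * \<eta> z * E (total_deriv (Q n)) z"
  "E' (total_deriv (Q (Suc n))) z = E' (total_deriv (total_deriv (total_deriv (Q n)))) z
    - 4 * reflect s (deriv \<eta>) z * E' (R n) z
    - 4 * reflect s \<eta> z * reflect s \<eta> z * E' (total_deriv (Q n)) z"
  unfolding total_deriv_Q_Suc
  by (simp_all only: reflect_eval eval_diff_poly_diff eval_diff_poly_mult
      eval_diff_poly_numeral E_var0 E_var1)

text \<open>The mixed products cancel under the reversal of i and n - 1 - i. The even part then
  carries the index i and the odd part the reversed index, so that inductive facts about odd parts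
  can be substituted.\<close>

lemma antisym_sum:
  fixes a a' :: "nat \<Rightarrow> complex"
  shows "(\<Sum>i<n. a i * a (n - 1 - i)) - (\<Sum>i<n. a' i * a' (n - 1 - i)) =
    (\<Sum>i<n. (a i + a' i) * (a (n - 1 - i) - a' (n - 1 - i)))"
proof -
  have "(\<Sum>i<n. a' i * a (n - 1 - i)) = (\<Sum>i<n. a i * a' (n - 1 - i))"
    by (rule sum.reindex_bij_witness[of _ "\<lambda>i. n - 1 - i" "\<lambda>i. n - 1 - i"]) (auto simp: mult.commute)
  then show ?thesis by (simp add: algebra_simps sum.distrib sum_subtractf)
qed

text \<open>The algebra of the induction from Q_m to Q_{m+1}. Here q, t, v, w stand for Q_m and its
  first three derivatives, u for R_m, a and b for \<eta> and \<eta>'; primes mark reflections. The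
  defect of the conclusion is an explicit combination of the defects of the four
  assumptions.\<close>

lemma robin_step:
  fixes a :: complex
  assumes t: "t - t' = P * (q - q')" and u: "2 * (u - u') = (a + a') * (q - q')"
    and w: "w - w' = (2 * a * b + 2 * a' * b') * (q - q') + 2 * (a\<^sup>2 - a'\<^sup>2) * (t + t') + P * (v - v')"
    and b: "b - b' = P * (a - a')"
  shows "w - 4 * b * u - 4 * a * a * t - (w' - 4 * b' * u' - 4 * a' * a' * t') =
    P * (v - 4 * a * u - (v' - 4 * a' * u'))"
proof -
  have "w - 4 * b * u - 4 * a * a * t - (w' - 4 * b' * u' - 4 * a' * a' * t')
      - P * (v - 4 * a * u - (v' - 4 * a' * u')) =
    ((w - w') - ((2 * a * b + 2 * a' * b') * (q - q') + 2 * (a\<^sup>2 - a'\<^sup>2) * (t + t') + P * (v - v')))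
    - 2 * (a\<^sup>2 + a'\<^sup>2) * ((t - t') - P * (q - q'))
    + 2 * (P * a' - b') * (2 * (u - u') - (a + a') * (q - q'))
    + (2 * a * (q - q') - 4 * u) * ((b - b') - P * (a - a'))"
    by (simp add: algebra_simps power2_eq_square)
  also have "\<dots> = 0" unfolding t u w b by simp
  finally show ?thesis by simp
qed

text \<open>The two claims need each other: Q_{n+1} contains R_n, and R_n is built from Q_0, ...,
  Q_n. The Robin identity for Q_m is differentiated twice, with P' taken from \<open>dP\<close>, and
  \<open>robin_step\<close> yields the one for Q_{m+1}. The derivatives of the two sides of the R_n
  identity agree, but that leaves a constant open, so this identity is read off from the quadratic
  formula instead.\<close>

proposition robin_mkdv:
  fixes P :: "complex \<Rightarrow> complex"
  assumes dP: "\<And>z. z \<in> B \<Longrightarrow> (P has_field_derivative (\<eta> z)\<^sup>2 - (reflect s \<eta> z)\<^sup>2) (at z)"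
    and base: "\<And>z. z \<in> B \<Longrightarrow> deriv \<eta> z - reflect s (deriv \<eta>) z = P z * (\<eta> z - reflect s \<eta> z)"
    and "z \<in> B"
  shows "E (total_deriv (Q n)) z - E' (total_deriv (Q n)) z = P z * (E (Q n) z - E' (Q n) z) \<and>
     2 * (E (R n) z - E' (R n) z) = (\<eta> z + reflect s \<eta> z) * (E (Q n) z - E' (Q n) z)"
    (is "?I n z \<and> ?J n z")
  using \<open>z \<in> B\<close>
proof (induction n arbitrary: z rule: less_induct)
  case (less n)
  have d2: "E (total_deriv (total_deriv (Q m))) z + E' (total_deriv (total_deriv (Q m))) z =
      ((\<eta> z)\<^sup>2 - (reflect s \<eta> z)\<^sup>2) * (E (Q m) z - E' (Q m) z) +
      P z * (E (total_deriv (Q m)) z + E' (total_deriv (Q m)) z)" (is "?d2 m z")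
    if "\<And>w. w \<in> B \<Longrightarrow> ?I m w" "z \<in> B" for m z
    by (rule derivs_eqI[OF that])
       (use that(2) in \<open>auto intro!: derivative_eq_intros dE dE' dP simp: algebra_simps\<close>)
  have d\<eta>: "(\<eta> has_field_derivative deriv \<eta> z) (at z)" if "z \<in> B" for z
    using dE[OF that, of "jet_var 0"] that holo by (simp add: holomorphic_derivI)
  have d\<eta>': "(reflect s \<eta> has_field_derivative - reflect s (deriv \<eta>) z) (at z)" if "z \<in> B" for z
    using has_field_derivative_reflect[OF d\<eta>[OF mirror_mem_ball[OF line that]]]
    by (simp add: reflect_def)
  have d3: "E (total_deriv (total_deriv (total_deriv (Q m)))) z - E' (total_deriv (total_deriv (total_deriv (Q m)))) z =
      (2 * \<eta> z * deriv \<eta> z + 2 * reflect s \<eta> z * reflect s (deriv \<eta>) z) * (E (Q m) z - E' (Q m) z) +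
      2 * ((\<eta> z)\<^sup>2 - (reflect s \<eta> z)\<^sup>2) * (E (total_deriv (Q m)) z + E' (total_deriv (Q m)) z) +
      P z * (E (total_deriv (total_deriv (Q m))) z - E' (total_deriv (total_deriv (Q m))) z)"
    if "\<And>w. w \<in> B \<Longrightarrow> ?d2 m w" "z \<in> B" for m z
    by (rule derivs_eqI[OF that])
       (use that(2) in \<open>auto intro!: derivative_eq_intros dE dE' dP d\<eta> d\<eta>' simp: algebra_simps\<close>)
  have I: "?I n z" if z: "z \<in> B" for z
  proof (cases n)
    case 0
    show ?thesis
      unfolding 0 mkdv_seq.simps total_deriv_var E_var0 E_var1 by (rule base[OF z])
  next
    case (Suc m)
    have IH: "?I m z" "?J m z" and IH1: "\<And>w. w \<in> B \<Longrightarrow> ?I m w"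
      using less.IH[of m] z Suc by auto
    have D2: "?d2 m z" by (rule d2[OF IH1 z])
    have D3: "E (total_deriv (total_deriv (total_deriv (Q m)))) z - E' (total_deriv (total_deriv (total_deriv (Q m)))) z =
      (2 * \<eta> z * deriv \<eta> z + 2 * reflect s \<eta> z * reflect s (deriv \<eta>) z) * (E (Q m) z - E' (Q m) z) +
      2 * ((\<eta> z)\<^sup>2 - (reflect s \<eta> z)\<^sup>2) * (E (total_deriv (Q m)) z + E' (total_deriv (Q m)) z) +
      P z * (E (total_deriv (total_deriv (Q m))) z - E' (total_deriv (total_deriv (Q m))) z)"
      by (rule d3[OF d2[OF IH1] z])
    show ?thesis
      unfolding Suc E_Q_Suc(2) E_total_deriv_Q_Suc(2)
      unfolding E_Q_Suc(1) E_total_deriv_Q_Suc(1)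
      by (rule robin_step[OF IH D3 base[OF z]])
  qed
  have J: "?J n z" if z: "z \<in> B" for z
  proof -
    let ?S = "\<eta> z + reflect s \<eta> z"
    define q q' t t' u u' where
      "q i = E (Q i) z" and "q' i = E' (Q i) z" and
      "t i = E (total_deriv (Q i)) z" and "t' i = E' (total_deriv (Q i)) z" and
      "u i = E (R i) z" and "u' i = E' (R i) z" for i
    have I': "t i - t' i = P z * (q i - q' i)" if "i \<le> n" for i
      using I[OF z] less.IH[OF _ z, of i] that unfolding t_def t'_def q_def q'_def
      by (cases "i = n") auto
    have J': "2 * (u i - u' i) = ?S * (q i - q' i)" if "i < n" for i
      using less.IH[OF _ z, of i] that unfolding u_def u'_def q_def q'_def by auto
    \<comment> \<open>The even part of Q_{i+1}: the odd part of R_i is replaced by means of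
      \<open>J'\<close>, and the resulting terms with \<eta>^2 - (\<eta>#)^2 cancel those from
      P'.\<close>
    have U: "q (Suc i) + q' (Suc i) = P z * (t i + t' i) - 2 * ?S * (u i + u' i)" if "i < n" for i
    proof -
      have "?d2 i z" by (rule d2[OF _ z]) (use less.IH that in auto)
      then show ?thesis
        using J'[OF that]
        unfolding q_def q'_def t_def t'_def u_def u'_def E_Q_Suc(2)
        unfolding E_Q_Suc(1) by algebra
    qed
    have "(\<Sum>i\<le>n. q i * q (n - i)) - (\<Sum>i\<le>n. q' i * q' (n - i)) =
        (\<Sum>i\<le>n. (q i + q' i) * (q (n - i) - q' (n - i)))"
      using antisym_sum[of q "Suc n" q'] by (simp add: lessThan_Suc_atMost)
    \<comment> \<open>Only the term i = 0 keeps its even part, which is \<eta> + \<eta>#; all others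
      are lowered by \<open>U\<close>.\<close>
    also have "\<dots> = ?S * (q n - q' n) +
        (\<Sum>i<n. (P z * (t i + t' i) - 2 * ?S * (u i + u' i)) * (q (n - 1 - i) - q' (n - 1 - i)))"
    proof -
      have "q 0 + q' 0 = ?S" unfolding q_def q'_def mkdv_seq.simps E_var0 ..
      then show ?thesis unfolding sum.atMost_shift by (simp add: U)
    qed
    finally have A: "(\<Sum>i\<le>n. q i * q (n - i)) - (\<Sum>i\<le>n. q' i * q' (n - i)) = \<dots>" .
    have "(\<Sum>i<n. t i * t (n - 1 - i)) - (\<Sum>i<n. t' i * t' (n - 1 - i)) =
        (\<Sum>i<n. (t i + t' i) * (t (n - 1 - i) - t' (n - 1 - i)))"
      by (rule antisym_sum)
    also have "\<dots> = (\<Sum>i<n. (t i + t' i) * (P z * (q (n - 1 - i) - q' (n - 1 - i))))"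
      by (intro sum.cong refl) (simp add: I')
    finally have B: "(\<Sum>i<n. t i * t (n - 1 - i)) - (\<Sum>i<n. t' i * t' (n - 1 - i)) = \<dots>" .
    have "2 * ((\<Sum>i<n. u i * u (n - 1 - i)) - (\<Sum>i<n. u' i * u' (n - 1 - i))) =
        (\<Sum>i<n. (u i + u' i) * (2 * (u (n - 1 - i) - u' (n - 1 - i))))"
      unfolding antisym_sum by (simp add: sum_distrib_left algebra_simps)
    also have "\<dots> = (\<Sum>i<n. (u i + u' i) * (?S * (q (n - 1 - i) - q' (n - 1 - i))))"
    proof (intro sum.cong refl)
      fix i assume "i \<in> {..<n}"
      then have "n - 1 - i < n" by auto
      then show "(u i + u' i) * (2 * (u (n - 1 - i) - u' (n - 1 - i))) =
          (u i + u' i) * (?S * (q (n - 1 - i) - q' (n - 1 - i)))"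
        by (simp only: J')
    qed
    finally have C: "2 * ((\<Sum>i<n. u i * u (n - 1 - i)) - (\<Sum>i<n. u' i * u' (n - 1 - i))) = \<dots>" .
    have r: "2 * u n = (\<Sum>i\<le>n. q i * q (n - i)) - (\<Sum>i<n. t i * t (n - 1 - i))
        + 4 * (\<Sum>i<n. u i * u (n - 1 - i))"
      and r': "2 * u' n = (\<Sum>i\<le>n. q' i * q' (n - i)) - (\<Sum>i<n. t' i * t' (n - 1 - i))
        + 4 * (\<Sum>i<n. u' i * u' (n - 1 - i))"
      using two_R[of n z] two_R'[of n z]
      unfolding q_def q'_def t_def t'_def u_def u'_def
      by (simp_all add: sum_subtractf sum_distrib_left mult.assoc)
    have "2 * (u n - u' n) = 2 * u n - 2 * u' n" by (rule right_diff_distrib)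
    also have "\<dots> =
      ((\<Sum>i\<le>n. q i * q (n - i)) - (\<Sum>i\<le>n. q' i * q' (n - i))) -
      ((\<Sum>i<n. t i * t (n - 1 - i)) - (\<Sum>i<n. t' i * t' (n - 1 - i))) +
      2 * (2 * ((\<Sum>i<n. u i * u (n - 1 - i)) - (\<Sum>i<n. u' i * u' (n - 1 - i))))"
      unfolding r r' by (simp only: algebra_simps) simp
    \<comment> \<open>The terms of \<open>A\<close> with P cancel against \<open>B\<close>, those
      with u + u' against \<open>C\<close>; only the term from i = 0 survives.\<close>
    also have "\<dots> = ?S * (q n - q' n)"
      unfolding A B C
      by (simp add: sum_distrib_left sum.distrib sum_subtractf algebra_simps)
    finally show ?thesis unfolding q_def q'_def u_def u'_def .
  qed
  show ?case using I J less.prems by blast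
qed

text \<open>Reflection anticommutes with one derivative and commutes with two. First derivatives
  enter R_n only in pairs, so their signs cancel, and Q_{n+1} contains only the second derivative of
  Q_n.\<close>

proposition dirichlet_mkdv:
  assumes base: "\<And>z. z \<in> B \<Longrightarrow> \<eta> z = reflect s \<eta> z" and "z \<in> B"
  shows "E (Q n) z = E' (Q n) z \<and> E (R n) z = E' (R n) z"
  using \<open>z \<in> B\<close>
proof (induction n arbitrary: z rule: less_induct)
  case (less n)
  have d1: "E (total_deriv P) z = - E' (total_deriv P) z"
    if "\<And>w. w \<in> B \<Longrightarrow> E P w = E' P w" "z \<in> B" for P z
    by (rule derivs_eqI[OF that dE[OF that(2)] dE'[OF that(2)]])
  have d2: "E (total_deriv (total_deriv P)) z = E' (total_deriv (total_deriv P)) z"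
    if "\<And>w. w \<in> B \<Longrightarrow> E P w = E' P w" "z \<in> B" for P z
    by (rule derivs_eqI[OF d1[OF that(1)] that(2) dE[OF that(2)]])
      (use that(2) in \<open>auto intro!: derivative_eq_intros dE'\<close>)
  have I: "E (Q n) z = E' (Q n) z" if z: "z \<in> B" for z
  proof (cases n)
    case 0
    then show ?thesis using base[OF z] by (simp only: mkdv_seq.simps E_var0)
  next
    case (Suc m)
    then show ?thesis
      using d2[of "Q m", OF _ z] less.IH[of m] z base[OF z] by (simp add: E_Q_Suc)
  qed
  have "E (R n) z = E' (R n) z" if z: "z \<in> B" for z
  proof -
    have q: "E (Q i) z = E' (Q i) z" if "i \<le> n" for i
      using I[OF z] less.IH[OF _ z, of i] that by (cases "i = n") auto
    have t: "E (total_deriv (Q i)) z = - E' (total_deriv (Q i)) z" if "i < n" for i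
      by (rule d1[OF _ z]) (use less.IH that in auto)
    have u: "E (R i) z = E' (R i) z" if "i < n" for i
      using less.IH[OF _ z, of i] that by auto
    have "2 * E (R n) z = 2 * E' (R n) z"
      unfolding two_R two_R' by (intro arg_cong2[of _ _ _ _ "(-)"] sum.cong) (auto simp: q t u)
    then show ?thesis by simp
  qed
  then show ?case using I less.prems by blast
qed

end

section \<open>Linear dependence from reflection estimates\<close>

text \<open>The Robin condition is a first-order equation for A = F + F#, namely A' = P (A - 2 F#).
  On the unknown half of the disc F# is bounded by M, so Gronwall-like reasoning applies: if |A| is
  maximal at w, then |A w| <= 2M + (|A w| + 2M) / 2, hence |A w| <= 6M and |F| <= |A| + |F#| <= 7M.
  What matters later is that \<open>\<delta>\<close> depends neither on F nor on M.\<close>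

lemma robin_estimate:
  assumes "Re p = s" "r > 0" "continuous_on (ball p r) P"
  obtains \<delta> where "0 < \<delta>" "\<delta> \<le> r"
    "\<And>F M z. \<lbrakk>F holomorphic_on ball p r;
       \<And>z. z \<in> ball p r \<Longrightarrow> deriv F z - reflect s (deriv F) z = P z * (F z - reflect s F z);
       \<And>z. z \<in> ball p r \<Longrightarrow> 0 \<le> \<sigma> * (Re z - s) \<Longrightarrow> norm (F z) \<le> M; z \<in> ball p \<delta>\<rbrakk>
       \<Longrightarrow> norm (F z) \<le> 7 * M"
proof -
  have "compact (P ` cball p (r/2))"
    by (intro compact_continuous_image continuous_on_subset[OF assms(3)]) (use \<open>r > 0\<close> in auto)
  then obtain L where L: "L > 0" "\<And>z. z \<in> cball p (r/2) \<Longrightarrow> norm (P z) \<le> L"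
    using compact_imp_bounded[of "P ` cball p (r/2)"] by (auto simp: bounded_pos)
  \<comment> \<open>The second bound makes L * \<delta> at most 1/2, so that half of the maximum of
    |A| can be absorbed on the left.\<close>
  define \<delta> where "\<delta> = min (r/2) (1 / (2 * L))"
  have \<delta>: "0 < \<delta>" "\<delta> \<le> r/2" "\<delta> \<le> 1 / (2 * L)" using L \<open>r > 0\<close> by (auto simp: \<delta>_def)
  from \<delta>(3) have \<delta>L: "L * \<delta> \<le> 1/2" using L by (simp add: field_simps)
  show ?thesis
  proof
    show "0 < \<delta>" "\<delta> \<le> r" using \<delta> \<open>r > 0\<close> by auto
    fix F M z
    assume hol: "F holomorphic_on ball p r"
      and rel: "\<And>z. z \<in> ball p r \<Longrightarrow> deriv F z - reflect s (deriv F) z = P z * (F z - reflect s F z)"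
      and M: "\<And>z. z \<in> ball p r \<Longrightarrow> 0 \<le> \<sigma> * (Re z - s) \<Longrightarrow> norm (F z) \<le> M"
      and z: "z \<in> ball p \<delta>"
    \<comment> \<open>The half where no bound on F is given; its mirror image lies in the half where
      M is a bound.\<close>
    define K where "K = cball p \<delta> \<inter> {z. \<sigma> * (Re z - s) \<le> 0}"
    have sub: "K \<subseteq> ball p r" using \<delta> \<open>r > 0\<close> by (auto simp: K_def)
    have sub2: "K \<subseteq> cball p (r/2)" using \<delta> by (auto simp: K_def)
    have "{z. \<sigma> * (Re z - s) \<le> 0} = {z. complex_of_real \<sigma> \<bullet> z \<le> \<sigma> * s}"
      by (auto simp: inner_complex_def algebra_simps)
    then have half: "closed {z. \<sigma> * (Re z - s) \<le> 0}" "convex {z. \<sigma> * (Re z - s) \<le> 0}"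
      by (simp_all add: closed_halfspace_le convex_halfspace_le)
    have "compact K" "convex K"
      unfolding K_def using half by (auto intro: closed_Int_compact compact_Int_closed convex_Int)
    have p: "p \<in> K" using assms(1) \<delta> by (auto simp: K_def)
    have "norm (F p) \<le> M" using M[of p] assms by simp
    then have M0: "M \<ge> 0" using norm_ge_zero order_trans by blast
    define A where "A z = F z + reflect s F z" for z
    have dA: "(A has_field_derivative deriv F z - reflect s (deriv F) z) (at z)" if "z \<in> ball p r" for z
      using DERIV_add[OF holomorphic_derivI[OF hol open_ball that]
        has_field_derivative_reflect[OF holomorphic_derivI[OF hol open_ball mirror_mem_ball[OF assms(1) that]]]]
      by (simp add: A_def[abs_def] reflect_def)
    then have "continuous_on (ball p r) A"
      by (meson DERIV_isCont continuous_at_imp_continuous_on)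
    then have "continuous_on K (\<lambda>z. norm (A z))"
      by (intro continuous_on_norm continuous_on_subset[OF _ sub])
    then obtain w where w: "w \<in> K" "\<And>z. z \<in> K \<Longrightarrow> norm (A z) \<le> norm (A w)"
      using continuous_attains_sup[OF \<open>compact K\<close>, of "\<lambda>z. norm (A z)"] p by auto
    have st: "norm (reflect s F z) \<le> M" if "z \<in> K" for z
      using M[of "2 * of_real s - cnj z"] mirror_mem_ball[OF assms(1), of z r] that sub
      by (auto simp: reflect_def K_def algebra_simps)
    have "norm (A w - A p) \<le> (L * (norm (A w) + 2 * M)) * norm (w - p)"
    proof (rule field_differentiable_bound[OF \<open>convex K\<close> _ _ w(1) p])
      fix z assume z: "z \<in> K"
      then have zb: "z \<in> ball p r" using sub by auto
      show "(A has_field_derivative deriv F z - reflect s (deriv F) z) (at z within K)"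
        using dA[OF zb] has_field_derivative_at_within by blast
      have "norm (F z - reflect s F z) = norm (A z - 2 * reflect s F z)"
        by (simp add: A_def)
      also have "\<dots> \<le> norm (A z) + norm (2 * reflect s F z)" by (rule norm_triangle_ineq4)
      also have "\<dots> \<le> norm (A w) + 2 * M"
        using w(2)[OF z] st[OF z] by (simp add: norm_mult)
      finally have "norm (F z - reflect s F z) \<le> norm (A w) + 2 * M" .
      then show "norm (deriv F z - reflect s (deriv F) z) \<le> L * (norm (A w) + 2 * M)"
        unfolding rel[OF zb] norm_mult
        by (intro mult_mono L) (use sub2 z L in auto)
    qed
    also have "\<dots> \<le> (L * (norm (A w) + 2 * M)) * \<delta>"
      using w(1) L M0 by (intro mult_left_mono) (auto simp: K_def dist_norm norm_minus_commute)
    also have "\<dots> = (L * \<delta>) * (norm (A w) + 2 * M)" by simp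
    also have "\<dots> \<le> 1/2 * (norm (A w) + 2 * M)"
      by (intro mult_right_mono \<delta>L) (use M0 in auto)
    finally have "norm (A w) \<le> norm (A p) + 1/2 * (norm (A w) + 2 * M)"
      using norm_triangle_ineq2[of "A w" "A p"] by linarith
    moreover have "norm (A p) \<le> 2 * M"
      using norm_triangle_ineq[of "F p" "reflect s F p"] st[OF p] \<open>norm (F p) \<le> M\<close>
      by (simp add: A_def)
    ultimately have Aw: "norm (A w) \<le> 6 * M" by argo
    show "norm (F z) \<le> 7 * M"
    proof (cases "0 \<le> \<sigma> * (Re z - s)")
      case True
      then show ?thesis using M[of z] z \<delta> M0 by auto
    next
      case False
      then have zK: "z \<in> K" using z by (auto simp: K_def)
      have "norm (F z) = norm (A z - reflect s F z)" by (simp add: A_def)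
      also have "\<dots> \<le> norm (A z) + norm (reflect s F z)" by (rule norm_triangle_ineq4)
      also have "\<dots> \<le> 7 * M" using w(2)[OF zK] Aw st[OF zK] by linarith
      finally show ?thesis .
    qed
  qed
qed

text \<open>Cauchy's estimates on a circle of radius at least 2 |z - p| bound the k-th Taylor term
  by K / 2^k, and the terms from k = 4 on add up to K / 8. The order is chosen so that 8 exceeds the
  7 of \<open>robin_estimate\<close>.\<close>

lemma norm_le_of_zero_order_4:
  assumes hol: "F holomorphic_on ball p r"
    and K: "\<And>z. z \<in> ball p r \<Longrightarrow> norm (F z) \<le> K"
    and zero: "\<And>k. k < 4 \<Longrightarrow> (deriv ^^ k) F p = 0"
    and z: "z \<in> ball p (r/2)"
  shows "norm (F z) \<le> K / 8"
proof -
  define t where "t = norm (z - p)"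
  have t: "0 \<le> t" "2 * t < r" using z by (auto simp: t_def dist_norm norm_minus_commute)
  \<comment> \<open>The midpoint of 2t and r: it stays below r, is at least 2t, and is positive even
    for t = 0.\<close>
  define \<rho> where "\<rho> = t + r / 2"
  have \<rho>: "0 < \<rho>" "\<rho> < r" "2 * t \<le> \<rho>" using t by (auto simp: \<rho>_def)
  have sub: "cball p \<rho> \<subseteq> ball p r" using \<rho> by auto
  have "norm (F p) \<le> K" using K[of p] t by auto
  then have K0: "K \<ge> 0" using norm_ge_zero order_trans by blast
  have Cau: "norm ((deriv ^^ k) F p) \<le> fact k * K / \<rho> ^ k" for k
  proof (rule Cauchy_inequality)
    show "F holomorphic_on ball p \<rho>" by (rule holomorphic_on_subset[OF hol]) (use \<rho> in auto)
    show "continuous_on (cball p \<rho>) F"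
      by (rule continuous_on_subset[OF holomorphic_on_imp_continuous_on[OF hol] sub])
    show "norm (F x) \<le> K" if "norm (p - x) = \<rho>" for x
      by (rule K) (use that \<rho> in \<open>auto simp: dist_norm\<close>)
  qed (rule \<rho>)
  define a where "a k = (deriv ^^ k) F p / fact k * (z - p) ^ k" for k
  have "a sums F z"
    unfolding a_def by (rule holomorphic_power_series[OF hol]) (use z t in auto)
  moreover have "(\<Sum>k<4. a k) = 0"
    using zero by (intro sum.neutral) (auto simp: a_def)
  ultimately have s: "(\<lambda>k. a (k + 4)) sums F z"
    using sums_split_initial_segment[of a "F z" 4] by simp
  have le: "norm (a k) \<le> K * (1/2) ^ k" for k
  proof -
    have "norm (a k) = norm ((deriv ^^ k) F p) / fact k * t ^ k"
      by (simp add: a_def norm_mult norm_divide norm_power t_def)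
    also have "\<dots> \<le> (fact k * K / \<rho> ^ k) / fact k * t ^ k"
      by (intro mult_right_mono divide_right_mono Cau) (use t in auto)
    also have "\<dots> = K * (t / \<rho>) ^ k" by (simp add: power_divide)
    also have "\<dots> \<le> K * (1/2) ^ k"
      using K0 t \<rho> by (intro mult_left_mono power_mono) (auto simp: field_simps)
    finally show ?thesis .
  qed
  have g: "(\<lambda>k. K * (1/2) ^ (k + 4)) sums (K / 8)"
    using sums_mult[OF geometric_sums[of "1/2::real"], of "K / 16"]
    by (simp add: power_add eval_nat_numeral)
  have "norm (suminf (\<lambda>k. a (k + 4))) \<le> suminf (\<lambda>k. K * (1/2) ^ (k + 4))"
    by (rule norm_suminf_le[OF le sums_summable[OF g]])
  then show ?thesis using sums_unique[OF s] sums_unique[OF g] by simp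
qed

text \<open>Gaussian elimination: when the new equation x is nontrivial, an unknown k with nonzero
  coefficient is eliminated from the others. The sums run to \<open>card I\<close> inclusive, so
  there is one more unknown than there are equations.\<close>

lemma nontrivial_solution:
  fixes \<Lambda> :: "'i \<Rightarrow> nat \<Rightarrow> real"
  assumes "finite I"
  shows "\<exists>c. (\<exists>j\<le>card I. c j \<noteq> 0) \<and> (\<forall>i\<in>I. (\<Sum>j\<le>card I. c j * \<Lambda> i j) = 0)"
  using assms
proof (induction I arbitrary: \<Lambda> rule: finite_induct)
  case empty
  show ?case by (intro exI[of _ "\<lambda>_. 1"]) auto
next
  case (insert x I)
  let ?n = "card I"
  have card: "card (insert x I) = Suc ?n" using insert by simp
  show ?case
  proof (cases "\<exists>k\<le>Suc ?n. \<Lambda> x k \<noteq> 0")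
    case False
    obtain c where c: "\<exists>j\<le>?n. c j \<noteq> 0" "\<And>i. i \<in> I \<Longrightarrow> (\<Sum>j\<le>?n. c j * \<Lambda> i j) = 0"
      using insert.IH[of \<Lambda>] by blast
    define c' where "c' j = (if j \<le> ?n then c j else 0)" for j
    have "(\<Sum>j\<le>Suc ?n. c' j * \<Lambda> i j) = (\<Sum>j\<le>?n. c j * \<Lambda> i j)" for i
      by (simp add: c'_def)
    moreover have "(\<Sum>j\<le>Suc ?n. c' j * \<Lambda> x j) = 0"
      using False by (intro sum.neutral) auto
    moreover have "\<exists>j\<le>Suc ?n. c' j \<noteq> 0"
      using c(1) le_SucI by (auto simp: c'_def)
    ultimately show ?thesis unfolding card using c(2) by (intro exI[of _ c']) auto
  next
    case True
    then obtain k where k: "k \<le> Suc ?n" "\<Lambda> x k \<noteq> 0" by blast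
    \<comment> \<open>\<open>e\<close> enumerates the indices other than the pivot k.\<close>
    define e where "e j = (if j < k then j else Suc j)" for j
    have split: "(\<Sum>j\<le>Suc ?n. f j) = f k + (\<Sum>j\<le>?n. f (e j))" for f :: "nat \<Rightarrow> real"
    proof -
      have "(\<Sum>j\<le>?n. f (e j)) = (\<Sum>j\<in>{..Suc ?n} - {k}. f j)"
        by (rule sum.reindex_bij_witness[of _ "\<lambda>j. if j < k then j else j - 1" e])
          (use k in \<open>auto simp: e_def\<close>)
      then show ?thesis using k sum.remove[of "{..Suc ?n}" k f] by simp
    qed
    obtain c where c: "\<exists>j\<le>?n. c j \<noteq> 0"
      "\<And>i. i \<in> I \<Longrightarrow> (\<Sum>j\<le>?n. c j * (\<Lambda> i (e j) - \<Lambda> i k * \<Lambda> x (e j) / \<Lambda> x k)) = 0"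
      using insert.IH[of "\<lambda>i j. \<Lambda> i (e j) - \<Lambda> i k * \<Lambda> x (e j) / \<Lambda> x k"] by blast
    \<comment> \<open>The value at the pivot is forced by equation x.\<close>
    define c' where "c' j = (if j = k then - (\<Sum>j\<le>?n. c j * \<Lambda> x (e j)) / \<Lambda> x k
      else if j < k then c j else c (j - 1))" for j
    have c'e: "c' (e j) = c j" for j by (auto simp: c'_def e_def)
    have "(\<Sum>j\<le>Suc ?n. c' j * \<Lambda> x j) = 0"
      unfolding split c'e using k by (simp add: c'_def)
    moreover have "(\<Sum>j\<le>Suc ?n. c' j * \<Lambda> i j) = 0" if "i \<in> I" for i
    proof -
      have "(\<Sum>j\<le>?n. c j * \<Lambda> i (e j)) - \<Lambda> i k / \<Lambda> x k * (\<Sum>j\<le>?n. c j * \<Lambda> x (e j)) = 0"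
        using c(2)[OF that]
        by (simp add: right_diff_distrib sum_subtractf sum_distrib_left mult.commute mult.left_commute)
      then show ?thesis unfolding split c'e by (simp add: c'_def)
    qed
    moreover have "\<exists>j\<le>Suc ?n. c' j \<noteq> 0"
    proof -
      obtain j where "j \<le> ?n" "c j \<noteq> 0" using c(1) by blast
      then show ?thesis by (intro exI[of _ "e j"]) (auto simp: c'e, simp add: e_def)
    qed
    ultimately show ?thesis unfolding card by (intro exI[of _ c']) auto
  qed
qed

text \<open>Because \<open>\<delta>\<close> serves all combinations at once, a finite cover of S by
  half-radius discs is fixed first. Then more functions are taken than there are conditions, giving
  a combination F that vanishes to order 4 at all centres. At a maximum point of |F| on S the
  estimates give |F| <= 7/8 |F|, so F vanishes on S.\<close>

lemma linear_dependence_of_estimate: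
  fixes Q :: "nat \<Rightarrow> complex \<Rightarrow> complex"
  assumes "compact S" "S \<noteq> {}"
    and hol: "\<And>n. Q n analytic_on S"
    and est: "\<And>p. p \<in> S \<Longrightarrow> \<exists>\<delta>>0. \<forall>c N M. (\<forall>z\<in>S. norm (\<Sum>j\<le>N. of_real (c j) * Q j z) \<le> M) \<longrightarrow>
       (\<lambda>z. \<Sum>j\<le>N. of_real (c j) * Q j z) holomorphic_on ball p \<delta> \<and>
       (\<forall>z\<in>ball p \<delta>. norm (\<Sum>j\<le>N. of_real (c j) * Q j z) \<le> 7 * M)"
  shows "\<exists>c N. (\<exists>j\<le>N. c j \<noteq> 0) \<and> (\<forall>z\<in>S. (\<Sum>j\<le>N. of_real (c j) * Q j z) = 0)"
proof -
  define Est where "Est p \<delta> \<longleftrightarrow> (\<forall>c N M. (\<forall>z\<in>S. norm (\<Sum>j\<le>N. of_real (c j) * Q j z) \<le> M) \<longrightarrow>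
       (\<lambda>z. \<Sum>j\<le>N. of_real (c j) * Q j z) holomorphic_on ball p \<delta> \<and>
       (\<forall>z\<in>ball p \<delta>. norm (\<Sum>j\<le>N. of_real (c j) * Q j z) \<le> 7 * M))" for p \<delta>
  have "\<forall>p\<in>S. \<exists>\<delta>. \<delta> > 0 \<and> Est p \<delta>" using est unfolding Est_def by blast
  from bchoice[OF this] obtain \<delta> where
    \<delta>: "\<And>p. p \<in> S \<Longrightarrow> \<delta> p > 0" "\<And>p. p \<in> S \<Longrightarrow> Est p (\<delta> p)" by blast
  obtain X where X: "finite X" "X \<subseteq> S" "S \<subseteq> (\<Union>p\<in>X. ball p (\<delta> p / 2))"
  proof (rule compactE_image[OF \<open>compact S\<close>, of S "\<lambda>p. ball p (\<delta> p / 2)"])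
    show "S \<subseteq> (\<Union>p\<in>S. ball p (\<delta> p / 2))" using \<delta>(1) by force
  qed auto
  \<comment> \<open>One real condition for each centre, each derivative of order below 4, and each
    of real and imaginary part.\<close>
  define I where "I = X \<times> {..<4::nat} \<times> (UNIV :: bool set)"
  have "finite I" using X by (simp add: I_def)
  define \<Lambda> where "\<Lambda> = (\<lambda>(p, k, b) j. (if b then Re else Im) ((deriv ^^ k) (Q j) p))"
  obtain c where c: "\<exists>j\<le>card I. c j \<noteq> 0" "\<And>i. i \<in> I \<Longrightarrow> (\<Sum>j\<le>card I. c j * \<Lambda> i j) = 0"
    using nontrivial_solution[OF \<open>finite I\<close>, of \<Lambda>] by blast
  define F where "F z = (\<Sum>j\<le>card I. of_real (c j) * Q j z)" for z
  have Q: "Q n analytic_on {p}" if "p \<in> X" for n p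
    using hol[of n] X(2) that analytic_on_subset[of "Q n" S "{p}"] by auto
  have zero: "(deriv ^^ k) F p = 0" if "p \<in> X" "k < 4" for p k
  proof -
    have an: "(\<lambda>z. \<Sum>j\<le>n. of_real (c j) * Q j z) analytic_on {p}" for n
      by (intro analytic_intros Q that)
    have "(deriv ^^ k) (\<lambda>z. \<Sum>j\<le>n. of_real (c j) * Q j z) p =
        (\<Sum>j\<le>n. of_real (c j) * (deriv ^^ k) (Q j) p)" for n
    proof (induction n)
      case 0
      show ?case using higher_deriv_cmult'[OF Q[OF that(1)]] by simp
    next
      case (Suc n)
      have "(\<lambda>z. of_real (c (Suc n)) * Q (Suc n) z) analytic_on {p}"
        by (intro analytic_intros Q that)
      from higher_deriv_add_at[OF an this, of k n] show ?case
        using Suc higher_deriv_cmult'[OF Q[OF that(1)]] by simp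
    qed
    then have "(deriv ^^ k) F p = (\<Sum>j\<le>card I. of_real (c j) * (deriv ^^ k) (Q j) p)"
      unfolding F_def .
    moreover have "Re \<dots> = 0" "Im \<dots> = 0"
      using c(2)[of "(p, k, True)"] c(2)[of "(p, k, False)"] that by (auto simp: I_def \<Lambda>_def)
    ultimately show ?thesis by (simp add: complex_eq_iff)
  qed
  have "continuous_on S (\<lambda>z. norm (F z))"
    unfolding F_def
    by (intro continuous_intros) (use hol analytic_imp_holomorphic holomorphic_on_imp_continuous_on in blast)
  then obtain w where w: "w \<in> S" "\<And>z. z \<in> S \<Longrightarrow> norm (F z) \<le> norm (F w)"
    using continuous_attains_sup[OF assms(1,2), of "\<lambda>z. norm (F z)"] by auto
  then obtain p where p: "p \<in> X" "w \<in> ball p (\<delta> p / 2)" using X(3) by auto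
  have "norm (F w) \<le> 7 * norm (F w) / 8"
  proof (rule norm_le_of_zero_order_4[OF _ _ zero[OF p(1)] p(2)])
    have "\<forall>z\<in>S. norm (\<Sum>j\<le>card I. of_real (c j) * Q j z) \<le> norm (F w)"
      using w(2) unfolding F_def by blast
    with \<delta>(2)[of p] p(1) X(2)
    show "F holomorphic_on ball p (\<delta> p)" "\<And>z. z \<in> ball p (\<delta> p) \<Longrightarrow> norm (F z) \<le> 7 * norm (F w)"
      unfolding F_def Est_def by blast+
  qed
  then have "norm (F w) = 0" using norm_ge_zero[of "F w"] by linarith
  then have "\<forall>z\<in>S. F z = 0" using w(2) by (metis norm_le_zero_iff)
  then show ?thesis using c(1) unfolding F_def by blast
qed

section \<open>Reflection across a capillary boundary\<close>

text \<open>The sign of \<open>\<sigma>\<close> selects the side of Re z = s, so that both edges of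
  the band are treated at once. The inner-product form matches the general facts about half-spaces
  and pasting across a line.\<close>

lemma half_plane_inner: "{z. k \<le> \<sigma> * (Re z - s)} = {z. complex_of_real \<sigma> \<bullet> z \<ge> \<sigma> * s + k}"
  "{z. k < \<sigma> * (Re z - s)} = {z. complex_of_real \<sigma> \<bullet> z > \<sigma> * s + k}"
  "{z. \<sigma> * (Re z - s) < k} = {z. complex_of_real \<sigma> \<bullet> z < \<sigma> * s + k}"
  "{z. \<sigma> * (Re z - s) \<le> k} = {z. complex_of_real \<sigma> \<bullet> z \<le> \<sigma> * s + k}"
  by (auto simp: inner_complex_def algebra_simps)

lemma open_half_ball: "open (ball p r \<inter> {z. 0 < \<sigma> * (Re z - s)})"
  unfolding half_plane_inner by (intro open_Int open_ball open_halfspace_gt)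

lemma convex_half_ball: "convex (ball p r \<inter> {z. 0 < \<sigma> * (Re z - s)})"
  unfolding half_plane_inner by (intro convex_Int convex_ball convex_halfspace_gt)

lemma half_ball_nonempty:
  assumes "Re p = s" "r > 0" "\<sigma> \<noteq> 0"
  shows "ball p r \<inter> {z. 0 < \<sigma> * (Re z - s)} \<noteq> {}"
proof -
  have "p + of_real (sgn \<sigma> * r / 2) \<in> ball p r \<inter> {z. 0 < \<sigma> * (Re z - s)}"
    using assms by (auto simp: dist_norm norm_mult sgn_real_def mult_neg_pos)
  then show ?thesis by blast
qed

text \<open>Extended by zero to the other side, \<Phi> is continuous and holomorphic off the line,
  hence holomorphic on the disc. It vanishes on an open half, so everywhere. This turns a relation
  on the edge into one inside the band.\<close>

lemma zero_of_zero_on_line: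
  assumes "Re p = s" "r > 0" "\<sigma> \<noteq> 0"
    and hol: "\<Phi> holomorphic_on ball p r \<inter> {z. 0 < \<sigma> * (Re z - s)}"
    and cont: "continuous_on (ball p r \<inter> {z. 0 \<le> \<sigma> * (Re z - s)}) \<Phi>"
    and zero: "\<And>z. z \<in> ball p r \<Longrightarrow> Re z = s \<Longrightarrow> \<Phi> z = 0"
    and z: "z \<in> ball p r" "0 \<le> \<sigma> * (Re z - s)"
  shows "\<Phi> z = 0"
proof -
  define \<Psi> where "\<Psi> z = (if 0 \<le> \<sigma> * (Re z - s) then \<Phi> z else 0)" for z
  have "continuous_on (ball p r) \<Psi>"
  proof -
    let ?A = "ball p r \<inter> {z. 0 \<le> \<sigma> * (Re z - s)}" and ?B = "ball p r \<inter> {z. \<sigma> * (Re z - s) \<le> 0}"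
    have U: "?A \<union> ?B = ball p r" by auto
    have "continuous_on (?A \<union> ?B) (\<lambda>z. if 0 \<le> \<sigma> * (Re z - s) then \<Phi> z else 0)"
    proof (rule continuous_on_cases_local)
      show "closedin (top_of_set (?A \<union> ?B)) ?A" "closedin (top_of_set (?A \<union> ?B)) ?B"
        unfolding U unfolding half_plane_inner
        by (auto intro!: closedin_closed_Int closed_halfspace_ge closed_halfspace_le)
      show "\<And>x. x \<in> ?A \<and> \<not> 0 \<le> \<sigma> * (Re x - s) \<or> x \<in> ?B \<and> 0 \<le> \<sigma> * (Re x - s) \<Longrightarrow> \<Phi> x = 0"
      proof -
        fix x assume "x \<in> ?A \<and> \<not> 0 \<le> \<sigma> * (Re x - s) \<or> x \<in> ?B \<and> 0 \<le> \<sigma> * (Re x - s)"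
        then have "x \<in> ball p r" "\<sigma> * (Re x - s) = 0" by auto
        then show "\<Phi> x = 0" using zero assms(3) by auto
      qed
    qed (use cont in auto)
    then show ?thesis unfolding U \<Psi>_def .
  qed
  moreover have "\<Psi> holomorphic_on ball p r \<inter> {z. complex_of_real \<sigma> \<bullet> z < \<sigma> * s}"
    by (rule holomorphic_transform[of "\<lambda>_. 0"])
       (auto simp: \<Psi>_def inner_complex_def algebra_simps)
  moreover have "\<Psi> holomorphic_on ball p r \<inter> {z. \<sigma> * s < complex_of_real \<sigma> \<bullet> z}"
  proof (rule holomorphic_transform)
    show "\<Phi> holomorphic_on ball p r \<inter> {z. \<sigma> * s < complex_of_real \<sigma> \<bullet> z}"
      using hol unfolding half_plane_inner by simp
  qed (auto simp: \<Psi>_def inner_complex_def algebra_simps)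
  ultimately have "\<Psi> holomorphic_on ball p r"
    using assms(3) by (intro holomorphic_on_paste_across_line[of "ball p r" "complex_of_real \<sigma>"]) auto
  moreover have "\<Psi> w = 0" if "w \<in> ball p r \<inter> {z. 0 < - \<sigma> * (Re z - s)}" for w
    using that by (simp add: \<Psi>_def)
  moreover have "ball p r \<inter> {z. 0 < - \<sigma> * (Re z - s)} \<noteq> {}"
    by (rule half_ball_nonempty) (use assms(1-3) in auto)
  ultimately have "\<Psi> z = 0"
    using analytic_continuation_open[OF open_half_ball[of p r "- \<sigma>" s] open_ball[of p r] _
        connected_ball Int_lower1, of \<Psi> "\<lambda>_. 0" z] z(1)
    by (simp only: holomorphic_on_const simp_thms)
  then show ?thesis using z by (simp add: \<Psi>_def)
qed

lemma holomorphic_mult_eq_0: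
  assumes "f holomorphic_on S" "h holomorphic_on S" "open S" "connected S"
    and "\<And>z. z \<in> S \<Longrightarrow> f z * h z = 0"
  shows "(\<forall>z\<in>S. f z = 0) \<or> (\<forall>z\<in>S. h z = 0)"
proof (rule disjCI)
  assume "\<not> (\<forall>z\<in>S. h z = 0)"
  then obtain w where w: "w \<in> S" "h w \<noteq> 0" by blast
  have "open (S \<inter> h -` (- {0}))"
    using assms(2,3) holomorphic_on_imp_continuous_on
    by (intro continuous_open_preimage) auto
  moreover have "f z = 0" if "z \<in> S \<inter> h -` (- {0})" for z
    using assms(5)[of z] that by auto
  ultimately show "\<forall>z\<in>S. f z = 0"
    using analytic_continuation_open[of "S \<inter> h -` (- {0})" S f "\<lambda>_. 0"] assms w by auto
qed

lemma holomorphic_factor_at: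
  assumes "f holomorphic_on ball p r" "r > 0" "\<exists>w\<in>ball p r. f w \<noteq> 0"
  obtains n h \<rho> where "0 < \<rho>" "\<rho> \<le> r" "h holomorphic_on ball p \<rho>"
    "\<And>w. w \<in> ball p \<rho> \<Longrightarrow> f w = (w - p) ^ n * h w" "\<And>w. w \<in> ball p \<rho> \<Longrightarrow> h w \<noteq> 0"
proof (cases "f p = 0")
  case True
  have nc: "\<not> f constant_on ball p r" 
  proof
    assume "f constant_on ball p r"
    then obtain c where "\<And>x. x \<in> ball p r \<Longrightarrow> f x = c" unfolding constant_on_def by blast
    then show False using True assms(2,3) by (metis centre_in_ball)
  qed
  obtain h \<rho> n where h: "0 < \<rho>" "ball p \<rho> \<subseteq> ball p r" "h holomorphic_on ball p \<rho>"
      "\<And>w. w \<in> ball p \<rho> \<Longrightarrow> f w = (w - p)^n * h w" "\<And>w. w \<in> ball p \<rho> \<Longrightarrow> h w \<noteq> 0"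
    using holomorphic_factor_zero_nonconstant[OF assms(1) open_ball _ _ True nc] assms(2)
    by (metis centre_in_ball connected_ball)
  moreover have "\<rho> \<le> r" using h(1,2) assms(2) by (simp add: ball_subset_ball_iff)
  ultimately show ?thesis using that by blast
next
  case False
  have "continuous (at p) f"
    using assms(1,2) by (meson centre_in_ball continuous_on_eq_continuous_at holomorphic_on_imp_continuous_on open_ball)
  then obtain e where e: "e > 0" "\<And>w. dist p w < e \<Longrightarrow> f w \<noteq> 0"
    using continuous_at_avoid[of p f 0] False by (auto simp: dist_commute)
  show ?thesis
  proof (rule that[of "min e r" f 0])
    show "f holomorphic_on ball p (min e r)" by (rule holomorphic_on_subset[OF assms(1)]) auto
  qed (use e assms in auto)
qed

text \<open>Replacing cnj g by g# makes the factor in the boundary relation holomorphic: this is A.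
  By \<open>zero_of_zero_on_line\<close>, A^2 g' = \<kappa>^2 (g')# holds in the half disc. The
  quotient (g')#/g' makes sense on a whole disc, and its square root continues A across the edge.
  Zeros of g' on the edge cannot be excluded at this stage, so they must be factored out.\<close>

lemma boundary_extension:
  fixes c \<kappa> :: real and d :: complex
  assumes "Re p = s" "r > 0" "\<sigma> \<noteq> 0"
    and g: "g holomorphic_on ball p r" "\<exists>w\<in>ball p r. deriv g w \<noteq> 0"
    and H: "H holomorphic_on ball p r \<inter> {z. 0 < \<sigma> * (Re z - s)}"
      "continuous_on (ball p r \<inter> {z. 0 \<le> \<sigma> * (Re z - s)}) H"
    and bd: "\<And>z. z \<in> ball p r \<Longrightarrow> Re z = s \<Longrightarrow>
      (H z + (c - 1) * cnj (g z) - d)\<^sup>2 * deriv g z = \<kappa>\<^sup>2 * cnj (deriv g z)"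
  obtains \<rho> B where "0 < \<rho>" "\<rho> \<le> r" "B holomorphic_on ball p \<rho>"
    "\<And>z. z \<in> ball p \<rho> \<Longrightarrow> (B z)\<^sup>2 * deriv g z = \<kappa>\<^sup>2 * reflect s (deriv g) z"
    "\<And>z. z \<in> ball p \<rho> \<Longrightarrow> 0 < \<sigma> * (Re z - s) \<Longrightarrow> H z = B z - (c - 1) * reflect s g z + d"
    "\<kappa> = 0 \<Longrightarrow> (\<And>z. z \<in> ball p \<rho> \<Longrightarrow> B z = 0)"
proof -
  let ?U = "\<lambda>r. ball p r \<inter> {z. 0 < \<sigma> * (Re z - s)}" and ?C = "\<lambda>r. ball p r \<inter> {z. 0 \<le> \<sigma> * (Re z - s)}"
  define A where "A z = H z + (c - 1) * reflect s g z - d" for z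
  have g': "deriv g holomorphic_on ball p r" using g by (intro holomorphic_intros) auto
  have stg: "reflect s g holomorphic_on ball p r" "reflect s (deriv g) holomorphic_on ball p r"
    using g g' assms(1) holomorphic_on_reflect by auto
  note sub = holomorphic_on_subset[OF _ Int_lower1] and
    csub = continuous_on_subset[OF holomorphic_on_imp_continuous_on Int_lower1]
  have holA: "A holomorphic_on ?U r" unfolding A_def
    by (intro holomorphic_on_diff holomorphic_on_add holomorphic_on_mult holomorphic_on_const
        H(1) sub[OF stg(1)])
  have "(A z)\<^sup>2 * deriv g z - \<kappa>\<^sup>2 * reflect s (deriv g) z = 0" if "z \<in> ?C r" for z
  proof (rule zero_of_zero_on_line[OF assms(1-3), where z = z and
        \<Phi> = "\<lambda>z. (A z)\<^sup>2 * deriv g z - \<kappa>\<^sup>2 * reflect s (deriv g) z"])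
    show "(\<lambda>z. (A z)\<^sup>2 * deriv g z - \<kappa>\<^sup>2 * reflect s (deriv g) z) holomorphic_on ?U r"
      by (intro holomorphic_on_diff holomorphic_on_mult holomorphic_on_power holomorphic_on_const
          holA sub[OF stg(2)] sub[OF g'])
    show "continuous_on (?C r) (\<lambda>z. (A z)\<^sup>2 * deriv g z - \<kappa>\<^sup>2 * reflect s (deriv g) z)"
      unfolding A_def by (intro continuous_intros H(2) csub[OF stg(1)] csub[OF stg(2)] csub[OF g'])
  qed (use that bd in \<open>auto simp: A_def reflect_on_line\<close>)
  then have rel: "(A z)\<^sup>2 * deriv g z = \<kappa>\<^sup>2 * reflect s (deriv g) z" if "z \<in> ?C r" for z
    using that by auto
  obtain n h \<rho> where \<rho>: "0 < \<rho>" "\<rho> \<le> r" and h: "h holomorphic_on ball p \<rho>"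
    "\<And>w. w \<in> ball p \<rho> \<Longrightarrow> deriv g w = (w - p) ^ n * h w" "\<And>w. w \<in> ball p \<rho> \<Longrightarrow> h w \<noteq> 0"
  proof (rule holomorphic_factor_at[OF g' assms(2) g(2)])
    fix \<rho> h n
    assume "0 < \<rho>" "\<rho> \<le> r" "h holomorphic_on ball p \<rho>"
      "\<And>w. w \<in> ball p \<rho> \<Longrightarrow> deriv g w = (w - p) ^ n * h w" "\<And>w. w \<in> ball p \<rho> \<Longrightarrow> h w \<noteq> 0"
    then show ?thesis by (rule that[of \<rho> h n])
  qed
  have sub\<rho>: "ball p \<rho> \<subseteq> ball p r" using \<rho> by auto
  have sth: "reflect s h holomorphic_on ball p \<rho>" "\<And>w. w \<in> ball p \<rho> \<Longrightarrow> reflect s h w \<noteq> 0"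
    using h assms(1) holomorphic_on_reflect mirror_mem_ball unfolding reflect_def by auto
  \<comment> \<open>Since p lies on the line, reflection sends w - p to -(w - p); so (g')# has the
    same order n at p, and the powers cancel in the quotient up to a sign.\<close>
  have fac: "reflect s (deriv g) w = (-1) ^ n * (w - p) ^ n * reflect s h w" if "w \<in> ball p \<rho>" for w
  proof -
    have "cnj (2 * of_real s - cnj w - p) = - (w - p)"
      using assms(1) by (simp add: complex_eq_iff)
    moreover have "reflect s (deriv g) w = cnj (2 * of_real s - cnj w - p) ^ n * reflect s h w"
      unfolding reflect_def h(2)[OF mirror_mem_ball[OF assms(1) that]]
      by (simp only: complex_cnj_mult complex_cnj_power)
    ultimately show ?thesis by (simp only: power_minus[of "w - p"])
  qed
  obtain e where e: "e holomorphic_on ball p \<rho>"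
    "\<And>z. z \<in> ball p \<rho> \<Longrightarrow> (-1) ^ n * reflect s h z / h z = (e z)\<^sup>2"
  proof (rule contractible_imp_holomorphic_sqrt[where S = "ball p \<rho>" and
        f = "\<lambda>z. (-1) ^ n * reflect s h z / h z"])
    show "(\<lambda>z. (-1) ^ n * reflect s h z / h z) holomorphic_on ball p \<rho>"
      by (intro holomorphic_intros h sth)
    show "contractible (ball p \<rho>)" by (simp add: convex_imp_contractible)
  qed (use h sth in auto)
  have er: "(e w)\<^sup>2 * deriv g w = reflect s (deriv g) w" if "w \<in> ball p \<rho>" for w
    using h(3)[OF that] by (simp add: e(2)[OF that, symmetric] h(2)[OF that] fac[OF that])
  have "(\<forall>z\<in>?U \<rho>. A z - \<kappa> * e z = 0) \<or> (\<forall>z\<in>?U \<rho>. A z + \<kappa> * e z = 0)"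
  proof (rule holomorphic_mult_eq_0[OF _ _ open_half_ball convex_connected[OF convex_half_ball]])
    have "A holomorphic_on ?U \<rho>" by (rule holomorphic_on_subset[OF holA]) (use \<rho> in auto)
    then show "(\<lambda>z. A z - \<kappa> * e z) holomorphic_on ?U \<rho>" "(\<lambda>z. A z + \<kappa> * e z) holomorphic_on ?U \<rho>"
      by (intro holomorphic_on_diff holomorphic_on_add holomorphic_on_mult holomorphic_on_const
          sub[OF e(1)]; assumption)+
    fix z assume z: "z \<in> ?U \<rho>"
    then have "z \<noteq> p" using assms(1) by auto
    then have "deriv g z \<noteq> 0" using z h(2,3) by simp
    moreover have "(A z)\<^sup>2 * deriv g z = \<kappa>\<^sup>2 * ((e z)\<^sup>2 * deriv g z)"
      using rel[of z] er[of z] z \<rho> by auto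
    ultimately have "(A z)\<^sup>2 = \<kappa>\<^sup>2 * (e z)\<^sup>2" by simp
    then show "(A z - \<kappa> * e z) * (A z + \<kappa> * e z) = 0"
      by (simp add: algebra_simps power2_eq_square)
  qed
  \<comment> \<open>The sign of the root is the same throughout the half disc, because a product of
    holomorphic functions on a connected set vanishes only if a factor does.\<close>
  then obtain \<kappa>' :: real where \<kappa>': "\<kappa>' = \<kappa> \<or> \<kappa>' = - \<kappa>" "\<And>z. z \<in> ?U \<rho> \<Longrightarrow> A z = \<kappa>' * e z"
  proof
    assume "\<forall>z\<in>?U \<rho>. A z - \<kappa> * e z = 0"
    then show ?thesis by (intro that[of \<kappa>]) auto
  next
    assume "\<forall>z\<in>?U \<rho>. A z + \<kappa> * e z = 0"
    then show ?thesis by (intro that[of "- \<kappa>"]) (auto simp: add_eq_0_iff2)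
  qed
  show ?thesis
  proof (rule that[OF \<rho>, of "\<lambda>z. \<kappa>' * e z"])
    show "(\<lambda>z. \<kappa>' * e z) holomorphic_on ball p \<rho>" by (intro holomorphic_intros e)
    show "(\<kappa>' * e z)\<^sup>2 * deriv g z = \<kappa>\<^sup>2 * reflect s (deriv g) z" if "z \<in> ball p \<rho>" for z
      using \<kappa>'(1) er[OF that] by (auto simp: power_mult_distrib)
    show "H z = \<kappa>' * e z - (c - 1) * reflect s g z + d"
      if "z \<in> ball p \<rho>" "0 < \<sigma> * (Re z - s)" for z
      using \<kappa>'(2)[of z] that by (simp add: A_def algebra_simps)
    show "\<kappa>' * e z = 0" if "\<kappa> = 0" for z using \<kappa>'(1) that by auto
  qed
qed

text \<open>On the line \<beta> = B g' satisfies \<beta>^2 = \<kappa>^2 |g'|^2, so \<beta> is real,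
  and nonzero outside the trivial cases. Differentiating the relation for B^2 g' and multiplying by
  g' gives 2 \<beta> B' g' = -2 \<kappa>^2 Re (g'' cnj g'), so B' g' is real. The remaining summand
  is (c - 1) |g'|^2.\<close>

lemma boundary_quadratic_differential_real:
  fixes c \<kappa> :: real
  assumes "Re p = s" "z \<in> ball p r" "Re z = s"
    and g: "g holomorphic_on ball p r" and B: "B holomorphic_on ball p r"
    and rel: "\<And>z. z \<in> ball p r \<Longrightarrow> (B z)\<^sup>2 * deriv g z = \<kappa>\<^sup>2 * reflect s (deriv g) z"
    and zero: "\<kappa> = 0 \<Longrightarrow> (\<And>z. z \<in> ball p r \<Longrightarrow> B z = 0)"
  shows "Im ((deriv B z + (c - 1) * reflect s (deriv g) z) * deriv g z) = 0"
proof -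
  let ?b = "B z" and ?b' = "deriv B z" and ?g1 = "deriv g z" and ?g2 = "deriv (deriv g) z"
  have st: "reflect s (deriv g) z = cnj ?g1" using assms by (simp add: reflect_on_line)
  have "Im (?b' * ?g1) = 0"
  proof (cases "\<kappa> = 0 \<or> ?g1 = 0")
    case True
    moreover have "?b' = 0" if "\<kappa> = 0"
    proof -
      have "((\<lambda>_. 0) has_field_derivative ?b') (at z)"
        by (rule has_field_derivative_transform_within_open[OF holomorphic_derivI[OF B open_ball assms(2)] open_ball assms(2)])
           (use zero that in auto)
      then show ?thesis using DERIV_const DERIV_unique by blast
    qed
    ultimately show ?thesis by auto
  next
    case False
    define \<beta> where "\<beta> = ?b * ?g1"
    have r0: "?b\<^sup>2 * ?g1 = \<kappa>\<^sup>2 * cnj ?g1" using rel[OF assms(2)] st by simp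
    have "\<beta>\<^sup>2 = of_real ((\<kappa> * norm ?g1)\<^sup>2)"
    proof -
      have "\<beta>\<^sup>2 = (?b\<^sup>2 * ?g1) * ?g1" by (simp add: \<beta>_def power2_eq_square)
      also have "\<dots> = \<kappa>\<^sup>2 * (?g1 * cnj ?g1)" by (simp add: r0)
      also have "?g1 * cnj ?g1 = of_real ((norm ?g1)\<^sup>2)" by (rule complex_norm_square[symmetric])
      finally show ?thesis by (simp add: power_mult_distrib)
    qed
    then have "Im \<beta> = 0" "\<beta> \<noteq> 0"
    proof -
      assume *: "\<beta>\<^sup>2 = of_real ((\<kappa> * norm ?g1)\<^sup>2)"
      then have "Re \<beta> * Im \<beta> = 0" "(Re \<beta>)\<^sup>2 - (Im \<beta>)\<^sup>2 = (\<kappa> * norm ?g1)\<^sup>2"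
        by (auto simp: complex_eq_iff power2_eq_square simp del: of_real_power)
      moreover have "(\<kappa> * norm ?g1)\<^sup>2 > 0" using False by simp
      ultimately have pos: "(Re \<beta>)\<^sup>2 - (Im \<beta>)\<^sup>2 > 0" and "Re \<beta> = 0 \<or> Im \<beta> = 0" by auto
      moreover have "Re \<beta> \<noteq> 0"
      proof
        assume "Re \<beta> = 0"
        with pos show False using zero_le_power2[of "Im \<beta>"] by simp
      qed
      ultimately show "Im \<beta> = 0" "\<beta> \<noteq> 0" by auto
    qed
    have g': "deriv g holomorphic_on ball p r" using g by (intro holomorphic_intros) auto
    have dg': "(deriv g has_field_derivative deriv (deriv g) w) (at w)" if "w \<in> ball p r" for w
      using holomorphic_derivI[OF g' open_ball that] .
    have "((\<lambda>z. (B z)\<^sup>2 * deriv g z) has_field_derivative (2 * ?b * ?b' * ?g1 + ?b\<^sup>2 * ?g2)) (at z)"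
      using holomorphic_derivI[OF B open_ball assms(2)] dg'[OF assms(2)]
      by (auto intro!: derivative_eq_intros simp: algebra_simps)
    then have "((\<lambda>z. \<kappa>\<^sup>2 * reflect s (deriv g) z) has_field_derivative (2 * ?b * ?b' * ?g1 + ?b\<^sup>2 * ?g2)) (at z)"
      by (rule has_field_derivative_transform_within_open[OF _ open_ball assms(2)]) (use rel in auto)
    moreover have "2 * of_real s - cnj z = z" using assms(3) by (simp add: complex_eq_iff)
    then have "(reflect s (deriv g) has_field_derivative - cnj ?g2) (at z)"
      using has_field_derivative_reflect[of "deriv g" ?g2 s z] dg'[OF assms(2)] by simp
    then have "((\<lambda>z. \<kappa>\<^sup>2 * reflect s (deriv g) z) has_field_derivative (\<kappa>\<^sup>2 * - cnj ?g2)) (at z)"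
      by (rule DERIV_cmult)
    ultimately have d: "2 * ?b * ?b' * ?g1 + ?b\<^sup>2 * ?g2 = - \<kappa>\<^sup>2 * cnj ?g2"
      using DERIV_unique by fastforce
    have "2 * \<beta> * (?b' * ?g1) = - (\<kappa>\<^sup>2 * (cnj ?g2 * ?g1 + cnj ?g1 * ?g2))"
    proof -
      have "2 * ?b * ?b' * ?g1 + ?b\<^sup>2 * ?g2 = - (of_real (\<kappa>\<^sup>2) * cnj ?g2)"
        using d by (simp del: of_real_power)
      with r0 show ?thesis unfolding \<beta>_def by algebra
    qed
    moreover have "Im (- (\<kappa>\<^sup>2 * (cnj ?g2 * ?g1 + cnj ?g1 * ?g2))) = 0" by (simp add: algebra_simps flip: of_real_power)
    ultimately have "Im (2 * \<beta> * (?b' * ?g1)) = 0" by simp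
    moreover have "2 * \<beta> = of_real (2 * Re \<beta>)" using \<open>Im \<beta> = 0\<close> by (simp add: complex_eq_iff)
    ultimately have "2 * Re \<beta> * Im (?b' * ?g1) = 0"
      by (metis Im_complex_of_real Re_complex_of_real add_0_right mult_zero_left times_complex.simps(2))
    moreover have "Re \<beta> \<noteq> 0" using \<open>\<beta> \<noteq> 0\<close> \<open>Im \<beta> = 0\<close> by (simp add: complex_eq_iff)
    ultimately show ?thesis by simp
  qed
  moreover have "Im ((c - 1) * cnj ?g1 * ?g1) = 0" by (simp add: algebra_simps)
  ultimately show ?thesis unfolding st by (simp add: distrib_right)
qed

text \<open>
  With \<open>e = B g'\<close> one has \<open>e' = e (\<eta> - \<eta>\<^sup>*) = 2\<eta>e + \<tau> + \<mu>e\<^sup>2\<close> where \<open>\<mu> = (1 - c) / \<kappa>\<^sup>2\<close>, hence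
  \<open>\<eta> + \<eta>\<^sup>* = - (\<tau>/e + \<mu>e)\<close>; differentiating, \<open>P = \<tau>/e - \<mu>e\<close>.
\<close>

lemma local_reflection_dichotomy:
  fixes c \<kappa> :: real
  assumes "Re p = s" "\<tau> \<noteq> 0"
    and g: "g holomorphic_on ball p r" "\<And>z. z \<in> ball p r \<Longrightarrow> deriv g z \<noteq> 0"
    and B: "B holomorphic_on ball p r"
    and rel: "\<And>z. z \<in> ball p r \<Longrightarrow> (B z)\<^sup>2 * deriv g z = \<kappa>\<^sup>2 * reflect s (deriv g) z"
    and zero: "\<kappa> = 0 \<Longrightarrow> (\<And>z. z \<in> ball p r \<Longrightarrow> B z = 0)"
    and lam: "\<And>z. z \<in> ball p r \<Longrightarrow> (deriv B z + (c - 1) * reflect s (deriv g) z) * deriv g z = \<tau>"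
    and \<eta>: "\<And>z. z \<in> ball p r \<Longrightarrow> \<eta> z = deriv (deriv g) z / (2 * deriv g z)"
  shows "(\<forall>z\<in>ball p r. \<eta> z = reflect s \<eta> z) \<or>
    (\<exists>P. \<forall>z\<in>ball p r. (P has_field_derivative (\<eta> z)\<^sup>2 - (reflect s \<eta> z)\<^sup>2) (at z) \<and>
       deriv \<eta> z - reflect s (deriv \<eta>) z = P z * (\<eta> z - reflect s \<eta> z))"
proof -
  let ?k = "reflect s (deriv g)"
  have g': "deriv g holomorphic_on ball p r" "deriv (deriv g) holomorphic_on ball p r"
    using g by (auto intro!: holomorphic_intros)
  have dg': "(deriv g has_field_derivative 2 * \<eta> z * deriv g z) (at z)" if "z \<in> ball p r" for z
    using holomorphic_derivI[OF g'(1) open_ball that] g(2)[OF that] by (simp add: \<eta>[OF that])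
  have dk: "(?k has_field_derivative - 2 * reflect s \<eta> z * ?k z) (at z)" if "z \<in> ball p r" for z
    using has_field_derivative_reflect[OF dg'[OF mirror_mem_ball[OF assms(1) that]]]
    by (simp add: reflect_def)
  have k0: "?k z \<noteq> 0" if "z \<in> ball p r" for z
    using g(2)[OF mirror_mem_ball[OF assms(1) that]] by (simp add: reflect_def)
  have hol\<eta>: "\<eta> holomorphic_on ball p r"
    by (rule holomorphic_transform[of "\<lambda>z. deriv (deriv g) z / (2 * deriv g z)"])
       (auto intro!: holomorphic_intros g' simp: g(2) \<eta>)
  have d\<eta>: "(\<eta> has_field_derivative deriv \<eta> z) (at z)" if "z \<in> ball p r" for z
    using holomorphic_derivI[OF hol\<eta> open_ball that] .
  have d\<eta>': "(reflect s \<eta> has_field_derivative - reflect s (deriv \<eta>) z) (at z)" if "z \<in> ball p r" for z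
    using has_field_derivative_reflect[OF d\<eta>[OF mirror_mem_ball[OF assms(1) that]]]
    by (simp add: reflect_def)
  have eqD: "a = b" if "(f has_field_derivative a) (at z)" "(h has_field_derivative b) (at z)"
    "\<And>w. w \<in> ball p r \<Longrightarrow> f w = h w" "z \<in> ball p r" for f h :: "complex \<Rightarrow> complex" and a b z
  proof -
    have "(f has_field_derivative b) (at z)"
      by (rule has_field_derivative_transform_within_open[OF that(2) open_ball that(4)]) (use that in auto)
    then show ?thesis using that(1) DERIV_unique by blast
  qed
  show ?thesis
  proof (cases "\<kappa> = 0")
    case True
    have dB: "deriv B z = 0" if "z \<in> ball p r" for z
      by (rule eqD[OF holomorphic_derivI[OF B open_ball that] DERIV_const[of 0] _ that])
        (use zero True in auto)
    \<comment> \<open>For \<kappa> = 0 the constant \<tau> is (c - 1) (g')# g'. Its logarithmic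
      derivative 2 (\<eta> - \<eta>#) must vanish, as \<tau> is nonzero.\<close>
    have gk: "(c - 1) * ?k z * deriv g z = \<tau>" if "z \<in> ball p r" for z
      using lam[OF that] dB[OF that] by simp
    have "\<eta> z = reflect s \<eta> z" if z: "z \<in> ball p r" for z
    proof -
      have "((\<lambda>z. (c - 1) * ?k z * deriv g z) has_field_derivative
          (c - 1) * ?k z * deriv g z * (2 * (\<eta> z - reflect s \<eta> z))) (at z)"
        using dg'[OF z] dk[OF z] by (auto intro!: derivative_eq_intros simp: algebra_simps)
      from eqD[OF this DERIV_const[of \<tau>] gk z] have "\<tau> * (2 * (\<eta> z - reflect s \<eta> z)) = 0"
        by (simp only: gk[OF z])
      then show ?thesis using \<open>\<tau> \<noteq> 0\<close> by simp
    qed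
    then show ?thesis by blast
  next
    case False
    define e where "e z = B z * deriv g z" for z
    define \<mu> :: complex where "\<mu> = (1 - c) / \<kappa>\<^sup>2"
    have e2: "(e z)\<^sup>2 = \<kappa>\<^sup>2 * (deriv g z * ?k z)" if "z \<in> ball p r" for z
      using rel[OF that] by (simp add: e_def power2_eq_square algebra_simps)
    have e0: "e z \<noteq> 0" if "z \<in> ball p r" for z
      using e2[OF that] g(2)[OF that] k0[OF that] False by auto
    have de1: "(e has_field_derivative 2 * \<eta> z * e z + \<tau> + \<mu> * (e z)\<^sup>2) (at z)" if z: "z \<in> ball p r" for z
    proof -
      have "\<mu> * (e z)\<^sup>2 = (1 - c) * (deriv g z * ?k z)"
        using False by (simp add: e2[OF z] \<mu>_def)
      then have "deriv B z * deriv g z = \<tau> + \<mu> * (e z)\<^sup>2"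
        using lam[OF z] unfolding of_real_diff by algebra
      moreover have "(e has_field_derivative deriv B z * deriv g z + 2 * \<eta> z * e z) (at z)"
        unfolding e_def[abs_def] using holomorphic_derivI[OF B open_ball z] dg'[OF z]
        by (auto intro!: derivative_eq_intros simp: e_def algebra_simps)
      ultimately show ?thesis by (simp add: algebra_simps)
    qed
    \<comment> \<open>A second expression for e', obtained from e^2 = \<kappa>^2 g' (g')#;
      comparison with \<open>de1\<close> eliminates B.\<close>
    have de2: "2 * \<eta> z * e z + \<tau> + \<mu> * (e z)\<^sup>2 = e z * (\<eta> z - reflect s \<eta> z)" if z: "z \<in> ball p r" for z
    proof -
      have "((\<lambda>z. (e z)\<^sup>2) has_field_derivative 2 * e z * (2 * \<eta> z * e z + \<tau> + \<mu> * (e z)\<^sup>2)) (at z)"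
        using de1[OF z] by (auto intro!: derivative_eq_intros)
      moreover have "((\<lambda>z. \<kappa>\<^sup>2 * (deriv g z * ?k z)) has_field_derivative
          \<kappa>\<^sup>2 * (deriv g z * ?k z) * (2 * (\<eta> z - reflect s \<eta> z))) (at z)"
        using dg'[OF z] dk[OF z] by (auto intro!: derivative_eq_intros simp: algebra_simps)
      ultimately have "2 * e z * (2 * \<eta> z * e z + \<tau> + \<mu> * (e z)\<^sup>2) = \<kappa>\<^sup>2 * (deriv g z * ?k z) * (2 * (\<eta> z - reflect s \<eta> z))"
        by (rule eqD[OF _ _ e2 z])
      then have "2 * e z * (2 * \<eta> z * e z + \<tau> + \<mu> * (e z)\<^sup>2) = 2 * e z * (e z * (\<eta> z - reflect s \<eta> z))"
        unfolding e2[OF z, symmetric] by algebra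
      then show ?thesis using e0[OF z] by simp
    qed
    have de: "(e has_field_derivative e z * (\<eta> z - reflect s \<eta> z)) (at z)" if z: "z \<in> ball p r" for z
      using de1[OF z] unfolding de2[OF z] .
    have sum: "\<eta> z + reflect s \<eta> z = - (\<tau> / e z + \<mu> * e z)" if z: "z \<in> ball p r" for z
    proof -
      have "e z * (\<eta> z + reflect s \<eta> z) = e z * (- (\<tau> / e z + \<mu> * e z))"
      proof -
        have "e z * (\<eta> z + reflect s \<eta> z) = - (\<tau> + \<mu> * (e z)\<^sup>2)" using de2[OF z] by algebra
        also have "\<dots> = e z * (- (\<tau> / e z + \<mu> * e z))"
          using e0[OF z] by (simp add: algebra_simps power2_eq_square)
        finally show ?thesis .
      qed
      then show ?thesis using e0[OF z] by simp
    qed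
    define P where "P z = \<tau> / e z - \<mu> * e z" for z
    have "(P has_field_derivative (\<eta> z)\<^sup>2 - (reflect s \<eta> z)\<^sup>2) (at z)" if z: "z \<in> ball p r" for z
    proof -
      have "(P has_field_derivative (- (\<tau> / e z + \<mu> * e z)) * (\<eta> z - reflect s \<eta> z)) (at z)"
        unfolding P_def[abs_def] using de[OF z] e0[OF z]
        by (auto intro!: derivative_eq_intros simp: field_simps power2_eq_square)
      then show ?thesis unfolding sum[OF z, symmetric] by (simp add: algebra_simps power2_eq_square)
    qed
    moreover have "deriv \<eta> z - reflect s (deriv \<eta>) z = P z * (\<eta> z - reflect s \<eta> z)" if z: "z \<in> ball p r" for z
    proof (rule eqD[OF _ _ sum z])
      show "((\<lambda>z. \<eta> z + reflect s \<eta> z) has_field_derivative deriv \<eta> z - reflect s (deriv \<eta>) z) (at z)"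
        using d\<eta>[OF z] d\<eta>'[OF z] by (auto intro!: derivative_eq_intros)
      show "((\<lambda>z. - (\<tau> / e z + \<mu> * e z)) has_field_derivative P z * (\<eta> z - reflect s \<eta> z)) (at z)"
        unfolding P_def using de[OF z] e0[OF z]
        by (auto intro!: derivative_eq_intros simp: field_simps power2_eq_square)
    qed
    ultimately show ?thesis by blast
  qed
qed

section \<open>Maximum principle on the periodic band\<close>

lemma ex_int_shift:
  fixes T y :: real
  assumes "0 < T"
  shows "\<exists>n::int. 0 \<le> y + of_int n * T \<and> y + of_int n * T \<le> T"
proof -
  have "of_int \<lfloor>y / T\<rfloor> * T \<le> y"
    using floor_correct[of "y / T"] assms by (simp only: pos_le_divide_eq)
  moreover have "y / T \<le> of_int \<lfloor>y / T\<rfloor> + 1" by linarith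
  then have "y \<le> (of_int \<lfloor>y / T\<rfloor> + 1) * T"
    using assms by (simp only: pos_divide_le_eq)
  ultimately show ?thesis
    by (intro exI[of _ "- \<lfloor>y / T\<rfloor>"]) (simp add: algebra_simps)
qed

text \<open>Only the imaginary part has to extend to the closed band for the maximum principle.\<close>

lemma band_constant:
  assumes "s\<^sub>1 < s\<^sub>2" "0 < T"
    and hol: "K holomorphic_on {z. s\<^sub>1 < Re z \<and> Re z < s\<^sub>2}"
    and per: "\<And>z. s\<^sub>1 < Re z \<Longrightarrow> Re z < s\<^sub>2 \<Longrightarrow> K (z + of_real T * \<i>) = K z"
    and bd: "\<And>p. Re p = s\<^sub>1 \<or> Re p = s\<^sub>2 \<Longrightarrow>
      ((\<lambda>z. Im (K z)) \<longlongrightarrow> 0) (at p within {z. s\<^sub>1 < Re z \<and> Re z < s\<^sub>2})"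
  obtains \<tau> where "\<And>z. s\<^sub>1 < Re z \<Longrightarrow> Re z < s\<^sub>2 \<Longrightarrow> K z = \<tau>"
proof -
  let ?O = "{z. s\<^sub>1 < Re z \<and> Re z < s\<^sub>2}"
  have O: "?O = {z. s\<^sub>1 < Re z} \<inter> {z. Re z < s\<^sub>2}" by auto
  have opn: "open ?O" unfolding O by (intro open_Int open_halfspace_Re_gt open_halfspace_Re_lt)
  have conn: "connected ?O" unfolding O
    by (intro convex_connected convex_Int convex_halfspace_Re_gt convex_halfspace_Re_lt)
  \<comment> \<open>Stated for every such function, since it is used for K and for -K.\<close>
  have le0: "Im (K z) \<le> 0"
    if hol: "K holomorphic_on ?O" and per: "\<And>z. z \<in> ?O \<Longrightarrow> K (z + of_real T * \<i>) = K z"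
      and bd: "\<And>p. Re p = s\<^sub>1 \<or> Re p = s\<^sub>2 \<Longrightarrow> ((\<lambda>z. Im (K z)) \<longlongrightarrow> 0) (at p within ?O)"
      and "z \<in> ?O" for K z
  proof -
    \<comment> \<open>Im K extended by zero to the edges: the boundary limits make it continuous on
      the closed band, and periodicity reduces its maximum to a compact rectangle.\<close>
    define w where "w z = (if z \<in> ?O then Im (K z) else 0)" for z
    let ?C = "{z. s\<^sub>1 \<le> Re z \<and> Re z \<le> s\<^sub>2}"
    have per': "w (z + of_real T * \<i>) = w z" for z using per[of z] by (auto simp: w_def)
    have pern: "w (z + of_nat n * of_real T * \<i>) = w z" for z n
      by (induction n) (use per' in \<open>auto simp: algebra_simps\<close>, metis add.commute add.left_commute)
    have peri: "w (z + of_int n * of_real T * \<i>) = w z" for z n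
    proof (cases "n \<ge> 0")
      case True
      then show ?thesis using pern[of z "nat n"] by simp
    next
      case False
      then show ?thesis using pern[of "z + of_int n * of_real T * \<i>" "nat (- n)"]
        by (simp add: of_nat_nat algebra_simps)
    qed
    have cont: "continuous_on ?C w"
      unfolding continuous_on_def
    proof
      fix p assume p: "p \<in> ?C"
      show "(w \<longlongrightarrow> w p) (at p within ?C)"
      proof (cases "p \<in> ?O")
        case True
        have "((\<lambda>z. Im (K z)) \<longlongrightarrow> Im (K p)) (at p)"
          using hol opn True holomorphic_on_imp_continuous_on[OF hol]
          by (intro tendsto_Im) (simp add: continuous_on_eq_continuous_at isCont_def)
        then have "(w \<longlongrightarrow> Im (K p)) (at p)"
          by (rule Lim_transform_within_open[OF _ opn True]) (simp add: w_def)
        moreover have "w p = Im (K p)" using True by (simp add: w_def)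
        ultimately have "(w \<longlongrightarrow> w p) (at p)" by simp
        then show ?thesis by (rule tendsto_within_subset) auto
      next
        case False
        then have e: "Re p = s\<^sub>1 \<or> Re p = s\<^sub>2" using p by auto
        have w0: "w p = 0" using False unfolding w_def by (simp only: if_False)
        show ?thesis unfolding w0
        proof (rule tendstoI)
          fix \<epsilon> :: real assume "\<epsilon> > 0"
          then have "\<forall>\<^sub>F z in at p within ?O. dist (Im (K z)) 0 < \<epsilon>" using bd[OF e] by (auto simp: tendsto_iff)
          then show "\<forall>\<^sub>F z in at p within ?C. dist (w z) 0 < \<epsilon>"
            unfolding eventually_at_filter
            by eventually_elim (use \<open>\<epsilon> > 0\<close> in \<open>auto simp: w_def\<close>)
        qed
      qed
    qed
    define R where "R = cbox (Complex s\<^sub>1 0) (Complex s\<^sub>2 T)"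
    have R: "R = {z. s\<^sub>1 \<le> Re z \<and> Re z \<le> s\<^sub>2 \<and> 0 \<le> Im z \<and> Im z \<le> T}"
      by (auto simp: R_def in_cbox_complex_iff)
    have "compact R" "R \<noteq> {}" unfolding R_def using assms(1,2)
      by (auto intro: compact_cbox simp: box_ne_empty Basis_complex_def inner_complex_def)
    then obtain q where q: "q \<in> R" "\<And>z. z \<in> R \<Longrightarrow> w z \<le> w q"
      using continuous_attains_sup[of R w] continuous_on_subset[OF cont, of R] R by auto
    have max: "w z \<le> w q" if "z \<in> ?C" for z
    proof -
      obtain n :: int where "0 \<le> Im z + of_int n * T" "Im z + of_int n * T \<le> T"
        using ex_int_shift[OF \<open>0 < T\<close>] by blast
      then have "z + of_int n * of_real T * \<i> \<in> R" using that by (auto simp: R)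
      then show ?thesis using q(2) peri by metis
    qed
    have "w q \<le> 0"
    proof (rule ccontr)
      assume pos: "\<not> w q \<le> 0"
      then have qO: "q \<in> ?O" by (auto simp: w_def split: if_splits)
      \<comment> \<open>|f| = exp (Im K), so the maximum modulus principle applies to Im K. A
        positive maximum would make Im K constant, contradicting its limit 0 at an edge.\<close>
      define f where "f z = exp (- \<i> * K z)" for z
      have nf: "norm (f z) = exp (Im (K z))" for z by (simp add: f_def)
      have "f constant_on ?O"
      proof (rule maximum_modulus_principle[OF _ opn conn opn order_refl qO])
        show "f holomorphic_on ?O" unfolding f_def by (intro holomorphic_intros hol)
        fix z assume "z \<in> ?O"
        then have "w z \<le> w q" by (intro max) auto
        then show "norm (f z) \<le> norm (f q)" using \<open>z \<in> ?O\<close> qO by (simp add: nf w_def)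
      qed
      then have nrm: "norm (f z) = norm (f q)" if "z \<in> ?O" for z
        using that qO unfolding constant_on_def by metis
      have wq: "w q = Im (K q)" using qO unfolding w_def by (simp only: if_True)
      have const: "Im (K z) = w q" if "z \<in> ?O" for z
        using nrm[OF that] unfolding nf wq exp_inj_iff .
      let ?p = "complex_of_real s\<^sub>1"
      have lim: "?p islimpt ?O"
      proof (unfold islimpt_approachable, intro allI impI)
        fix e :: real assume "e > 0"
        define h where "h = min (e / 2) ((s\<^sub>2 - s\<^sub>1) / 2)"
        have "h > 0" "h < e" "s\<^sub>1 + h < s\<^sub>2" using \<open>e > 0\<close> assms(1) by (auto simp: h_def min_def field_simps)
        then show "\<exists>x'\<in>?O. x' \<noteq> ?p \<and> dist x' ?p < e"
          by (intro bexI[of _ "?p + of_real h"]) (auto simp: dist_norm)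
      qed
      have "((\<lambda>z. w q) \<longlongrightarrow> 0) (at ?p within ?O)"
        by (rule Lim_transform_eventually[OF bd[of ?p]]) (auto simp: eventually_at_filter const)
      then have "w q = 0"
        using lim tendsto_unique[of "at ?p within ?O" "\<lambda>z. w q"] by (simp add: trivial_limit_within)
      with pos show False by simp
    qed
    then show ?thesis using max[of z] \<open>z \<in> ?O\<close> by (auto simp: w_def)
  qed
  have bd': "((\<lambda>z. Im (- K z)) \<longlongrightarrow> 0) (at p within ?O)" if "Re p = s\<^sub>1 \<or> Re p = s\<^sub>2" for p
    using tendsto_minus[OF bd[OF that]] by simp
  have per': "K (z + of_real T * \<i>) = K z" if "z \<in> ?O" for z
    using per that by simp
  then have per'': "- K (z + of_real T * \<i>) = - K z" if "z \<in> ?O" for z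
    using that by simp
  have Im0: "Im (K z) = 0" if z: "z \<in> ?O" for z
  proof -
    have "Im (K z) \<le> 0" by (rule le0[OF hol per' bd z])
    moreover have "Im (- K z) \<le> 0" by (rule le0[OF holomorphic_on_minus[OF hol] per'' bd' z])
    ultimately show ?thesis by simp
  qed
  define z\<^sub>0 where "z\<^sub>0 = complex_of_real ((s\<^sub>1 + s\<^sub>2) / 2)"
  have z0: "z\<^sub>0 \<in> ?O" using assms(1) by (simp add: z\<^sub>0_def)
  \<comment> \<open>A nonconstant holomorphic function is open and cannot take only real
    values.\<close>
  have "K constant_on ?O"
  proof (rule ccontr)
    assume "\<not> K constant_on ?O"
    then have "open (K ` ?O)" by (rule open_mapping_thm[OF hol opn conn opn order_refl])
    then obtain e where e: "e > 0" "ball (K z\<^sub>0) e \<subseteq> K ` ?O" using z0 by (meson imageI openE)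
    have "K z\<^sub>0 + of_real (e / 2) * \<i> \<in> ball (K z\<^sub>0) e" using e(1) by (simp add: dist_norm norm_mult)
    from subsetD[OF e(2) this] obtain y where "y \<in> ?O" "K z\<^sub>0 + of_real (e / 2) * \<i> = K y"
      by (rule imageE)
    then have "Im (K z\<^sub>0 + of_real (e / 2) * \<i>) = 0" using Im0 by simp
    then show False using Im0[OF z0] e(1) by simp
  qed
  then show ?thesis using that unfolding constant_on_def by blast
qed

section \<open>Capillary boundary conditions in the plane\<close>

text \<open>The gradient is assumed differentiable at z, with no continuity of second derivatives.
  The mean value theorem in direction a, applied to the increment of u in direction b, leaves a
  difference of two values of G, expanded to first order at z. The two increments have lengths at
  most 2t and t, whence 3 \<epsilon>.\<close>

lemma second_difference_estimate:
  fixes u :: "complex \<Rightarrow> real" and G G' :: "complex \<Rightarrow> complex"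
  assumes "open S" "z \<in> S"
    and u: "\<And>w. w \<in> S \<Longrightarrow> (u has_derivative (\<lambda>h. h \<bullet> G w)) (at w)"
    and G: "(G has_derivative G') (at z)"
    and ab: "norm a = 1" "norm b = 1" and "\<epsilon> > 0"
  shows "\<forall>\<^sub>F t in at_right 0.
    \<bar>u (z + t *\<^sub>R a + t *\<^sub>R b) - u (z + t *\<^sub>R a) - u (z + t *\<^sub>R b) + u z - t\<^sup>2 * (a \<bullet> G' b)\<bar> \<le> 3 * \<epsilon> * t\<^sup>2"
proof -
  obtain \<delta>\<^sub>1 where \<delta>1: "\<delta>\<^sub>1 > 0" "ball z \<delta>\<^sub>1 \<subseteq> S" using assms(1,2) openE by blast
  obtain \<delta>\<^sub>2 where \<delta>2: "\<delta>\<^sub>2 > 0"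
    "\<And>y. norm (y - z) < \<delta>\<^sub>2 \<Longrightarrow> norm (G y - G z - G' (y - z)) \<le> \<epsilon> * norm (y - z)"
    using G \<open>\<epsilon> > 0\<close> unfolding has_derivative_at_alt by blast
  have lin: "linear G'" using G has_derivative_linear by blast
  define \<delta> where "\<delta> = min \<delta>\<^sub>1 \<delta>\<^sub>2 / 2"
  have "\<delta> > 0" using \<delta>1 \<delta>2 by (simp add: \<delta>_def)
  have main: "\<bar>u (z + t *\<^sub>R a + t *\<^sub>R b) - u (z + t *\<^sub>R a) - u (z + t *\<^sub>R b) + u z - t\<^sup>2 * (a \<bullet> G' b)\<bar> \<le> 3 * \<epsilon> * t\<^sup>2"
    if t: "0 < t" "t < \<delta>" for t
  proof -
    define \<phi> where "\<phi> x = u (z + x *\<^sub>R a + t *\<^sub>R b) - u (z + x *\<^sub>R a)" for x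
    have n1: "norm (x *\<^sub>R a + t *\<^sub>R b) \<le> 2 * t" "norm (x *\<^sub>R a) \<le> t" if "0 \<le> x" "x \<le> t" for x
      using norm_triangle_ineq[of "x *\<^sub>R a" "t *\<^sub>R b"] ab that t by auto
    have small: "2 * t < \<delta>\<^sub>1" "2 * t < \<delta>\<^sub>2" "t < \<delta>\<^sub>1" "t < \<delta>\<^sub>2" using t by (auto simp: \<delta>_def)
    have d\<phi>: "(\<phi> has_real_derivative a \<bullet> (G (z + x *\<^sub>R a + t *\<^sub>R b) - G (z + x *\<^sub>R a))) (at x)"
      if x: "0 \<le> x" "x \<le> t" for x
    proof -
      have "norm (x *\<^sub>R a + t *\<^sub>R b) < \<delta>\<^sub>1" "norm (x *\<^sub>R a) < \<delta>\<^sub>1" using n1[OF x] small by linarith+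
      moreover have "z + y \<in> ball z \<delta>\<^sub>1" if "norm y < \<delta>\<^sub>1" for y
        using that by (simp add: dist_norm)
      ultimately have "z + (x *\<^sub>R a + t *\<^sub>R b) \<in> ball z \<delta>\<^sub>1" "z + x *\<^sub>R a \<in> ball z \<delta>\<^sub>1" by blast+
      then have "z + x *\<^sub>R a + t *\<^sub>R b \<in> ball z \<delta>\<^sub>1" "z + x *\<^sub>R a \<in> ball z \<delta>\<^sub>1"
        by (simp_all only: add.assoc)
      then have S: "z + x *\<^sub>R a + t *\<^sub>R b \<in> S" "z + x *\<^sub>R a \<in> S" using \<delta>1 by auto
      have "((\<lambda>x. u (z + x *\<^sub>R a + t *\<^sub>R b)) has_derivative (\<lambda>h. (h *\<^sub>R a) \<bullet> G (z + x *\<^sub>R a + t *\<^sub>R b))) (at x)"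
        by (rule has_derivative_compose[where g = u and f = "\<lambda>x. z + x *\<^sub>R a + t *\<^sub>R b"
              and g' = "\<lambda>h. h \<bullet> G (z + x *\<^sub>R a + t *\<^sub>R b)"])
          (use u[OF S(1)] in \<open>auto intro!: derivative_eq_intros\<close>)
      moreover have "((\<lambda>x. u (z + x *\<^sub>R a)) has_derivative (\<lambda>h. (h *\<^sub>R a) \<bullet> G (z + x *\<^sub>R a))) (at x)"
        by (rule has_derivative_compose[where g = u and f = "\<lambda>x. z + x *\<^sub>R a"
              and g' = "\<lambda>h. h \<bullet> G (z + x *\<^sub>R a)"])
          (use u[OF S(2)] in \<open>auto intro!: derivative_eq_intros\<close>)
      ultimately have "(\<phi> has_derivative (\<lambda>h. (h *\<^sub>R a) \<bullet> G (z + x *\<^sub>R a + t *\<^sub>R b) - (h *\<^sub>R a) \<bullet> G (z + x *\<^sub>R a))) (at x)"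
        unfolding \<phi>_def by (rule has_derivative_diff)
      then show ?thesis
        by (rule has_derivative_imp_has_field_derivative) (simp add: inner_diff_right algebra_simps)
    qed
    obtain \<xi> where \<xi>: "0 < \<xi>" "\<xi> < t"
      "\<phi> t - \<phi> 0 = (t - 0) * (a \<bullet> (G (z + \<xi> *\<^sub>R a + t *\<^sub>R b) - G (z + \<xi> *\<^sub>R a)))"
      using MVT2[of 0 t \<phi>, OF t(1) d\<phi>] by blast
    define r where "r y = G (z + y) - G z - G' y" for y
    have r: "norm (r y) \<le> \<epsilon> * norm y" if "norm y < \<delta>\<^sub>2" for y
      using \<delta>2(2)[of "z + y"] that by (simp add: r_def)
    let ?y = "\<xi> *\<^sub>R a + t *\<^sub>R b" and ?y' = "\<xi> *\<^sub>R a"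
    have ny: "norm ?y \<le> 2 * t" "norm ?y' \<le> t" using n1[of \<xi>] \<xi> by auto
    have "G (z + ?y) - G (z + ?y') = t *\<^sub>R G' b + (r ?y - r ?y')"
      unfolding r_def by (simp add: linear_add[OF lin] linear_scale[OF lin])
    then have Gd: "a \<bullet> (G (z + \<xi> *\<^sub>R a + t *\<^sub>R b) - G (z + \<xi> *\<^sub>R a)) = t * (a \<bullet> G' b) + a \<bullet> (r ?y - r ?y')"
      by (simp add: inner_add_right add.assoc)
    have eq: "\<phi> t - \<phi> 0 - t\<^sup>2 * (a \<bullet> G' b) = t * (a \<bullet> (r ?y - r ?y'))"
      unfolding \<xi>(3) Gd power2_eq_square by (simp only: diff_zero distrib_left mult.assoc add_diff_cancel_left')
    have "\<bar>a \<bullet> (r ?y - r ?y')\<bar> \<le> norm a * norm (r ?y - r ?y')" by (rule Cauchy_Schwarz_ineq2)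
    also have "\<dots> \<le> norm (r ?y) + norm (r ?y')" using ab norm_triangle_ineq4[of "r ?y" "r ?y'"] by simp
    also have "\<dots> \<le> \<epsilon> * norm ?y + \<epsilon> * norm ?y'"
      using r[of ?y] r[of ?y'] ny small by linarith
    also have "\<dots> \<le> \<epsilon> * (2 * t) + \<epsilon> * t"
      using ny \<open>\<epsilon> > 0\<close> by (intro add_mono mult_left_mono) auto
    finally have "\<bar>a \<bullet> (r ?y - r ?y')\<bar> \<le> 3 * \<epsilon> * t" by simp
    then have "\<bar>\<phi> t - \<phi> 0 - t\<^sup>2 * (a \<bullet> G' b)\<bar> \<le> t * (3 * \<epsilon> * t)"
      unfolding eq abs_mult using t by (intro mult_mono) auto
    moreover have "\<phi> t - \<phi> 0 = u (z + t *\<^sub>R a + t *\<^sub>R b) - u (z + t *\<^sub>R a) - u (z + t *\<^sub>R b) + u z"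
      by (simp add: \<phi>_def)
    ultimately show ?thesis by (simp add: power2_eq_square algebra_simps)
  qed
  show ?thesis
    unfolding eventually_at_right_field using \<open>\<delta> > 0\<close> main by blast
qed

text \<open>The second difference of u is symmetric in a and b, and its leading coefficient can be
  read in either order.\<close>

lemma second_derivative_symmetric:
  fixes u :: "complex \<Rightarrow> real" and G G' :: "complex \<Rightarrow> complex"
  assumes "open S" "z \<in> S"
    and u: "\<And>w. w \<in> S \<Longrightarrow> (u has_derivative (\<lambda>h. h \<bullet> G w)) (at w)"
    and G: "(G has_derivative G') (at z)"
    and ab: "norm a = 1" "norm b = 1"
  shows "a \<bullet> G' b = b \<bullet> G' a"
proof (rule ccontr)
  assume ne: "a \<bullet> G' b \<noteq> b \<bullet> G' a"
  \<comment> \<open>With 1/12 the two errors 3 \<epsilon> add up to half of the supposed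
    gap.\<close>
  define \<epsilon> where "\<epsilon> = \<bar>a \<bullet> G' b - b \<bullet> G' a\<bar> / 12"
  have "\<epsilon> > 0" using ne by (simp add: \<epsilon>_def)
  have "\<forall>\<^sub>F t::real in at_right 0. t > 0" by (simp add: eventually_at_right_less)
  moreover have est: "\<forall>\<^sub>F t in at_right 0.
    \<bar>u (z + t *\<^sub>R a + t *\<^sub>R b) - u (z + t *\<^sub>R a) - u (z + t *\<^sub>R b) + u z - t\<^sup>2 * (a \<bullet> G' b)\<bar> \<le> 3 * \<epsilon> * t\<^sup>2"
    if "norm a = 1" "norm b = 1" for a b
    by (rule second_difference_estimate[OF assms(1,2) _ G that \<open>\<epsilon> > 0\<close>]) (rule u)
  note est[OF ab] est[OF ab(2,1)]
  ultimately have "\<forall>\<^sub>F t in at_right (0::real). False"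
  proof eventually_elim
    case (elim t)
    have "t\<^sup>2 * \<bar>a \<bullet> G' b - b \<bullet> G' a\<bar> = \<bar>t\<^sup>2 * (a \<bullet> G' b) - t\<^sup>2 * (b \<bullet> G' a)\<bar>"
      by (simp add: abs_mult flip: right_diff_distrib)
    also have "\<dots> \<le> 3 * \<epsilon> * t\<^sup>2 + 3 * \<epsilon> * t\<^sup>2"
      using elim(2,3) by (simp only: add.assoc add.commute[of "t *\<^sub>R a"])
    also have "\<dots> = t\<^sup>2 * (\<bar>a \<bullet> G' b - b \<bullet> G' a\<bar> / 2)" by (simp add: \<epsilon>_def)
    finally show False using elim(1) ne by simp
  qed
  then show False by simp
qed

text \<open>The Cauchy-Riemann equations for (u_x + x) - i (u_y + y): one is the equation for the
  Laplacian, the other the symmetry of the Hessian.\<close>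

lemma torsion_holomorphic:
  assumes "open \<Omega>"
    and u: "\<And>w. w \<in> \<Omega> \<Longrightarrow> (u has_derivative (\<lambda>h. h \<bullet> G w)) (at w)"
    and G: "\<And>z. z \<in> \<Omega> \<Longrightarrow> \<exists>G'. (G has_derivative G') (at z) \<and> (\<Sum>b\<in>Basis. G' b \<bullet> b) + 2 = 0"
  shows "(\<lambda>w. cnj (G w) + cnj w) holomorphic_on \<Omega>"
proof (rule holomorphic_onI)
  fix z assume z: "z \<in> \<Omega>"
  obtain G' where G': "(G has_derivative G') (at z)" "(\<Sum>b\<in>Basis. G' b \<bullet> b) + 2 = 0"
    using G[OF z] by blast
  have tr: "Re (G' 1) + Im (G' \<i>) = - 2" using G'(2) by (simp add: Basis_complex_def)
  have sym: "Re (G' \<i>) = Im (G' 1)"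
    using second_derivative_symmetric[OF assms(1) z u G'(1), of 1 \<i>] by (simp add: inner_complex_def)
  have lin: "linear G'" using G'(1) has_derivative_linear by blast
  have G'h: "G' h = Re h *\<^sub>R G' 1 + Im h *\<^sub>R G' \<i>" for h
  proof -
    have "h = Re h *\<^sub>R 1 + Im h *\<^sub>R \<i>" by (simp add: complex_eq_iff)
    then show ?thesis using linear_add[OF lin] linear_scale[OF lin] by metis
  qed
  have "((\<lambda>w. cnj (G w) + cnj w) has_derivative (\<lambda>h. cnj (G' h) + cnj h)) (at z)"
    by (intro derivative_intros G' has_derivative_cnj)
  moreover have "(\<lambda>h. cnj (G' h) + cnj h) = (*) (cnj (G' 1) + 1)"
  proof
    fix h
    define a b where "a = Re (G' 1)" and "b = Im (G' 1)"
    have "G' 1 = Complex a b" "G' \<i> = Complex b (- 2 - a)"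
      using tr sym by (simp_all add: a_def b_def complex_eq_iff)
    then show "cnj (G' h) + cnj h = (cnj (G' 1) + 1) * h"
      unfolding G'h[of h] by (intro complex_eqI) (simp_all add: algebra_simps)
  qed
  ultimately have "((\<lambda>w. cnj (G w) + cnj w) has_field_derivative (cnj (G' 1) + 1)) (at z)"
    by (simp add: has_field_derivative_def)
  then show "(\<lambda>w. cnj (G w) + cnj w) field_differentiable at z within \<Omega>"
    using field_differentiable_def field_differentiable_at_within by blast
qed

text \<open>Take for P the constant boundary value. As u is constant along the curve, its gradient
  is normal there, so its length is the absolute value of the normal derivative.\<close>

lemma capillary_of_serrin:
  assumes "serrin_ring_domain \<Omega> u"
  shows "capillary_ring_domain \<Omega> u"
  unfolding capillary_ring_domain_def
proof (intro conjI ballI)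
  show "ring_domain \<Omega>" "torsion_solution \<Omega> u" using assms by (auto simp: serrin_ring_domain_def)
  fix C assume C: "C \<in> components (frontier \<Omega>)"
  then have sub: "C \<subseteq> closure \<Omega>" using in_components_subset by (fastforce simp: frontier_def)
  have "serrin_curve \<Omega> u C" using assms C by (simp add: serrin_ring_domain_def)
  then obtain a \<kappa> where ak: "\<forall>z\<in>C. u z = a \<and>
       (\<exists>D \<nu>. (u has_derivative (\<lambda>h. h \<bullet> D)) (at z within closure \<Omega>) \<and>
          exterior_unit_normal \<Omega> C z \<nu> \<and> \<nu> \<bullet> D = \<kappa>)"
    unfolding serrin_curve_def by (elim exE) (rule that)
  note ak = bspec[OF ak]
  have P: "capillary_poly a 0 0 0 = (\<lambda>_. a)" by (simp add: capillary_poly_def fun_eq_iff)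
  have "u z = a \<and> (\<exists>D. ((\<lambda>w. u w - a) has_derivative (\<lambda>h. h \<bullet> D)) (at z within closure \<Omega>) \<and> norm D = \<bar>\<kappa>\<bar>)"
    if z: "z \<in> C" for z
  proof -
    obtain D \<nu> where D: "(u has_derivative (\<lambda>h. h \<bullet> D)) (at z within closure \<Omega>)"
      and \<nu>: "exterior_unit_normal \<Omega> C z \<nu>" "\<nu> \<bullet> D = \<kappa>"
      using conjunct2[OF ak[OF z]] by (elim exE conjE) (rule that)
    obtain \<gamma> t where \<gamma>: "smooth_Jordan_param \<gamma>" "range \<gamma> = C" "\<gamma> t = z"
      "vector_derivative \<gamma> (at t) \<bullet> \<nu> = 0" and "norm \<nu> = 1"
      using \<nu>(1) unfolding exterior_unit_normal_def by (elim exE conjE) (rule that)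
    obtain \<Gamma> where \<Gamma>: "\<Gamma> (0::nat) = \<gamma>" "\<And>n t. (\<Gamma> n has_vector_derivative \<Gamma> (Suc n) t) (at t)" "\<And>t. \<Gamma> 1 t \<noteq> 0"
      using \<gamma>(1) unfolding smooth_Jordan_param_def by metis
    define v where "v = \<Gamma> 1 t"
    have dv: "(\<gamma> has_vector_derivative v) (at t)" using \<Gamma>(2)[of 0 t] by (simp add: \<Gamma>(1) v_def)
    have "v \<noteq> 0" using \<Gamma>(3) by (simp add: v_def)
    have "v \<bullet> \<nu> = 0" using \<gamma>(4) vector_derivative_at[OF dv] by simp
    have "((\<lambda>y. u (\<gamma> y)) has_derivative (\<lambda>y. (y *\<^sub>R v) \<bullet> D)) (at t)"
    proof (rule has_derivative_in_compose[where s = UNIV and f = \<gamma>])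
      show "(\<gamma> has_derivative (\<lambda>y. y *\<^sub>R v)) (at t)" using dv by (simp add: has_vector_derivative_def)
      show "(u has_derivative (\<lambda>h. h \<bullet> D)) (at (\<gamma> t) within range \<gamma>)"
        using D sub \<gamma>(2,3) has_derivative_subset by blast
    qed
    moreover have "(\<lambda>y. u (\<gamma> y)) = (\<lambda>_. a)" using ak \<gamma>(2) by blast
    ultimately have "((\<lambda>_. a) has_derivative (\<lambda>y. (y *\<^sub>R v) \<bullet> D)) (at t)" by simp
    from has_derivative_unique[OF this has_derivative_const] have "v \<bullet> D = 0"
      by (metis scaleR_one)
    \<comment> \<open>In the plane, D and \<nu> are both orthogonal to v, hence parallel.\<close>
    have "Re v * (Re \<nu> * Im D - Im \<nu> * Re D) = 0" "Im v * (Re \<nu> * Im D - Im \<nu> * Re D) = 0"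
      using \<open>v \<bullet> D = 0\<close> \<open>v \<bullet> \<nu> = 0\<close> unfolding inner_complex_def by algebra+
    with \<open>v \<noteq> 0\<close> have cross: "Re \<nu> * Im D - Im \<nu> * Re D = 0" by (auto simp: complex_eq_iff)
    have "(Re \<nu>)\<^sup>2 + (Im \<nu>)\<^sup>2 = 1" using \<open>norm \<nu> = 1\<close> by (simp add: cmod_def)
    then have "(Re D)\<^sup>2 + (Im D)\<^sup>2 = (\<nu> \<bullet> D)\<^sup>2"
      using cross unfolding inner_complex_def by algebra
    then have "norm D = \<bar>\<kappa>\<bar>" using \<nu>(2) by (simp add: cmod_def)
    then show ?thesis using ak[OF z] D by (auto intro!: derivative_eq_intros exI[of _ D])
  qed
  then show "capillary_curve \<Omega> u C"
    unfolding capillary_curve_def by (intro exI[of _ a] exI[of _ 0] exI[of _ "\<bar>\<kappa>\<bar>"]) (simp add: P)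
qed

section \<open>The capillary condition on the edges of the band\<close>

lemma has_derivative_capillary_poly:
  "(capillary_poly a d\<^sub>1 d\<^sub>2 c has_derivative (\<lambda>h. h \<bullet> (Complex d\<^sub>1 d\<^sub>2 - c *\<^sub>R w))) (at w within S)"
  unfolding capillary_poly_def[abs_def]
  by (auto intro!: derivative_eq_intros simp: inner_complex_def algebra_simps)

text \<open>Along the edge u - P pulled back by g is zero, so its tangential derivative vanishes:
  cnj D g' is real. Hence (cnj D)^2 g' = |D|^2 cnj g'. It remains to identify D with the gradient
  from G, where a derivative within the closed domain must be shown unique.\<close>

lemma capillary_boundary_relation:
  fixes \<kappa> c :: real
  assumes s: "s\<^sub>1 < s\<^sub>2" "s = s\<^sub>1 \<or> s = s\<^sub>2" "Re z = s"
    and g: "g analytic_on closed_band s\<^sub>1 s\<^sub>2" "g ` closed_band s\<^sub>1 s\<^sub>2 = closure \<Omega>"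
    and G: "(u has_derivative (\<lambda>h. h \<bullet> G (g z))) (at (g z) within closure \<Omega>)"
    and eq: "\<And>w. Re w = s \<Longrightarrow> u (g w) = capillary_poly a d\<^sub>1 d\<^sub>2 c (g w)"
    and D: "((\<lambda>w. u w - capillary_poly a d\<^sub>1 d\<^sub>2 c w) has_derivative (\<lambda>h. h \<bullet> D)) (at (g z) within closure \<Omega>)"
      "norm D = \<kappa>"
  shows "(cnj (G (g z)) + cnj (g z) + (c - 1) * cnj (g z) - cnj (Complex d\<^sub>1 d\<^sub>2))\<^sup>2 * deriv g z =
    \<kappa>\<^sup>2 * cnj (deriv g z)"
proof (cases "deriv g z = 0")
  case False
  let ?C = "closed_band s\<^sub>1 s\<^sub>2" and ?f = "\<lambda>w. u w - capillary_poly a d\<^sub>1 d\<^sub>2 c w"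
  let ?E = "G (g z) - (Complex d\<^sub>1 d\<^sub>2 - c *\<^sub>R g z)"
  have zC: "z \<in> ?C" using s by (auto simp: closed_band_def)
  have "(g has_field_derivative deriv g z) (at z)"
    using analytic_on_subset[OF g(1), of "{z}"] zC by (intro analytic_derivI) auto
  then have dg: "(g has_derivative (\<lambda>h. deriv g z * h)) (at z within S)" for S
    by (simp add: has_field_derivative_def has_derivative_at_withinI)
  have E: "(?f has_derivative (\<lambda>h. h \<bullet> ?E)) (at (g z) within closure \<Omega>)"
    using has_derivative_diff[OF G has_derivative_capillary_poly[of a d\<^sub>1 d\<^sub>2 c]]
    by (simp add: inner_diff_right)
  have comp: "((\<lambda>w. ?f (g w)) has_derivative (\<lambda>h. (deriv g z * h) \<bullet> X)) (at z within ?C)"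
    if "(?f has_derivative (\<lambda>h. h \<bullet> X)) (at (g z) within closure \<Omega>)" for X
    using has_derivative_in_compose[OF dg, of ?f _ ?C] that unfolding g(2) by blast
  \<comment> \<open>Uniqueness is checked on the band, where every edge point has admissible
    directions, and transported back through the invertible factor g'.\<close>
  have "(\<lambda>h. (deriv g z * h) \<bullet> D) = (\<lambda>h. (deriv g z * h) \<bullet> ?E)"
  proof (rule frechet_derivative_unique_within[OF comp[OF D(1)] comp[OF E]])
    fix i :: complex and e :: real assume i: "i \<in> Basis" and "e > 0"
    \<comment> \<open>A step small enough to stay in the band when taken inward; vertical steps stay
      in it anyway.\<close>
    define h where "h = min (e / 2) (s\<^sub>2 - s\<^sub>1)"
    have h: "0 < h" "h < e" "h \<le> s\<^sub>2 - s\<^sub>1" using \<open>e > 0\<close> s by (auto simp: h_def)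
    show "\<exists>d. 0 < \<bar>d\<bar> \<and> \<bar>d\<bar> < e \<and> z + d *\<^sub>R i \<in> ?C"
      by (rule exI[of _ "if s = s\<^sub>1 then h else - h"])
        (use i h s in \<open>auto simp: closed_band_def Basis_complex_def\<close>)
  qed
  from fun_cong[OF this, of "(D - ?E) / deriv g z"] False
  have "(D - ?E) \<bullet> D = (D - ?E) \<bullet> ?E" by simp
  then have "(D - ?E) \<bullet> (D - ?E) = 0" by (simp add: inner_diff_right)
  then have DE: "D = ?E" by simp
  have "((\<lambda>y::real. ?f (g (z + of_real y * \<i>))) has_derivative (\<lambda>y. (deriv g z * (of_real y * \<i>)) \<bullet> D)) (at 0)"
  proof (rule has_derivative_in_compose[where s = UNIV and f = "\<lambda>y::real. z + of_real y * \<i>" and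
        f' = "\<lambda>y. of_real y * \<i>" and g = "\<lambda>w. ?f (g w)" and g' = "\<lambda>h. (deriv g z * h) \<bullet> D"])
    show "((\<lambda>y::real. z + of_real y * \<i>) has_derivative (\<lambda>y. of_real y * \<i>)) (at 0)"
      by (auto intro!: derivative_eq_intros)
    show "((\<lambda>w. ?f (g w)) has_derivative (\<lambda>h. (deriv g z * h) \<bullet> D))
        (at (z + of_real 0 * \<i>) within range (\<lambda>y::real. z + of_real y * \<i>))"
    proof -
      have "range (\<lambda>y::real. z + of_real y * \<i>) \<subseteq> ?C" using zC by (auto simp: closed_band_def)
      from has_derivative_subset[OF comp[OF D(1)] this] show ?thesis by simp
    qed
  qed
  moreover have "(\<lambda>y::real. ?f (g (z + of_real y * \<i>))) = (\<lambda>_. 0)"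
    using eq s(3) by (simp add: fun_eq_iff)
  ultimately have "((\<lambda>_. 0) has_derivative (\<lambda>y. (deriv g z * (of_real y * \<i>)) \<bullet> D)) (at 0)" by simp
  from fun_cong[OF has_derivative_unique[OF this has_derivative_const], of 1]
  have "Im (cnj D * deriv g z) = 0" by (simp add: inner_complex_def algebra_simps)
  then have "cnj D * deriv g z = cnj (cnj D * deriv g z)" by (simp add: complex_eq_iff)
  then have "(cnj D)\<^sup>2 * deriv g z = (D * cnj D) * cnj (deriv g z)"
    by (simp add: power2_eq_square algebra_simps)
  also have "D * cnj D = of_real (\<kappa>\<^sup>2)" unfolding D(2)[symmetric] by (rule complex_norm_square[symmetric])
  finally have "(cnj D)\<^sup>2 * deriv g z = \<kappa>\<^sup>2 * cnj (deriv g z)" .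
  moreover have "cnj D = cnj (G (g z)) + cnj (g z) + (c - 1) * cnj (g z) - cnj (Complex d\<^sub>1 d\<^sub>2)"
    by (simp add: DE algebra_simps scaleR_conv_of_real)
  ultimately show ?thesis by simp
qed simp

text \<open>Both boundary conditions are real-linear, so they pass from the Q_n to real
  combinations. Under the first, Schwarz reflection even gives the bound M; under the second,
  \<open>robin_estimate\<close> applies. \<open>\<delta>\<close> comes before c and N because the
  test points are fixed before the combination is chosen.\<close>

lemma mkdv_combination_estimate:
  assumes hyp: "\<eta> holomorphic_on ball p r" "Re p = s" "r > 0"
    and dich: "(\<forall>z\<in>ball p r. \<eta> z = reflect s \<eta> z) \<or>
      (\<exists>P. \<forall>z\<in>ball p r. (P has_field_derivative (\<eta> z)\<^sup>2 - (reflect s \<eta> z)\<^sup>2) (at z) \<and>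
         deriv \<eta> z - reflect s (deriv \<eta>) z = P z * (\<eta> z - reflect s \<eta> z))"
  obtains \<delta> where "0 < \<delta>" "\<delta> \<le> r"
    "\<And>c N M z. \<lbrakk>\<And>z. z \<in> ball p r \<Longrightarrow> 0 \<le> \<sigma> * (Re z - s) \<Longrightarrow>
        norm (\<Sum>j\<le>N. of_real (c j) * eval_diff_poly (mkdv_seq j) \<eta> z) \<le> M; z \<in> ball p \<delta>\<rbrakk>
      \<Longrightarrow> norm (\<Sum>j\<le>N. of_real (c j) * eval_diff_poly (mkdv_seq j) \<eta> z) \<le> 7 * M"
  using dich
proof
  interpret reflected_jet \<eta> p r s using hyp by unfold_locales
  assume d: "\<forall>z\<in>ball p r. \<eta> z = reflect s \<eta> z"
  show thesis
  proof (rule that[of r])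
    fix c N M z
    assume M: "\<And>z. z \<in> ball p r \<Longrightarrow> 0 \<le> \<sigma> * (Re z - s) \<Longrightarrow>
        norm (\<Sum>j\<le>N. of_real (c j) * E (mkdv_seq j) z) \<le> M" and z: "z \<in> ball p r"
    have "norm (\<Sum>j\<le>N. of_real (c j) * E (mkdv_seq j) p) \<le> M" by (rule M) (use hyp in auto)
    then have "M \<ge> 0" using norm_ge_zero order_trans by blast
    moreover have "norm (\<Sum>j\<le>N. of_real (c j) * E (mkdv_seq j) z) \<le> M"
    proof (cases "0 \<le> \<sigma> * (Re z - s)")
      case True
      then show ?thesis by (rule M[OF z])
    next
      case False
      let ?w = "2 * of_real s - cnj z"
      have E: "E (mkdv_seq j) z = cnj (E (mkdv_seq j) ?w)" for j
        using dirichlet_mkdv[OF _ z, of j] d unfolding reflect_def[of _ "E (mkdv_seq j)"] by blast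
      have "(\<Sum>j\<le>N. of_real (c j) * E (mkdv_seq j) z) = cnj (\<Sum>j\<le>N. of_real (c j) * E (mkdv_seq j) ?w)"
        unfolding E by simp
      moreover have "norm (\<Sum>j\<le>N. of_real (c j) * E (mkdv_seq j) ?w) \<le> M"
        by (rule M[OF mirror_mem_ball[OF hyp(2) z]]) (use False in \<open>simp add: algebra_simps\<close>)
      ultimately show ?thesis by (simp only: complex_mod_cnj)
    qed
    ultimately show "norm (\<Sum>j\<le>N. of_real (c j) * E (mkdv_seq j) z) \<le> 7 * M" by linarith
  qed (use hyp in auto)
next
  interpret reflected_jet \<eta> p r s using hyp by unfold_locales
  assume "\<exists>P. \<forall>z\<in>ball p r. (P has_field_derivative (\<eta> z)\<^sup>2 - (reflect s \<eta> z)\<^sup>2) (at z) \<and>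
         deriv \<eta> z - reflect s (deriv \<eta>) z = P z * (\<eta> z - reflect s \<eta> z)"
  then obtain P where P: "\<And>z. z \<in> ball p r \<Longrightarrow> (P has_field_derivative (\<eta> z)\<^sup>2 - (reflect s \<eta> z)\<^sup>2) (at z)"
    "\<And>z. z \<in> ball p r \<Longrightarrow> deriv \<eta> z - reflect s (deriv \<eta>) z = P z * (\<eta> z - reflect s \<eta> z)"
    by blast
  have contP: "continuous_on (ball p r) P"
    using P(1) by (meson DERIV_isCont continuous_at_imp_continuous_on)
  obtain \<delta> where \<delta>: "0 < \<delta>" "\<delta> \<le> r"
    and est: "\<And>F M z. \<lbrakk>F holomorphic_on ball p r;
       \<And>z. z \<in> ball p r \<Longrightarrow> deriv F z - reflect s (deriv F) z = P z * (F z - reflect s F z);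
       \<And>z. z \<in> ball p r \<Longrightarrow> 0 \<le> \<sigma> * (Re z - s) \<Longrightarrow> norm (F z) \<le> M; z \<in> ball p \<delta>\<rbrakk>
       \<Longrightarrow> norm (F z) \<le> 7 * M"
    using robin_estimate[OF hyp(2,3) contP, of \<sigma>] by blast
  show thesis
  proof (rule that[OF \<delta>])
    fix c N M z
    assume M: "\<And>z. z \<in> ball p r \<Longrightarrow> 0 \<le> \<sigma> * (Re z - s) \<Longrightarrow>
        norm (\<Sum>j\<le>N. of_real (c j) * E (mkdv_seq j) z) \<le> M" and z: "z \<in> ball p \<delta>"
    define F where "F z = (\<Sum>j\<le>N. of_real (c j) * E (mkdv_seq j) z)" for z
    have dF: "(F has_field_derivative (\<Sum>j\<le>N. of_real (c j) * E (total_deriv (mkdv_seq j)) z)) (at z)"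
      if "z \<in> ball p r" for z
      unfolding F_def[abs_def] by (intro DERIV_sum DERIV_cmult dE that)
    have "norm (F z) \<le> 7 * M"
    proof (rule est[OF _ _ _ z])
      show "F holomorphic_on ball p r"
        using dF by (meson field_differentiable_at_within field_differentiable_def holomorphic_on_def)
      show "norm (F z) \<le> M" if "z \<in> ball p r" "0 \<le> \<sigma> * (Re z - s)" for z
        unfolding F_def by (rule M[OF that])
      fix z assume z: "z \<in> ball p r"
      have r1: "reflect s F z = (\<Sum>j\<le>N. of_real (c j) * E' (mkdv_seq j) z)"
        by (simp add: F_def reflect_def)
      have r2: "reflect s (deriv F) z = (\<Sum>j\<le>N. of_real (c j) * E' (total_deriv (mkdv_seq j)) z)"
        using DERIV_imp_deriv[OF dF[OF mirror_mem_ball[OF hyp(2) z]]] by (simp add: reflect_def)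
      have "deriv F z - reflect s (deriv F) z =
          (\<Sum>j\<le>N. of_real (c j) * (E (total_deriv (mkdv_seq j)) z - E' (total_deriv (mkdv_seq j)) z))"
        unfolding DERIV_imp_deriv[OF dF[OF z]] r2 by (simp add: sum_subtractf right_diff_distrib)
      also have "\<dots> = (\<Sum>j\<le>N. of_real (c j) * (P z * (E (mkdv_seq j) z - E' (mkdv_seq j) z)))"
        using robin_mkdv[OF P z] by simp
      also have "\<dots> = P z * (F z - reflect s F z)"
        unfolding r1 unfolding F_def by (simp add: sum_distrib_left sum_subtractf right_diff_distrib mult.left_commute)
      finally show "deriv F z - reflect s (deriv F) z = P z * (F z - reflect s F z)" .
    qed
    then show "norm (\<Sum>j\<le>N. of_real (c j) * E (mkdv_seq j) z) \<le> 7 * M" unfolding F_def .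
  qed
qed

text \<open>Each connected piece lies inside a component that it meets. Two distinct components must
  therefore use up different pieces, and nothing is left over.\<close>

lemma union_of_components:
  assumes A: "A = X \<union> Y" "connected X" "connected Y"
    and C: "C \<in> components A" "D \<in> components A" "C \<noteq> D"
  shows "A = C \<union> D"
proof -
  have disj: "C \<inter> D = {}" using C components_nonoverlap by blast
  have sub: "C \<subseteq> A" "D \<subseteq> A" using C in_components_subset by auto
  have full: "X \<subseteq> Z" if "Z \<in> components A" "x \<in> Z" "x \<in> X" for Z x
    using components_maximal[OF that(1) A(2)] A(1) that by blast
  have full': "Y \<subseteq> Z" if "Z \<in> components A" "x \<in> Z" "x \<in> Y" for Z x
    using components_maximal[OF that(1) A(3)] A(1) that by blast
  obtain x y where x: "x \<in> C" and y: "y \<in> D"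
    using C in_components_nonempty by blast
  consider "x \<in> X" | "x \<in> Y" using x sub A(1) by blast
  then show ?thesis
  proof cases
    case 1
    then have "X \<subseteq> C" using full[OF C(1) x] by blast
    then have "y \<in> Y" using y disj sub A(1) by blast
    then have "Y \<subseteq> D" using full'[OF C(2) y] by blast
    then show ?thesis using \<open>X \<subseteq> C\<close> sub A(1) by blast
  next
    case 2
    then have "Y \<subseteq> C" using full'[OF C(1) x] by blast
    then have "y \<in> X" using y disj sub A(1) by blast
    then have "X \<subseteq> D" using full[OF C(2) y] by blast
    then show ?thesis using \<open>Y \<subseteq> C\<close> sub A(1) by blast
  qed
qed

lemma smooth_Jordan_connected: "smooth_Jordan_param \<gamma> \<Longrightarrow> connected (range \<gamma>)"
proof -
  assume "smooth_Jordan_param \<gamma>"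
  then obtain \<Gamma> where "\<Gamma> (0::nat) = \<gamma>" "\<And>n t. (\<Gamma> n has_vector_derivative \<Gamma> (Suc n) t) (at t)"
    unfolding smooth_Jordan_param_def by metis
  then have "\<And>t. (\<gamma> has_vector_derivative \<Gamma> 1 t) (at t)" by (metis One_nat_def)
  then have "continuous_on UNIV \<gamma>"
    by (meson continuous_at_imp_continuous_on has_vector_derivative_continuous)
  then show ?thesis by (intro connected_continuous_image) auto
qed

lemma higher_deriv_periodic:
  fixes f :: "complex \<Rightarrow> complex"
  assumes "f holomorphic_on S" "open S" "\<And>z. z \<in> S \<Longrightarrow> z + a \<in> S" "\<And>z. z \<in> S \<Longrightarrow> f (z + a) = f z"
    and "z \<in> S"
  shows "(deriv ^^ n) f (z + a) = (deriv ^^ n) f z"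
  using \<open>z \<in> S\<close>
proof (induction n arbitrary: z)
  case (Suc n)
  have "((deriv ^^ n) f has_field_derivative (deriv ^^ Suc n) f (z + a)) (at (z + a))"
    by (rule has_field_derivative_higher_deriv[OF assms(1,2) assms(3)[OF Suc.prems]])
  then have "((\<lambda>w. (deriv ^^ n) f (w + a)) has_field_derivative (deriv ^^ Suc n) f (z + a)) (at z)"
    by (simp add: DERIV_shift)
  then have "((deriv ^^ n) f has_field_derivative (deriv ^^ Suc n) f (z + a)) (at z)"
    by (rule has_field_derivative_transform_within_open[OF _ assms(2) Suc.prems]) (rule Suc.IH)
  from DERIV_imp_deriv[OF this] show ?case by simp
qed (use assms(4) in auto)

lemma eval_diff_poly_analytic: "f analytic_on S \<Longrightarrow> eval_diff_poly P f analytic_on S"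
proof -
  assume "f analytic_on S"
  then obtain U where U: "open U" "S \<subseteq> U" "f holomorphic_on U" using analytic_on_holomorphic by blast
  have "eval_diff_poly P f holomorphic_on U"
    using has_field_derivative_eval_diff_poly[OF U(3,1)]
    by (meson field_differentiable_at_within field_differentiable_def holomorphic_on_def)
  then show ?thesis using U analytic_on_holomorphic by blast
qed

section \<open>The band of a capillary ring domain\<close>

locale capillary_band =
  fixes \<Omega> :: "complex set" and u :: "complex \<Rightarrow> real" and g G :: "complex \<Rightarrow> complex"
    and s\<^sub>1 s\<^sub>2 T :: real
  assumes ring: "ring_domain \<Omega>"
    and capillary: "\<And>C. C \<in> components (frontier \<Omega>) \<Longrightarrow> capillary_curve \<Omega> u C"
    and gradient: "\<And>z. z \<in> closure \<Omega> \<Longrightarrow> (u has_derivative (\<lambda>h. h \<bullet> G z)) (at z within closure \<Omega>)"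
    and gradient_cont: "continuous_on (closure \<Omega>) G"
    and laplace: "\<And>z. z \<in> \<Omega> \<Longrightarrow> \<exists>G'. (G has_derivative G') (at z) \<and> (\<Sum>b\<in>Basis. G' b \<bullet> b) + 2 = 0"
    and not_paraboloid: "\<not> paraboloid_on \<Omega> u"
    and developing: "developing_map \<Omega> s\<^sub>1 s\<^sub>2 T g"
begin

abbreviation "C \<equiv> closed_band s\<^sub>1 s\<^sub>2"

definition "O' = {z. s\<^sub>1 < Re z \<and> Re z < s\<^sub>2}"

definition "H z = cnj (G (g z)) + cnj (g z)"

lemma band: "s\<^sub>1 < s\<^sub>2" "0 < T"
  using developing by (simp_all add: developing_map_def)

lemma g_analytic: "g analytic_on C"
  using developing by (simp add: developing_map_def)

lemma g_image: "g ` C = closure \<Omega>"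
  using developing by (simp add: developing_map_def)

lemma g_eq_iff: "z \<in> C \<Longrightarrow> w \<in> C \<Longrightarrow> g z = g w \<longleftrightarrow> (\<exists>n::int. w = z + of_int n * of_real T * \<i>)"
  using developing unfolding developing_map_def by (elim conjE) (drule (1) bspec, drule (1) bspec)

lemma line_components: "s = s\<^sub>1 \<or> s = s\<^sub>2 \<Longrightarrow> g ` {z. Re z = s} \<in> components (frontier \<Omega>)"
  using developing by (auto simp: developing_map_def)

lemma O_subset: "O' \<subseteq> C"
  by (auto simp: O'_def closed_band_def)

lemma open_O: "open O'"
proof -
  have "O' = {z. s\<^sub>1 < Re z} \<inter> {z. Re z < s\<^sub>2}" by (auto simp: O'_def)
  then show ?thesis by (simp add: open_Int open_halfspace_Re_gt open_halfspace_Re_lt)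
qed

lemma convex_O: "convex O'"
proof -
  have "O' = {z. s\<^sub>1 < Re z} \<inter> {z. Re z < s\<^sub>2}" by (auto simp: O'_def)
  then show ?thesis by (simp add: convex_Int convex_halfspace_Re_gt convex_halfspace_Re_lt)
qed

lemma O_nonempty: "O' \<noteq> {}"
proof -
  have "of_real ((s\<^sub>1 + s\<^sub>2) / 2) \<in> O'" using band(1) by (simp add: O'_def)
  then show ?thesis by blast
qed

lemma closure_O: "C \<subseteq> closure O'"
proof
  fix z assume "z \<in> C"
  \<comment> \<open>The point of the midline at the same height; moving z towards it enters the open
    band.\<close>
  define m where "m = Complex ((s\<^sub>1 + s\<^sub>2) / 2) (Im z)"
  have "(\<lambda>n. z + of_real (1 / real (Suc n)) * (m - z)) \<longlonglongrightarrow> z + of_real 0 * (m - z)"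
    by (intro tendsto_intros LIMSEQ_inverse_real_of_nat[unfolded inverse_eq_divide])
  moreover have "z + of_real (1 / real (Suc n)) * (m - z) \<in> O'" for n
  proof -
    define t where "t = 1 / real (Suc n)"
    have t: "0 < t" "t \<le> 1" by (auto simp: t_def)
    have z: "s\<^sub>1 \<le> Re z" "Re z \<le> s\<^sub>2" using \<open>z \<in> C\<close> by (auto simp: closed_band_def)
    have re: "Re (z + of_real t * (m - z)) = (1 - t) * Re z + t * Re m"
      by (simp add: algebra_simps)
    have m: "s\<^sub>1 < Re m" "Re m < s\<^sub>2" using band(1) by (simp_all add: m_def)
    have "(1 - t) * s\<^sub>1 \<le> (1 - t) * Re z" "(1 - t) * Re z \<le> (1 - t) * s\<^sub>2"
      using z t by (auto intro!: mult_left_mono)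
    moreover have "t * s\<^sub>1 < t * Re m" "t * Re m < t * s\<^sub>2" using m t by auto
    moreover have "(1 - t) * s\<^sub>1 + t * s\<^sub>1 = s\<^sub>1" "(1 - t) * s\<^sub>2 + t * s\<^sub>2 = s\<^sub>2"
      by (simp_all add: algebra_simps)
    ultimately have "s\<^sub>1 < (1 - t) * Re z + t * Re m" "(1 - t) * Re z + t * Re m < s\<^sub>2" by linarith+
    then show ?thesis unfolding O'_def mem_Collect_eq t_def[symmetric] re by blast
  qed
  ultimately show "z \<in> closure O'"
    unfolding closure_sequential by (intro exI[of _ "\<lambda>n. z + of_real (1 / real (Suc n)) * (m - z)"]) simp
qed

lemma shift_C: "z \<in> C \<Longrightarrow> z + of_real T * \<i> \<in> C" and shift_O: "z \<in> O' \<Longrightarrow> z + of_real T * \<i> \<in> O'"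
  by (auto simp: closed_band_def O'_def)

lemma g_periodic: "z \<in> C \<Longrightarrow> g (z + of_real T * \<i>) = g z"
  using g_eq_iff[of z "z + of_real T * \<i>"] shift_C by (metis mult_1 of_int_1)

lemma g_holomorphic_O: "g holomorphic_on O'"
  using analytic_imp_holomorphic[OF analytic_on_subset[OF g_analytic O_subset]] .

text \<open>Points with the same image under g have the same real part, so the two edges give
  different components, and a union of two connected curves has no third one.\<close>

lemma frontier_eq: "frontier \<Omega> = g ` {z. Re z = s\<^sub>1} \<union> g ` {z. Re z = s\<^sub>2}"
proof -
  obtain \<gamma>\<^sub>1 \<gamma>\<^sub>2 where \<gamma>: "smooth_Jordan_param \<gamma>\<^sub>1" "smooth_Jordan_param \<gamma>\<^sub>2"
    "frontier \<Omega> = range \<gamma>\<^sub>1 \<union> range \<gamma>\<^sub>2"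
    using ring unfolding ring_domain_def by blast
  have "g (of_real s\<^sub>1) \<notin> g ` {z. Re z = s\<^sub>2}"
  proof
    assume "g (of_real s\<^sub>1) \<in> g ` {z. Re z = s\<^sub>2}"
    then obtain w where w: "g (of_real s\<^sub>1) = g w" "Re w = s\<^sub>2" by auto
    have "of_real s\<^sub>1 \<in> C" "w \<in> C" using w band by (auto simp: closed_band_def)
    then obtain n :: int where "w = of_real s\<^sub>1 + of_int n * of_real T * \<i>" using g_eq_iff w(1) by blast
    then show False using w(2) band by simp
  qed
  moreover have "g (of_real s\<^sub>1) \<in> g ` {z. Re z = s\<^sub>1}" by simp
  ultimately have ne: "g ` {z. Re z = s\<^sub>1} \<noteq> g ` {z. Re z = s\<^sub>2}" by metis
  show ?thesis
    by (rule union_of_components[OF \<gamma>(3) smooth_Jordan_connected[OF \<gamma>(1)]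
        smooth_Jordan_connected[OF \<gamma>(2)] line_components line_components ne]) auto
qed

lemma open_Omega: "open \<Omega>" and connected_Omega: "connected \<Omega>"
  using ring by (auto simp: ring_domain_def)

text \<open>Real parts are constant on fibres of g, so no interior point shares its image with an
  edge point, and the frontier consists of images of edge points.\<close>

lemma g_image_O: "g ` O' = \<Omega>"
proof
  have fr: "frontier \<Omega> = closure \<Omega> - \<Omega>"
    using open_Omega by (simp add: frontier_def interior_open)
  show "g ` O' \<subseteq> \<Omega>"
  proof
    fix y assume "y \<in> g ` O'"
    then obtain z where z: "z \<in> O'" "y = g z" by blast
    then have zC: "z \<in> C" using O_subset by blast
    have "y \<in> closure \<Omega>" using z zC g_image by blast
    moreover have "y \<notin> frontier \<Omega>"
    proof
      assume "y \<in> frontier \<Omega>"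
      then obtain w where w: "y = g w" "Re w = s\<^sub>1 \<or> Re w = s\<^sub>2" unfolding frontier_eq by auto
      then have "w \<in> C" using band by (auto simp: closed_band_def)
      then obtain n :: int where "w = z + of_int n * of_real T * \<i>" using g_eq_iff[OF zC] w z by metis
      then have "Re w = Re z" by simp
      then show False using w(2) z(1) by (auto simp: O'_def)
    qed
    ultimately show "y \<in> \<Omega>" using fr by blast
  qed
  show "\<Omega> \<subseteq> g ` O'"
  proof
    fix y assume y: "y \<in> \<Omega>"
    then have "y \<in> g ` C" using g_image closure_subset by blast
    then obtain z where z: "z \<in> C" "y = g z" by blast
    have "y \<notin> frontier \<Omega>" using y fr by blast
    then have "Re z \<noteq> s\<^sub>1" "Re z \<noteq> s\<^sub>2" using z(2) unfolding frontier_eq by auto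
    then have "z \<in> O'" using z(1) by (auto simp: closed_band_def O'_def)
    then show "y \<in> g ` O'" using z(2) by blast
  qed
qed

lemma gradient_Omega: "w \<in> \<Omega> \<Longrightarrow> (u has_derivative (\<lambda>h. h \<bullet> G w)) (at w)"
proof -
  assume w: "w \<in> \<Omega>"
  have "(u has_derivative (\<lambda>h. h \<bullet> G w)) (at w within \<Omega>)"
    by (rule has_derivative_subset[OF gradient closure_subset]) (use w closure_subset in blast)
  then show ?thesis unfolding at_within_open[OF w open_Omega] .
qed

lemma H_holomorphic: "H holomorphic_on O'"
proof -
  have "(\<lambda>w. cnj (G w) + cnj w) holomorphic_on g ` O'"
    unfolding g_image_O by (rule torsion_holomorphic[OF open_Omega gradient_Omega laplace])
  from holomorphic_on_compose[OF g_holomorphic_O this] show ?thesis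
    by (simp add: H_def[abs_def] o_def)
qed

lemma H_continuous: "continuous_on C H"
proof -
  have g: "continuous_on C g"
    by (intro holomorphic_on_imp_continuous_on analytic_imp_holomorphic g_analytic)
  moreover have "continuous_on C (\<lambda>z. G (g z))"
    by (rule continuous_on_compose2[OF gradient_cont g]) (use g_image in auto)
  ultimately show ?thesis unfolding H_def[abs_def] by (intro continuous_intros)
qed

lemma H_periodic: "z \<in> C \<Longrightarrow> H (z + of_real T * \<i>) = H z"
  by (simp add: H_def g_periodic)

lemma deriv_g_nonzero: "z \<in> O' \<Longrightarrow> deriv g z \<noteq> 0"
proof -
  assume z: "z \<in> O'"
  \<comment> \<open>Two points of a disc of radius T/2 cannot differ by a nonzero multiple of the
    period, so g is injective here.\<close>
  let ?S = "O' \<inter> ball z (T / 2)"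
  have "inj_on g ?S"
  proof (rule inj_onI)
    fix x y assume xy: "x \<in> ?S" "y \<in> ?S" "g x = g y"
    then obtain n :: int where n: "y = x + of_int n * of_real T * \<i>" using g_eq_iff O_subset by blast
    have "dist x y < T / 2 + T / 2"
      using xy by (intro dist_triangle_less_add[of x z _ y]) (auto simp: dist_commute)
    moreover have "dist x y = \<bar>of_int n\<bar> * T" using n band by (simp add: dist_norm norm_mult)
    ultimately have "\<bar>of_int n :: real\<bar> * T < 1 * T" by simp
    then have "\<bar>of_int n :: real\<bar> < 1" using band mult_less_cancel_right_pos by blast
    then have "n = 0" by linarith
    then show "x = y" using n by simp
  qed
  then show ?thesis
    using z band open_O holomorphic_on_subset[OF g_holomorphic_O, of ?S]
    by (intro holomorphic_injective_imp_regular[of g ?S]) auto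
qed

lemma boundary_relation:
  assumes s: "s = s\<^sub>1 \<or> s = s\<^sub>2"
  obtains c \<kappa> :: real and d :: complex where
    "\<And>z. Re z = s \<Longrightarrow> (H z + (c - 1) * cnj (g z) - d)\<^sup>2 * deriv g z = \<kappa>\<^sup>2 * cnj (deriv g z)"
proof -
  have "capillary_curve \<Omega> u (g ` {z. Re z = s})" by (rule capillary[OF line_components[OF s]])
  then obtain a d\<^sub>1 d\<^sub>2 c \<kappa> where cc: "\<forall>z\<in>g ` {z. Re z = s}. u z = capillary_poly a d\<^sub>1 d\<^sub>2 c z \<and>
       (\<exists>D. ((\<lambda>w. u w - capillary_poly a d\<^sub>1 d\<^sub>2 c w) has_derivative (\<lambda>h. h \<bullet> D))
              (at z within closure \<Omega>) \<and> norm D = \<kappa>)"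
    unfolding capillary_curve_def by (elim exE) (rule that)
  have eq: "u (g w) = capillary_poly a d\<^sub>1 d\<^sub>2 c (g w)" if "Re w = s" for w
    using cc that by auto
  show ?thesis
  proof (rule that[of c "cnj (Complex d\<^sub>1 d\<^sub>2)" \<kappa>])
    fix z assume z: "Re z = s"
    then have "g z \<in> g ` {z. Re z = s}" by simp
    from conjunct2[OF bspec[OF cc this]] obtain D where
      D: "((\<lambda>w. u w - capillary_poly a d\<^sub>1 d\<^sub>2 c w) has_derivative (\<lambda>h. h \<bullet> D)) (at (g z) within closure \<Omega>)"
        "norm D = \<kappa>"
      by (elim exE conjE) (rule that)
    have "z \<in> C" using z s band by (auto simp: closed_band_def)
    then have "g z \<in> closure \<Omega>" using g_image by blast
    note gr = gradient[OF this]
    show "(H z + (c - 1) * cnj (g z) - cnj (Complex d\<^sub>1 d\<^sub>2))\<^sup>2 * deriv g z = \<kappa>\<^sup>2 * cnj (deriv g z)"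
      unfolding H_def
      by (rule capillary_boundary_relation[where u = u and G = G and a = a and D = D,
            OF band(1) s z g_analytic g_image gr _ D]) (rule eq)
  qed
qed

text \<open>\<open>\<sigma>\<close> is the sign of the inward direction at the edge Re z =
  s.\<close>

definition "side s \<sigma> \<longleftrightarrow> s = s\<^sub>1 \<and> \<sigma> = 1 \<or> s = s\<^sub>2 \<and> \<sigma> = (-1::real)"

text \<open>A disc of radius equal to the width of the band does not reach the opposite edge, so one
  half-plane condition decides membership.\<close>

lemma side_O:
  assumes "side s \<sigma>" "Re p = s" "z \<in> ball p (s\<^sub>2 - s\<^sub>1)"
  shows "0 < \<sigma> * (Re z - s) \<longleftrightarrow> z \<in> O'" "0 \<le> \<sigma> * (Re z - s) \<longleftrightarrow> z \<in> C"
proof -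
  have "\<bar>Re z - Re p\<bar> < s\<^sub>2 - s\<^sub>1"
    using assms(3) abs_Re_le_cmod[of "z - p"] by (auto simp: dist_norm norm_minus_commute)
  then show "0 < \<sigma> * (Re z - s) \<longleftrightarrow> z \<in> O'" "0 \<le> \<sigma> * (Re z - s) \<longleftrightarrow> z \<in> C"
    using assms(1,2) by (auto simp: side_def O'_def closed_band_def)
qed

text \<open>Inside the band H = B - (c - 1) g# + d, whose right-hand side is holomorphic across the
  edge. Its derivative loses d, and reflection flips the sign of the middle term. This formula
  continues the Hopf differential past the edge.\<close>

lemma boundary_local:
  assumes side: "side s \<sigma>" and p: "Re p = s"
  obtains \<rho> B and c \<kappa> :: real where "0 < \<rho>" "\<rho> \<le> s\<^sub>2 - s\<^sub>1" "g holomorphic_on ball p \<rho>" "B holomorphic_on ball p \<rho>"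
    "\<And>z. z \<in> ball p \<rho> \<Longrightarrow> (B z)\<^sup>2 * deriv g z = \<kappa>\<^sup>2 * reflect s (deriv g) z"
    "\<And>z. z \<in> ball p \<rho> \<inter> O' \<Longrightarrow> deriv H z = deriv B z + (c - 1) * reflect s (deriv g) z"
    "\<kappa> = 0 \<Longrightarrow> (\<And>z. z \<in> ball p \<rho> \<Longrightarrow> B z = 0)"
proof -
  have s: "s = s\<^sub>1 \<or> s = s\<^sub>2" and \<sigma>: "\<sigma> \<noteq> 0" using side by (auto simp: side_def)
  have "p \<in> C" using p s band by (auto simp: closed_band_def)
  then obtain e where e: "e > 0" "g holomorphic_on ball p e"
    using g_analytic unfolding analytic_on_def by blast
  define r where "r = min e (s\<^sub>2 - s\<^sub>1)"
  have r: "r > 0" "r \<le> s\<^sub>2 - s\<^sub>1" "ball p r \<subseteq> ball p (s\<^sub>2 - s\<^sub>1)" using e band by (auto simp: r_def)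
  have g: "g holomorphic_on ball p r" by (rule holomorphic_on_subset[OF e(2)]) (auto simp: r_def)
  have U: "ball p r \<inter> {z. 0 < \<sigma> * (Re z - s)} \<subseteq> O'" "ball p r \<inter> {z. 0 \<le> \<sigma> * (Re z - s)} \<subseteq> C"
    using side_O[OF side p] r(3) by blast+
  obtain w where w: "w \<in> ball p r \<inter> {z. 0 < \<sigma> * (Re z - s)}" using half_ball_nonempty[OF p r(1) \<sigma>] by blast
  then have "w \<in> O'" using U(1) by (rule rev_subsetD)
  then have w': "\<exists>w\<in>ball p r. deriv g w \<noteq> 0" using deriv_g_nonzero w by blast
  show ?thesis
  proof (rule boundary_relation[OF s])
    fix c \<kappa> :: real and d
    assume bd: "\<And>z. Re z = s \<Longrightarrow> (H z + (c - 1) * cnj (g z) - d)\<^sup>2 * deriv g z = \<kappa>\<^sup>2 * cnj (deriv g z)"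
    show thesis
    proof (rule boundary_extension[OF p r(1) \<sigma> g w' holomorphic_on_subset[OF H_holomorphic U(1)]
          continuous_on_subset[OF H_continuous U(2)] bd])
      fix \<rho> B
      assume \<rho>: "0 < \<rho>" "\<rho> \<le> r" and B: "B holomorphic_on ball p \<rho>"
        and rel: "\<And>z. z \<in> ball p \<rho> \<Longrightarrow> (B z)\<^sup>2 * deriv g z = \<kappa>\<^sup>2 * reflect s (deriv g) z"
        and HB: "\<And>z. z \<in> ball p \<rho> \<Longrightarrow> 0 < \<sigma> * (Re z - s) \<Longrightarrow> H z = B z - (c - 1) * reflect s g z + d"
        and zero: "\<kappa> = 0 \<Longrightarrow> (\<And>z. z \<in> ball p \<rho> \<Longrightarrow> B z = 0)"
      have g\<rho>: "g holomorphic_on ball p \<rho>" by (rule holomorphic_on_subset[OF g]) (use \<rho> in auto)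
      have dH: "deriv H z = deriv B z + (c - 1) * reflect s (deriv g) z" if z: "z \<in> ball p \<rho> \<inter> O'" for z
      proof -
        have zb: "z \<in> ball p \<rho>" using z by simp
        have dst: "(reflect s g has_field_derivative - reflect s (deriv g) z) (at z)"
          using has_field_derivative_reflect[OF holomorphic_derivI[OF g\<rho> open_ball mirror_mem_ball[OF p zb]]]
          by (simp add: reflect_def)
        have "((\<lambda>z. B z - (c - 1) * reflect s g z + d) has_field_derivative
            (deriv B z + (c - 1) * reflect s (deriv g) z)) (at z)"
          using holomorphic_derivI[OF B open_ball zb] dst by (auto intro!: derivative_eq_intros)
        then have "(H has_field_derivative (deriv B z + (c - 1) * reflect s (deriv g) z)) (at z)"
        proof (rule has_field_derivative_transform_within_open[OF _ open_Int[OF open_ball open_O] z])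
          fix w assume w: "w \<in> ball p \<rho> \<inter> O'"
          then have "w \<in> ball p (s\<^sub>2 - s\<^sub>1)" using \<rho> r by auto
          then have "0 < \<sigma> * (Re w - s)" using side_O(1)[OF side p] w by blast
          then show "B w - (c - 1) * reflect s g w + d = H w" using HB w by simp
        qed
        then show ?thesis by (rule DERIV_imp_deriv)
      qed
      show thesis
        by (rule that[OF \<rho>(1) _ g\<rho> B rel dH zero]) (use \<rho> r in auto)
    qed
  qed
qed

section \<open>The Hopf differential\<close>

lemma line_side:
  assumes "Re p = s\<^sub>1 \<or> Re p = s\<^sub>2"
  obtains \<sigma> where "side (Re p) \<sigma>"
  using assms that[of 1] that[of "-1"] by (auto simp: side_def)

lemma Hopf_constant: "\<exists>\<tau>. \<forall>z\<in>O'. deriv H z * deriv g z = \<tau>"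
proof -
  have hol: "(\<lambda>z. deriv H z * deriv g z) holomorphic_on O'"
    by (intro holomorphic_on_mult holomorphic_deriv H_holomorphic g_holomorphic_O open_O)
  have per: "deriv H (z + of_real T * \<i>) * deriv g (z + of_real T * \<i>) = deriv H z * deriv g z"
    if "z \<in> O'" for z
    using higher_deriv_periodic[OF H_holomorphic open_O shift_O H_periodic[OF subsetD[OF O_subset]] that, of 1]
      higher_deriv_periodic[OF g_holomorphic_O open_O shift_O g_periodic[OF subsetD[OF O_subset]] that, of 1]
    by simp
  have lim: "((\<lambda>z. Im (deriv H z * deriv g z)) \<longlongrightarrow> 0) (at p within O')"
    if line: "Re p = s\<^sub>1 \<or> Re p = s\<^sub>2" for p
  proof -
    obtain \<sigma> where side: "side (Re p) \<sigma>" using line_side[OF line] .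
    show ?thesis
    proof (rule boundary_local[OF side refl])
      fix \<rho> B and c \<kappa> :: real
      assume \<rho>: "0 < \<rho>" and g: "g holomorphic_on ball p \<rho>" and B: "B holomorphic_on ball p \<rho>"
        and rel: "\<And>z. z \<in> ball p \<rho> \<Longrightarrow> (B z)\<^sup>2 * deriv g z = \<kappa>\<^sup>2 * reflect (Re p) (deriv g) z"
        and dH: "\<And>z. z \<in> ball p \<rho> \<inter> O' \<Longrightarrow> deriv H z = deriv B z + (c - 1) * reflect (Re p) (deriv g) z"
        and zero: "\<kappa> = 0 \<Longrightarrow> (\<And>z. z \<in> ball p \<rho> \<Longrightarrow> B z = 0)"
      \<comment> \<open>The continuation of H' g' across the edge: continuous at p with real value,
        which supplies the limit of the imaginary part from inside.\<close>
      define K where "K z = (deriv B z + (c - 1) * reflect (Re p) (deriv g) z) * deriv g z" for z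
      have pb: "p \<in> ball p \<rho>" using \<rho> by simp
      have "Im (K p) = 0"
        unfolding K_def by (rule boundary_quadratic_differential_real[OF refl pb refl g B rel zero])
      moreover have "K holomorphic_on ball p \<rho>"
        unfolding K_def using g B
        by (intro holomorphic_on_mult holomorphic_on_add holomorphic_on_const holomorphic_deriv
            holomorphic_on_reflect open_ball refl)
      then have "continuous_on (ball p \<rho>) K" by (rule holomorphic_on_imp_continuous_on)
      then have "isCont K p" using pb by (simp add: continuous_on_eq_continuous_at)
      ultimately have "((\<lambda>z. Im (K z)) \<longlongrightarrow> 0) (at p)"
        using tendsto_Im[of K "K p" "at p"] by (simp add: isCont_def)
      then have "((\<lambda>z. Im (K z)) \<longlongrightarrow> 0) (at p within O')"
        by (rule tendsto_within_subset) simp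
      moreover have "\<forall>\<^sub>F z in at p within O'. Im (K z) = Im (deriv H z * deriv g z)"
        unfolding eventually_at_filter
        using eventually_nhds_in_open[OF open_ball pb]
      proof eventually_elim
        case (elim z)
        then show ?case using dH[of z] by (auto simp: K_def)
      qed
      ultimately show ?thesis by (rule Lim_transform_eventually)
    qed
  qed
  show ?thesis
  proof (rule band_constant[OF band hol[unfolded O'_def] _ lim[unfolded O'_def]])
    fix \<tau>
    assume "\<And>z. s\<^sub>1 < Re z \<Longrightarrow> Re z < s\<^sub>2 \<Longrightarrow> deriv H z * deriv g z = \<tau>"
    then show ?thesis unfolding O'_def by blast
  qed (use per in \<open>auto simp: O'_def\<close>)
qed

text \<open>If \<tau> were 0, then H' = 0 since g' has no interior zeros, so H is a constant k and
  the gradient of u is cnj k - w. Integration gives a paraboloid centred at cnj k.\<close>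

lemma Hopf_nonzero:
  assumes "\<And>z. z \<in> O' \<Longrightarrow> deriv H z * deriv g z = \<tau>"
  shows "\<tau> \<noteq> 0"
proof
  assume "\<tau> = 0"
  then have "deriv H z = 0" if "z \<in> O'" for z using assms[OF that] deriv_g_nonzero[OF that] by simp
  then have "(H has_field_derivative 0) (at z within O')" if "z \<in> O'" for z
    using holomorphic_derivI[OF H_holomorphic open_O that, of O'] that by simp
  then obtain k where k: "\<And>z. z \<in> O' \<Longrightarrow> H z = k"
    using has_field_derivative_zero_constant[OF convex_O, of H] by blast
  have Gw: "G w = cnj k - w" if w: "w \<in> \<Omega>" for w
  proof -
    obtain z where "z \<in> O'" "w = g z" using g_image_O w by blast
    then have "cnj (G w) + cnj w = k" using k by (simp add: H_def)
    then have "cnj (cnj (G w) + cnj w) = cnj k" by simp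
    then show ?thesis by (simp add: algebra_simps)
  qed
  define v where "v = cnj k"
  define f where "f w = u w + 1 / 2 * ((w - v) \<bullet> (w - v))" for w
  have df: "(f has_derivative (\<lambda>h. 0)) (at w)" if "w \<in> \<Omega>" for w
    using gradient_Omega[OF that] unfolding Gw[OF that] v_def f_def[abs_def]
    by (auto intro!: derivative_eq_intros simp: inner_commute algebra_simps inner_diff_right inner_diff_left)
  obtain w\<^sub>0 where w0: "w\<^sub>0 \<in> \<Omega>" using O_nonempty g_image_O by blast
  define k' where "k' = f w\<^sub>0"
  have fk: "f w = k'" if "w \<in> \<Omega>" for w
    unfolding k'_def by (rule has_derivative_zero_unique_connected[OF open_Omega connected_Omega df that w0])
  have "u w = k' - 1 / 2 * (norm (w - v))\<^sup>2" if "w \<in> \<Omega>" for w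
    unfolding fk[OF that, symmetric] by (simp add: f_def power2_norm_eq_inner)
  then show False using not_paraboloid unfolding paraboloid_on_def by blast
qed

section \<open>The potential and its boundary conditions\<close>

definition "\<eta> z = deriv (deriv g) z / (2 * deriv g z)"

text \<open>The continued Hopf differential equals \<tau> on the part of the disc inside the band,
  hence on the whole disc. As \<tau> is nonzero, its factor g' has no zero there, even on the
  edge.\<close>

lemma boundary_dichotomy:
  assumes side: "side s \<sigma>" and p: "Re p = s"
  obtains \<rho> where "0 < \<rho>" "\<rho> \<le> s\<^sub>2 - s\<^sub>1" "g holomorphic_on ball p \<rho>"
    "\<And>z. z \<in> ball p \<rho> \<Longrightarrow> deriv g z \<noteq> 0"
    "(\<forall>z\<in>ball p \<rho>. \<eta> z = reflect s \<eta> z) \<or>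
      (\<exists>P. \<forall>z\<in>ball p \<rho>. (P has_field_derivative (\<eta> z)\<^sup>2 - (reflect s \<eta> z)\<^sup>2) (at z) \<and>
         deriv \<eta> z - reflect s (deriv \<eta>) z = P z * (\<eta> z - reflect s \<eta> z))"
proof -
  obtain \<tau> where "\<forall>z\<in>O'. deriv H z * deriv g z = \<tau>" using Hopf_constant by blast
  then have \<tau>: "\<And>z. z \<in> O' \<Longrightarrow> deriv H z * deriv g z = \<tau>" by blast
  have "\<tau> \<noteq> 0" by (rule Hopf_nonzero[OF \<tau>])
  show thesis
  proof (rule boundary_local[OF side p])
    fix \<rho> B and c \<kappa> :: real
    assume \<rho>: "0 < \<rho>" "\<rho> \<le> s\<^sub>2 - s\<^sub>1" and g: "g holomorphic_on ball p \<rho>" and B: "B holomorphic_on ball p \<rho>"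
      and rel: "\<And>z. z \<in> ball p \<rho> \<Longrightarrow> (B z)\<^sup>2 * deriv g z = \<kappa>\<^sup>2 * reflect s (deriv g) z"
      and dH: "\<And>z. z \<in> ball p \<rho> \<inter> O' \<Longrightarrow> deriv H z = deriv B z + (c - 1) * reflect s (deriv g) z"
      and zero: "\<kappa> = 0 \<Longrightarrow> (\<And>z. z \<in> ball p \<rho> \<Longrightarrow> B z = 0)"
    let ?K = "\<lambda>z. (deriv B z + (c - 1) * reflect s (deriv g) z) * deriv g z"
    have holK: "?K holomorphic_on ball p \<rho>"
      using g B p
      by (intro holomorphic_on_mult holomorphic_on_add holomorphic_on_const holomorphic_deriv
          holomorphic_on_reflect open_ball)
    have ne: "ball p \<rho> \<inter> O' \<noteq> {}"
    proof -
      have "\<sigma> \<noteq> 0" using side by (auto simp: side_def)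
      from half_ball_nonempty[OF p \<rho>(1) this] obtain w where
        w: "w \<in> ball p \<rho>" "0 < \<sigma> * (Re w - s)" by blast
      then have "w \<in> ball p (s\<^sub>2 - s\<^sub>1)" using \<rho> by auto
      then show ?thesis using side_O(1)[OF side p] w by blast
    qed
    have lam: "?K z = \<tau>" if z: "z \<in> ball p \<rho>" for z
    proof (rule analytic_continuation_open[where f = ?K and g = "\<lambda>_. \<tau>" and s = "ball p \<rho> \<inter> O'" and s' = "ball p \<rho>"])
      show "?K w = \<tau>" if "w \<in> ball p \<rho> \<inter> O'" for w
        using dH[OF that] \<tau>[of w] that by simp
    qed (use ne holK z open_O in auto)
    have g0: "deriv g z \<noteq> 0" if "z \<in> ball p \<rho>" for z using lam[OF that] \<open>\<tau> \<noteq> 0\<close> by auto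
    show thesis
      by (rule that[OF \<rho> g g0 local_reflection_dichotomy[OF p \<open>\<tau> \<noteq> 0\<close> g g0 B rel zero lam \<eta>_def]])
  qed
qed

lemma deriv_g_nonzero_C: "z \<in> C \<Longrightarrow> deriv g z \<noteq> 0"
proof -
  assume z: "z \<in> C"
  show ?thesis
  proof (cases "z \<in> O'")
    case True
    then show ?thesis by (rule deriv_g_nonzero)
  next
    case False
    then have "Re z = s\<^sub>1 \<or> Re z = s\<^sub>2" using z by (auto simp: O'_def closed_band_def)
    then obtain \<sigma> where side: "side (Re z) \<sigma>" by (rule line_side)
    show ?thesis by (rule boundary_dichotomy[OF side refl]) simp
  qed
qed

lemma \<eta>_holomorphic:
  assumes "g holomorphic_on S" "open S" "\<And>z. z \<in> S \<Longrightarrow> deriv g z \<noteq> 0"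
  shows "\<eta> holomorphic_on S"
  unfolding \<eta>_def[abs_def] using assms by (auto intro!: holomorphic_intros)

lemma \<eta>_analytic: "\<eta> analytic_on C"
  unfolding \<eta>_def[abs_def] using deriv_g_nonzero_C g_analytic by (auto intro!: analytic_intros)

section \<open>Real combinations of the mKdV polynomials on the band\<close>

definition "F c N z = (\<Sum>j\<le>N. of_real (c j) * eval_diff_poly (mkdv_seq j) \<eta> z)"

lemma F_analytic: "F c N analytic_on C"
  unfolding F_def[abs_def] by (intro analytic_intros eval_diff_poly_analytic \<eta>_analytic)

lemma F_continuous: "continuous_on C (F c N)"
  by (intro holomorphic_on_imp_continuous_on analytic_imp_holomorphic F_analytic)

lemma F_periodic_O: "z \<in> O' \<Longrightarrow> F c N (z + of_real T * \<i>) = F c N z"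
proof -
  assume z: "z \<in> O'"
  have per: "g (z + of_real T * \<i>) = g z" if "z \<in> O'" for z using g_periodic O_subset that by blast
  have \<eta>: "\<eta> (z + of_real T * \<i>) = \<eta> z" if "z \<in> O'" for z
    using higher_deriv_periodic[OF g_holomorphic_O open_O shift_O per that, of 1]
      higher_deriv_periodic[OF g_holomorphic_O open_O shift_O per that, of 2]
    by (simp add: \<eta>_def numeral_2_eq_2)
  have "\<eta> holomorphic_on O'" by (rule \<eta>_holomorphic[OF g_holomorphic_O open_O deriv_g_nonzero])
  from higher_deriv_periodic[OF this open_O shift_O \<eta> z] show ?thesis
    unfolding F_def eval_diff_poly_def by simp
qed

text \<open>Periodicity of g is given on the closed band, not on a neighbourhood of it, so at edge
  points its derivatives cannot be shifted directly. The identity is passed from the interior to the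
  edges by continuity.\<close>

lemma F_periodic: "z \<in> C \<Longrightarrow> F c N (z + of_real T * \<i>) = F c N z"
proof -
  assume "z \<in> C"
  have "closure O' = C"
  proof
    show "closure O' \<subseteq> C"
    proof (rule closure_minimal[OF O_subset])
      have "C = {z. s\<^sub>1 \<le> Re z} \<inter> {z. Re z \<le> s\<^sub>2}" by (auto simp: closed_band_def)
      then show "closed C" by (simp add: closed_Int closed_halfspace_Re_ge closed_halfspace_Re_le)
    qed
  qed (rule closure_O)
  moreover have "continuous_on C (\<lambda>z. F c N (z + of_real T * \<i>) - F c N z)"
  proof (intro continuous_on_diff F_continuous)
    show "continuous_on C (\<lambda>z. F c N (z + of_real T * \<i>))"
      by (rule continuous_on_compose2[OF F_continuous]) (use shift_C in \<open>auto intro!: continuous_intros\<close>)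
  qed
  ultimately have "continuous_on (closure O') (\<lambda>z. F c N (z + of_real T * \<i>) - F c N z)" "z \<in> closure O'"
    using \<open>z \<in> C\<close> by simp_all
  from continuous_constant_on_closure[OF this(1) _ this(2), of 0]
  have "F c N (z + of_real T * \<i>) - F c N z = 0" using F_periodic_O by simp
  then show ?thesis by simp
qed

text \<open>A compact period rectangle, standing in for the quotient band.\<close>

definition "R = {z. s\<^sub>1 \<le> Re z \<and> Re z \<le> s\<^sub>2 \<and> 0 \<le> Im z \<and> Im z \<le> T}"

lemma R: "compact R" "R \<noteq> {}" "R \<subseteq> C"
proof -
  have "R = cbox (Complex s\<^sub>1 0) (Complex s\<^sub>2 T)" by (auto simp: R_def in_cbox_complex_iff)
  then show "compact R" by simp
  have "of_real s\<^sub>1 \<in> R" using band by (simp add: R_def)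
  then show "R \<noteq> {}" by blast
  show "R \<subseteq> C" by (auto simp: R_def closed_band_def)
qed

lemma F_translate:
  assumes "z \<in> C"
  obtains w where "w \<in> R" "F c N w = F c N z"
proof -
  have shift: "z + of_int n * of_real T * \<i> \<in> C" if "z \<in> C" for z n
    using that by (auto simp: closed_band_def)
  have nat: "F c N (z + of_nat n * of_real T * \<i>) = F c N z" if "z \<in> C" for z n
  proof (induction n)
    case (Suc n)
    have "z + of_nat n * of_real T * \<i> \<in> C" using shift[OF that, of "int n"] by simp
    from F_periodic[OF this, of c N] Suc show ?case by (simp add: algebra_simps)
  qed simp
  have int: "F c N (z + of_int n * of_real T * \<i>) = F c N z" for n
  proof (cases "n \<ge> 0")
    case True
    then show ?thesis using nat[OF assms, of "nat n"] by simp
  next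
    case False
    then show ?thesis using nat[OF shift[OF assms], of n "nat (- n)"]
      by (simp add: of_nat_nat algebra_simps)
  qed
  obtain n :: int where "0 \<le> Im z + of_int n * T" "Im z + of_int n * T \<le> T"
    using ex_int_shift[OF band(2)] by blast
  then have "z + of_int n * of_real T * \<i> \<in> R" using assms by (simp add: R_def closed_band_def)
  then show ?thesis using int that by blast
qed

text \<open>A bound on the rectangle is first spread over the closed band by periodicity, since
  discs around p may leave the rectangle at its top or bottom. Only the part beyond an edge then
  calls for reflection.\<close>

lemma F_estimate:
  assumes "p \<in> R"
  obtains \<delta> where "\<delta> > 0" "\<And>c N. F c N holomorphic_on ball p \<delta>"
    "\<And>c N M z. (\<And>w. w \<in> R \<Longrightarrow> norm (F c N w) \<le> M) \<Longrightarrow> z \<in> ball p \<delta> \<Longrightarrow> norm (F c N z) \<le> 7 * M"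
proof -
  have bound: "norm (F c N z) \<le> M" if "\<And>w. w \<in> R \<Longrightarrow> norm (F c N w) \<le> M" "z \<in> C" for c N M z
    using F_translate[OF that(2)] that(1) by metis
  have pC: "p \<in> C" using assms R(3) by blast
  have hol: "F c N holomorphic_on S" if "\<eta> holomorphic_on S" "open S" for S c N
  proof -
    have "\<eta> analytic_on S" using that by (simp add: analytic_on_open)
    then have "F c N analytic_on S" unfolding F_def[abs_def] by (intro analytic_intros eval_diff_poly_analytic)
    then show ?thesis by (rule analytic_imp_holomorphic)
  qed
  show thesis
  proof (cases "p \<in> O'")
    case True
    then obtain \<delta> where \<delta>: "\<delta> > 0" "ball p \<delta> \<subseteq> O'" using open_O openE by blast
    show ?thesis
    proof (rule that[OF \<delta>(1)])
      show "F c N holomorphic_on ball p \<delta>" for c N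
        by (rule hol) (use \<delta>(2) deriv_g_nonzero holomorphic_on_subset[OF g_holomorphic_O] in \<open>auto intro!: \<eta>_holomorphic\<close>)
      fix c N M z assume M: "\<And>w. w \<in> R \<Longrightarrow> norm (F c N w) \<le> M" and z: "z \<in> ball p \<delta>"
      have "z \<in> C" using z \<delta>(2) O_subset by blast
      from bound[OF M this] have "norm (F c N z) \<le> M" .
      then show "norm (F c N z) \<le> 7 * M" using norm_ge_zero[of "F c N z"] by linarith
    qed
  next
    case False
    then have "Re p = s\<^sub>1 \<or> Re p = s\<^sub>2" using pC by (auto simp: O'_def closed_band_def)
    then obtain \<sigma> where side: "side (Re p) \<sigma>" by (rule line_side)
    show ?thesis
    proof (rule boundary_dichotomy[OF side refl])
      fix \<rho>
      assume \<rho>: "0 < \<rho>" "\<rho> \<le> s\<^sub>2 - s\<^sub>1" and g: "g holomorphic_on ball p \<rho>"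
        "\<And>z. z \<in> ball p \<rho> \<Longrightarrow> deriv g z \<noteq> 0"
        and dich: "(\<forall>z\<in>ball p \<rho>. \<eta> z = reflect (Re p) \<eta> z) \<or>
        (\<exists>P. \<forall>z\<in>ball p \<rho>. (P has_field_derivative (\<eta> z)\<^sup>2 - (reflect (Re p) \<eta> z)\<^sup>2) (at z) \<and>
           deriv \<eta> z - reflect (Re p) (deriv \<eta>) z = P z * (\<eta> z - reflect (Re p) \<eta> z))"
      have hol\<eta>: "\<eta> holomorphic_on ball p \<rho>" by (rule \<eta>_holomorphic[OF g(1) open_ball g(2)])
      show ?thesis
      proof (rule mkdv_combination_estimate[OF hol\<eta> refl \<rho>(1) dich, of \<sigma>])
        fix \<delta>
        assume \<delta>: "0 < \<delta>" "\<delta> \<le> \<rho>"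
          and est: "\<And>c N M z. \<lbrakk>\<And>z. z \<in> ball p \<rho> \<Longrightarrow> 0 \<le> \<sigma> * (Re z - Re p) \<Longrightarrow>
              norm (\<Sum>j\<le>N. of_real (c j) * eval_diff_poly (mkdv_seq j) \<eta> z) \<le> M; z \<in> ball p \<delta>\<rbrakk>
            \<Longrightarrow> norm (\<Sum>j\<le>N. of_real (c j) * eval_diff_poly (mkdv_seq j) \<eta> z) \<le> 7 * M"
        show ?thesis
        proof (rule that[OF \<delta>(1)])
          show "F c N holomorphic_on ball p \<delta>" for c N
            by (rule hol[OF holomorphic_on_subset[OF hol\<eta>]]) (use \<delta> in auto)
          fix c N M z assume M: "\<And>w. w \<in> R \<Longrightarrow> norm (F c N w) \<le> M" and z: "z \<in> ball p \<delta>"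
          show "norm (F c N z) \<le> 7 * M"
            unfolding F_def
          proof (rule est[OF _ z])
            fix w assume w: "w \<in> ball p \<rho>" "0 \<le> \<sigma> * (Re w - Re p)"
            then have "w \<in> ball p (s\<^sub>2 - s\<^sub>1)" using \<rho> by auto
            then have "w \<in> C" using side_O(2)[OF side refl] w(2) by blast
            from bound[OF M this] show "norm (\<Sum>j\<le>N. of_real (c j) * eval_diff_poly (mkdv_seq j) \<eta> w) \<le> M"
              unfolding F_def .
          qed
        qed
      qed
    qed
  qed
qed

lemma linear_dependence: "\<exists>c N. (\<exists>j\<le>N. c j \<noteq> 0) \<and> (\<forall>z\<in>C. F c N z = 0)"
proof -
  have "\<exists>c N. (\<exists>j\<le>N. c j \<noteq> 0) \<and> (\<forall>z\<in>R. (\<Sum>j\<le>N. of_real (c j) * eval_diff_poly (mkdv_seq j) \<eta> z) = 0)"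
  proof (rule linear_dependence_of_estimate[OF R(1,2)])
    show "eval_diff_poly (mkdv_seq n) \<eta> analytic_on R" for n
      by (rule eval_diff_poly_analytic[OF analytic_on_subset[OF \<eta>_analytic R(3)]])
    fix p assume p: "p \<in> R"
    show "\<exists>\<delta>>0. \<forall>c N M. (\<forall>z\<in>R. norm (\<Sum>j\<le>N. of_real (c j) * eval_diff_poly (mkdv_seq j) \<eta> z) \<le> M) \<longrightarrow>
       (\<lambda>z. \<Sum>j\<le>N. of_real (c j) * eval_diff_poly (mkdv_seq j) \<eta> z) holomorphic_on ball p \<delta> \<and>
       (\<forall>z\<in>ball p \<delta>. norm (\<Sum>j\<le>N. of_real (c j) * eval_diff_poly (mkdv_seq j) \<eta> z) \<le> 7 * M)"
      unfolding F_def[symmetric]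
    proof (rule F_estimate[OF p])
      fix \<delta>
      assume \<delta>: "\<delta> > 0" and hol: "\<And>c N. F c N holomorphic_on ball p \<delta>"
        and est: "\<And>c N M z. (\<And>w. w \<in> R \<Longrightarrow> norm (F c N w) \<le> M) \<Longrightarrow> z \<in> ball p \<delta> \<Longrightarrow> norm (F c N z) \<le> 7 * M"
      show "\<exists>\<delta>>0. \<forall>c N M. (\<forall>z\<in>R. norm (F c N z) \<le> M) \<longrightarrow>
         F c N holomorphic_on ball p \<delta> \<and> (\<forall>z\<in>ball p \<delta>. norm (F c N z) \<le> 7 * M)"
      proof (intro exI[of _ \<delta>] conjI allI impI ballI \<delta> hol)
        fix c N M z assume M: "\<forall>z\<in>R. norm (F c N z) \<le> M" and z: "z \<in> ball p \<delta>"
        show "norm (F c N z) \<le> 7 * M" by (rule est[OF bspec[OF M] z])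
      qed
    qed
  qed
  then obtain c N where c: "\<exists>j\<le>N. c j \<noteq> 0" "\<And>z. z \<in> R \<Longrightarrow> F c N z = 0" unfolding F_def by blast
  have "F c N z = 0" if "z \<in> C" for z using F_translate[OF that] c(2) by metis
  then show ?thesis using c(1) by blast
qed

theorem algebro_geometric: "algebro_geometric_potential C \<eta>"
  unfolding algebro_geometric_potential_def
proof
  show "\<eta> meromorphic_on C" by (rule analytic_on_imp_meromorphic_on[OF \<eta>_analytic])
  obtain c N where c: "\<exists>j\<le>N. c j \<noteq> 0" and F0: "\<And>z. z \<in> C \<Longrightarrow> F c N z = 0"
    using linear_dependence by blast
  \<comment> \<open>The last nonzero coefficient: dividing by it expresses Q_m through the lower
    Q_j, with additive constant 0.\<close>
  define m where "m = Max {j. j \<le> N \<and> c j \<noteq> 0}"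
  have fin: "finite {j. j \<le> N \<and> c j \<noteq> 0}" by simp
  have m: "m \<le> N" "c m \<noteq> 0" using Max_in[OF fin] c unfolding m_def by blast+
  have above: "c j = 0" if "m < j" "j \<le> N" for j
  proof (rule ccontr)
    assume "c j \<noteq> 0"
    then have "j \<le> m" unfolding m_def using that by (intro Max_ge[OF fin]) simp
    then show False using that by simp
  qed
  let ?q = "\<lambda>j z. eval_diff_poly (mkdv_seq j) \<eta> z"
  have "?q m z = 0 + (\<Sum>j<m. of_real (- c j / c m) * ?q j z)" if "z \<in> C" for z
  proof -
    have "0 = (\<Sum>j\<le>N. of_real (c j) * ?q j z)" using F0[OF that] by (simp add: F_def)
    also have "\<dots> = (\<Sum>j\<le>m. of_real (c j) * ?q j z)"
      by (rule sum.mono_neutral_right) (use m above in auto)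
    also have "\<dots> = (\<Sum>j<m. of_real (c j) * ?q j z) + of_real (c m) * ?q m z"
      by (simp flip: lessThan_Suc_atMost)
    finally have "of_real (c m) * ?q m z = - (\<Sum>j<m. of_real (c j) * ?q j z)"
      by (simp add: eq_neg_iff_add_eq_0 add.commute)
    then have "?q m z = - (\<Sum>j<m. of_real (c j) * ?q j z) / of_real (c m)"
      using m(2) by (simp add: field_simps)
    also have "\<dots> = 0 + (\<Sum>j<m. of_real (- c j / c m) * ?q j z)"
      by (simp add: sum_negf sum_divide_distrib)
    finally show ?thesis .
  qed
  then show "\<exists>m a c. \<forall>z\<in>C. \<eta> analytic_on {z} \<longrightarrow>
      eval_diff_poly (mkdv_Q m) \<eta> z = a + (\<Sum>j<m. c j * eval_diff_poly (mkdv_Q j) \<eta> z)"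
    unfolding mkdv_Q_eq_seq
    by (intro exI[of _ m] exI[of _ 0] exI[of _ "\<lambda>j. of_real (- c j / c m)"]) blast
qed

end

theorem corollary10p9:
  fixes \<Omega> :: "complex set" and u :: "complex \<Rightarrow> real" and g :: "complex \<Rightarrow> complex"
    and s\<^sub>1 s\<^sub>2 T :: real
  assumes "serrin_ring_domain \<Omega> u \<or> capillary_ring_domain \<Omega> u"
    and "\<not> paraboloid_on \<Omega> u"
    and "developing_map \<Omega> s\<^sub>1 s\<^sub>2 T g"
  shows "algebro_geometric_potential (closed_band s\<^sub>1 s\<^sub>2)
           (\<lambda>z. deriv (deriv g) z / (2 * deriv g z))"
proof -
  have cap: "capillary_ring_domain \<Omega> u" using assms(1) capillary_of_serrin by blast
  then obtain G where "\<forall>z\<in>closure \<Omega>. (u has_derivative (\<lambda>h. h \<bullet> G z)) (at z within closure \<Omega>)"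
    "continuous_on (closure \<Omega>) G"
    "\<forall>z\<in>\<Omega>. \<exists>G'. (G has_derivative G') (at z) \<and> (\<Sum>b\<in>Basis. G' b \<bullet> b) + 2 = 0"
    unfolding capillary_ring_domain_def torsion_solution_def by (elim conjE exE) (rule that)
  then interpret capillary_band \<Omega> u g G s\<^sub>1 s\<^sub>2 T
    using cap assms(2,3) by unfold_locales (simp_all add: capillary_ring_domain_def)
  show ?thesis using algebro_geometric unfolding \<eta>_def[abs_def] .
qed

end
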